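(* For every $k\geq 3$, $$\lim_{N\to\infty}\sqrt[N]{|S_{k,N}|}=\lim_{N\to\infty}\sqrt[N]{|S_{k,N}\setminus P_{k,N}|}=2k-3.$$
   Context: $F_k$ is the free group on $X=\{x_1,\dots,x_k\}$; elements are represented by reduced words in $X^{\pm1}$, and the length of an element is the length of its reduced word. An element of $F_k$ is primitive if it belongs to some free generating set (basis) of $F_k$. $P_{k,N}$ is the set of primitive elements of $F_k$ of word length $N$. $S_{k,N}$ is the set of elements of $F_k$ of word length $N$ that are contained in a proper free factor of $F_k$ (so $P_{k,N}\subseteq S_{k,N}$ for $k\ge2$). *)

theory Defs
  imports Complex_Main "HOL-Algebra.Group"
begin

section \<open>Free groups as groups of reduced words\<close>

text \<open>The letter \<open>(x, True)\<close> stands for the generator \<open>x\<close>, and \<open>(x, False)\<close> for its formal inverse.\<close>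

type_synonym 'a letter = "'a \<times> bool"
type_synonym 'a word = "'a letter list"

fun inv_letter :: "'a letter \<Rightarrow> 'a letter" where
  "inv_letter (x, e) = (x, \<not> e)"

definition reduced :: "'a word \<Rightarrow> bool" where
  "reduced w \<longleftrightarrow> successively (\<lambda>a b. b \<noteq> inv_letter a) w"

definition reduced_words :: "'a set \<Rightarrow> 'a word set" where
  "reduced_words X = {w. set w \<subseteq> X \<times> UNIV \<and> reduced w}"

fun push :: "'a letter \<Rightarrow> 'a word \<Rightarrow> 'a word" where
  "push a [] = [a]"
| "push a (b # w) = (if b = inv_letter a then w else a # b # w)"

text \<open>For reduced words \<open>u\<close> and \<open>v\<close>, the word \<open>foldr push u v\<close> is the reduced form of \<open>u @ v\<close>.\<close>

definition free_group :: "'a set \<Rightarrow> 'a word monoid" where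
  "free_group X = \<lparr>carrier = reduced_words X, monoid.mult = foldr push, one = []\<rparr>"

lemma inv_letter_inv_letter [simp]: "inv_letter (inv_letter a) = a"
  by (cases a) simp

lemma reduced_push: "reduced w \<Longrightarrow> reduced (push a w)"
  by (cases w) (auto simp: reduced_def successively_Cons)

lemma reduced_foldr_push: "reduced w \<Longrightarrow> reduced (foldr push u w)"
  by (induction u) (auto intro: reduced_push)

lemma set_push: "set (push a w) \<subseteq> insert a (set w)"
  by (cases w) auto

lemma set_foldr_push: "set (foldr push u w) \<subseteq> set u \<union> set w"
proof (induction u)
  case (Cons a u)
  then show ?case using set_push[of a "foldr push u w"] by auto
qed simp

lemma push_push_inv: "reduced w \<Longrightarrow> push a (push (inv_letter a) w) = w"
  by (induction w rule: induct_list012) (auto simp: reduced_def)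

lemma foldr_push_push:
  assumes "reduced w"
  shows "foldr push (push a v) w = push a (foldr push v w)"
  by (cases v) (auto simp: push_push_inv reduced_foldr_push assms)

lemma foldr_push_assoc:
  "reduced w \<Longrightarrow> foldr push (foldr push u v) w = foldr push u (foldr push v w)"
  by (induction u) (auto simp: foldr_push_push)

lemma foldr_push_Nil: "reduced w \<Longrightarrow> foldr push w [] = w"
proof (induction w)
  case (Cons a w)
  then show ?case by (cases w) (auto simp: reduced_def successively_Cons)
qed simp

lemma foldr_push_inv:
  assumes "reduced v"
  shows "foldr push (rev (map inv_letter u)) (foldr push u v) = v"
proof (induction u)
  case (Cons a u)
  then show ?case
    using push_push_inv[of "foldr push u v" "inv_letter a"] reduced_foldr_push[OF assms]
    by simp
qed (simp add: assms)

lemma reduced_inv: "reduced u \<Longrightarrow> reduced (rev (map inv_letter u))"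
proof -
  assume "reduced u"
  moreover have "(a = inv_letter b) = (b = inv_letter a)" for a b :: "'a letter"
    by (metis inv_letter_inv_letter)
  ultimately show ?thesis
    by (auto simp: reduced_def successively_rev successively_map elim!: successively_mono)
qed

lemma group_free_group: "group (free_group X)"
proof (rule groupI)
  fix u v w
  assume "u \<in> carrier (free_group X)" "v \<in> carrier (free_group X)" "w \<in> carrier (free_group X)"
  then show "u \<otimes>\<^bsub>free_group X\<^esub> v \<otimes>\<^bsub>free_group X\<^esub> w = u \<otimes>\<^bsub>free_group X\<^esub> (v \<otimes>\<^bsub>free_group X\<^esub> w)"
    by (simp add: free_group_def reduced_words_def foldr_push_assoc)
next
  fix u assume u: "u \<in> carrier (free_group X)"
  show "\<exists>v\<in>carrier (free_group X). v \<otimes>\<^bsub>free_group X\<^esub> u = \<one>\<^bsub>free_group X\<^esub>"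
  proof
    show "rev (map inv_letter u) \<in> carrier (free_group X)"
      using u by (auto simp: free_group_def reduced_words_def reduced_inv)
    show "rev (map inv_letter u) \<otimes>\<^bsub>free_group X\<^esub> u = \<one>\<^bsub>free_group X\<^esub>"
      using u foldr_push_inv[of "[]" u]
      by (simp add: free_group_def reduced_words_def foldr_push_Nil reduced_def)
  qed
next
  fix u v
  assume "u \<in> carrier (free_group X)" "v \<in> carrier (free_group X)"
  then show "u \<otimes>\<^bsub>free_group X\<^esub> v \<in> carrier (free_group X)"
    using set_foldr_push[of u v]
    by (auto simp: free_group_def reduced_words_def reduced_foldr_push)
qed (auto simp: free_group_def reduced_words_def reduced_def)

section \<open>Bases, primitive elements and free factors\<close>

definition list_prod :: "('g, 'm) monoid_scheme \<Rightarrow> 'g list \<Rightarrow> 'g" where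
  "list_prod G gs = foldr (\<lambda>g h. g \<otimes>\<^bsub>G\<^esub> h) gs \<one>\<^bsub>G\<^esub>"

definition word_value :: "('g, 'm) monoid_scheme \<Rightarrow> 'g word \<Rightarrow> 'g" where
  "word_value G w = list_prod G (map (\<lambda>(b, e). if e then b else inv\<^bsub>G\<^esub> b) w)"

text \<open>\<open>B\<close> is a free generating set of \<open>G\<close> if every element of \<open>G\<close> is the value of exactly one
  reduced word in \<open>B\<close> and its formal inverses.\<close>

definition free_basis :: "('g, 'm) monoid_scheme \<Rightarrow> 'g set \<Rightarrow> bool" where
  "free_basis G B \<longleftrightarrow>
     B \<subseteq> carrier G \<and> bij_betw (word_value G) (reduced_words B) (carrier G)"

definition primitive_element :: "('g, 'm) monoid_scheme \<Rightarrow> 'g \<Rightarrow> bool" where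
  "primitive_element G g \<longleftrightarrow> (\<exists>B. free_basis G B \<and> g \<in> B)"

text \<open>\<open>G\<close> is the internal free product of its subgroups \<open>H\<close> and \<open>K\<close> if every element has exactly
  one normal form: a product of nontrivial elements taken alternately from \<open>H\<close> and \<open>K\<close>, the empty
  product representing the identity. The condition \<open>H \<inter> K = {\<one>}\<close> is needed in order that each
  entry of an alternating list belongs to only one of the two factors.\<close>

definition alternating_lists ::
    "('g, 'm) monoid_scheme \<Rightarrow> 'g set \<Rightarrow> 'g set \<Rightarrow> 'g list set" where
  "alternating_lists G H K =
     {gs. set gs \<subseteq> (H \<union> K) - {\<one>\<^bsub>G\<^esub>} \<and>
          successively (\<lambda>g h. (g \<in> H \<and> h \<in> K) \<or> (g \<in> K \<and> h \<in> H)) gs}"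

definition internal_free_product ::
    "('g, 'm) monoid_scheme \<Rightarrow> 'g set \<Rightarrow> 'g set \<Rightarrow> bool" where
  "internal_free_product G H K \<longleftrightarrow>
     subgroup H G \<and> subgroup K G \<and> H \<inter> K = {\<one>\<^bsub>G\<^esub>} \<and>
     bij_betw (list_prod G) (alternating_lists G H K) (carrier G)"

definition free_factor :: "('g, 'm) monoid_scheme \<Rightarrow> 'g set \<Rightarrow> bool" where
  "free_factor G H \<longleftrightarrow> (\<exists>K. internal_free_product G H K)"

definition proper_free_factor :: "('g, 'm) monoid_scheme \<Rightarrow> 'g set \<Rightarrow> bool" where
  "proper_free_factor G H \<longleftrightarrow> free_factor G H \<and> H \<noteq> carrier G"

section \<open>Spheres in the free group of rank \<open>k\<close>\<close>

definition free_group_rank :: "nat \<Rightarrow> nat word monoid" where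
  "free_group_rank k = free_group {1..k}"

text \<open>These are \<open>P\<^sub>k\<^sub>,\<^sub>N\<close> and \<open>S\<^sub>k\<^sub>,\<^sub>N\<close> in the usual notation.\<close>

definition primitives_of_length :: "nat \<Rightarrow> nat \<Rightarrow> nat word set" where
  "primitives_of_length k N =
     {w \<in> carrier (free_group_rank k). length w = N \<and> primitive_element (free_group_rank k) w}"

definition factor_elements_of_length :: "nat \<Rightarrow> nat \<Rightarrow> nat word set" where
  "factor_elements_of_length k N =
     {w \<in> carrier (free_group_rank k). length w = N \<and>
          (\<exists>H. proper_free_factor (free_group_rank k) H \<and> w \<in> H)}"

lemma finite_factor_elements_of_length: "finite (factor_elements_of_length k N)"
proof (rule finite_subset)
  show "factor_elements_of_length k N \<subseteq> {w. set w \<subseteq> {1..k} \<times> UNIV \<and> length w = N}"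
    by (auto simp: factor_elements_of_length_def free_group_rank_def free_group_def reduced_words_def)
qed (intro finite_lists_length_eq finite_cartesian_product finite_UNIV finite_atLeastAtMost)

end

theory Submission
  imports Defs "HOL-Algebra.Coset"
begin

text \<open>
  Upper bound. Let \<open>F = H * K\<close> with \<open>K\<close> nontrivial and \<open>w \<in> H\<close>. Join the core graphs of
  \<open>H\<close> and \<open>K\<close> at their base points. The result has rank at most \<open>k\<close>, its closed walks represent
  all of \<open>F\<close>, and the walk of \<open>w\<close> covers a subgraph of rank at most \<open>k - 1\<close>. Stallings folds
  transform this graph into the rose with \<open>k\<close> petals. Each of them removes few edges, and the
  cyclically reduced part of \<open>w\<close> labels a closed walk in every graph on the way. Hence, for every
  \<open>m\<close>, it covers a graph of rank at most \<open>k - 1\<close> with less than \<open>m\<close> edges or a graph of rank at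
  most \<open>k\<close> with about \<open>m\<close> edges. For fixed \<open>m\<close> these graphs are finite in number.
  In the first case all degrees are at most \<open>2 * k - 2\<close>, so that a reduced walk has at most
  \<open>2 * k - 3\<close> continuations at each vertex. In the second case at most one vertex \<open>p\<close> has a larger
  degree. For large \<open>m\<close>, the closed reduced walks at \<open>p\<close> of bounded length \<open>L\<close> cover a proper
  subgraph, which has smaller rank and therefore degree at most \<open>2 * k - 2\<close> at \<open>p\<close>. So there are at
  most \<open>O(L * (2 * k - 3) ^ L)\<close> reduced walks of length \<open>L\<close> from a given dart, with a constant that
  depends only on \<open>k\<close>, and this gives growth rates arbitrarily close to \<open>2 * k - 3\<close>. Conjugation
  does not change the rate because \<open>2 * k \<le> (2 * k - 3) ^ 2\<close>.

  Lower bound. A reduced word in the first \<open>k - 1\<close> generators can be extended by a word of bounded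
  length so that all exponent sums become divisible by 3. Then every homomorphism to the integers
  takes a value divisible by 3, whereas for a primitive element some value is 1.
\<close>

section \<open>Labelled graphs and walks\<close>

text \<open>The obstacle is uniformity over \<open>H\<close>. A single leafless graph of rank at
  most \<open>k - 1\<close> has at most a constant times \<open>(2 * k - 3) ^ n\<close> reduced
  walks, but there are infinitely many proper free factors, with arbitrarily large graphs, so the
  constants cannot be summed. Two degrees of at least \<open>2 * k - 1\<close> would exceed the
  bound \<open>2 * k + 2\<close> for their sum once \<open>k \<ge> 3\<close>; this is why a single
  exceptional vertex remains. That the ranks of two complementary factors add up to at most
  \<open>k\<close> is obtained by counting homomorphisms to the group of order two. This takes only
  the universal property of the normal forms, and no basis of \<open>H\<close> or \<open>K\<close>.
  The modulus in the lower bound is odd for a reason: the exponent sums of a word add up to its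
  length modulo 2, so even exponent sums would rule out all odd lengths.\<close>

text \<open>An edge is represented by two opposite darts. Numbers of edges are therefore doubled below:
  \<open>card D + 2 \<le> 2 * card (verts D) + 2 * k\<close> says that a connected graph \<open>D\<close> has rank at
  most \<open>k\<close>.\<close>

type_synonym ('v, 'a) dart = "'v \<times> 'a letter \<times> 'v"

abbreviation lab :: "('v, 'a) dart \<Rightarrow> 'a letter" where "lab d \<equiv> fst (snd d)"
abbreviation tgt :: "('v, 'a) dart \<Rightarrow> 'v" where "tgt d \<equiv> snd (snd d)"

definition rev_dart :: "('v, 'a) dart \<Rightarrow> ('v, 'a) dart" where
  "rev_dart d = (tgt d, inv_letter (lab d), fst d)"

definition dart_graph :: "('v, 'a) dart set \<Rightarrow> bool" where
  "dart_graph D \<longleftrightarrow> finite D \<and> rev_dart ` D \<subseteq> D"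

definition verts :: "('v, 'a) dart set \<Rightarrow> 'v set" where
  "verts D = fst ` D"

definition out_darts :: "('v, 'a) dart set \<Rightarrow> 'v \<Rightarrow> ('v, 'a) dart set" where
  "out_darts D v = {d \<in> D. fst d = v}"

fun walk :: "('v, 'a) dart set \<Rightarrow> 'v \<Rightarrow> ('v, 'a) dart list \<Rightarrow> 'v \<Rightarrow> bool" where
  "walk D a [] c \<longleftrightarrow> a = c"
| "walk D a (d # p) c \<longleftrightarrow> d \<in> D \<and> fst d = a \<and> walk D (tgt d) p c"

fun reads :: "('v, 'a) dart set \<Rightarrow> 'v \<Rightarrow> 'a word \<Rightarrow> 'v \<Rightarrow> bool" where
  "reads D a [] c \<longleftrightarrow> a = c"
| "reads D a (l # w) c \<longleftrightarrow> (\<exists>b. (a, l, b) \<in> D \<and> reads D b w c)"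

definition deterministic :: "('v, 'a) dart set \<Rightarrow> bool" where
  "deterministic D \<longleftrightarrow> (\<forall>d\<in>D. \<forall>d'\<in>D. fst d = fst d' \<longrightarrow> lab d = lab d' \<longrightarrow> tgt d = tgt d')"

text \<open>Closed vertex sets replace paths here. For symmetric dart sets this is ordinary
  connectedness; it passes to images directly and yields at once a dart that leaves a given proper
  vertex set.\<close>

definition conn :: "('v, 'a) dart set \<Rightarrow> bool" where
  "conn D \<longleftrightarrow> (\<forall>S. S \<noteq> {} \<longrightarrow> S \<subseteq> verts D \<longrightarrow> (\<forall>d\<in>D. fst d \<in> S \<longrightarrow> tgt d \<in> S) \<longrightarrow> S = verts D)"

definition sym_closure :: "('v, 'a) dart set \<Rightarrow> ('v, 'a) dart set" where
  "sym_closure P = P \<union> rev_dart ` P"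

definition map_dart :: "('v \<Rightarrow> 'u) \<Rightarrow> ('v, 'a) dart \<Rightarrow> ('u, 'a) dart" where
  "map_dart f d = (f (fst d), lab d, f (tgt d))"

lemma inv_letter_neq [simp]: "inv_letter l \<noteq> l" "l \<noteq> inv_letter l"
  by (cases l; auto)+

lemma snd_inv_letter [simp]: "snd (inv_letter l) \<longleftrightarrow> \<not> snd l"
  by (cases l) auto

lemma fst_inv_letter [simp]: "fst (inv_letter l) = fst l"
  by (cases l) auto

text \<open>No dart is its own reverse, not even a loop, because a letter differs from its inverse.
  So counting darts counts every edge exactly twice.\<close>

lemma rev_dart_simps [simp]:
  "fst (rev_dart d) = tgt d" "lab (rev_dart d) = inv_letter (lab d)" "tgt (rev_dart d) = fst d"
  "rev_dart (rev_dart d) = d" "rev_dart d \<noteq> d" "d \<noteq> rev_dart d"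
  by (auto simp: rev_dart_def prod_eq_iff)

lemma inj_rev_dart: "inj_on rev_dart D"
  by (metis inj_onI rev_dart_simps(4))

lemma map_dart_simps [simp]:
  "fst (map_dart f d) = f (fst d)" "lab (map_dart f d) = lab d" "tgt (map_dart f d) = f (tgt d)"
  by (auto simp: map_dart_def)

lemma rev_map_dart: "rev_dart (map_dart f d) = map_dart f (rev_dart d)"
  by (simp add: prod_eq_iff)

lemma dart_graphD: "dart_graph D \<Longrightarrow> finite D" "dart_graph D \<Longrightarrow> d \<in> D \<Longrightarrow> rev_dart d \<in> D"
  by (auto simp: dart_graph_def)

lemma rev_dart_mem_iff: "dart_graph D \<Longrightarrow> rev_dart d \<in> D \<longleftrightarrow> d \<in> D"
  by (metis dart_graphD(2) rev_dart_simps(4))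

lemma fst_in_verts: "d \<in> D \<Longrightarrow> fst d \<in> verts D"
  by (simp add: verts_def)

lemma tgt_in_verts: "dart_graph D \<Longrightarrow> d \<in> D \<Longrightarrow> tgt d \<in> verts D"
  by (metis dart_graphD(2) fst_in_verts rev_dart_simps(1))

lemma finite_verts: "dart_graph D \<Longrightarrow> finite (verts D)"
  by (simp add: verts_def dart_graphD)

lemma inj_on_map_dart:
  assumes "dart_graph D" "inj_on f (verts D)" shows "inj_on (map_dart f) D"
proof (rule inj_onI)
  fix d e assume de: "d \<in> D" "e \<in> D" and eq: "map_dart f d = map_dart f e"
  have "f (fst d) = f (fst e)" "f (tgt d) = f (tgt e)" and l: "lab d = lab e"
    using eq unfolding map_dart_def by simp_all
  then have "fst d = fst e" "tgt d = tgt e"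
    using de by (auto intro: inj_onD[OF assms(2)] fst_in_verts tgt_in_verts[OF assms(1)])
  with l show "d = e" by (cases d, cases e) simp
qed

lemma verts_map: "verts (map_dart f ` D) = f ` verts D"
  by (simp add: verts_def image_image)

lemma verts_mono: "W \<subseteq> D \<Longrightarrow> verts W \<subseteq> verts D"
  by (auto simp: verts_def)

lemma verts_Un: "verts (A \<union> B) = verts A \<union> verts B"
  by (auto simp: verts_def)

lemma verts_sym_closure: "verts (sym_closure P) = fst ` P \<union> tgt ` P"
  by (simp add: verts_def sym_closure_def image_Un image_image)

lemma dart_graph_sym_closure: "finite P \<Longrightarrow> dart_graph (sym_closure P)"
  by (auto simp: dart_graph_def sym_closure_def)

lemma sym_closure_subset: "dart_graph D \<Longrightarrow> P \<subseteq> D \<Longrightarrow> sym_closure P \<subseteq> D"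
  by (auto simp: sym_closure_def dart_graph_def)

lemma subset_sym_closure: "P \<subseteq> sym_closure P"
  by (auto simp: sym_closure_def)

lemma sym_closure_map: "sym_closure (map_dart f ` P) = map_dart f ` sym_closure P"
  by (simp add: sym_closure_def image_Un image_image rev_map_dart)

lemma dart_graph_map: "dart_graph D \<Longrightarrow> dart_graph (map_dart f ` D)"
  by (auto simp: dart_graph_def rev_map_dart)

lemma dart_graph_Un: "dart_graph A \<Longrightarrow> dart_graph B \<Longrightarrow> dart_graph (A \<union> B)"
  by (auto simp: dart_graph_def)

lemma walk_append: "walk D a (p @ q) c \<longleftrightarrow> (\<exists>b. walk D a p b \<and> walk D b q c)"
  by (induction p arbitrary: a) auto

lemma walk_set: "walk D a p c \<Longrightarrow> set p \<subseteq> D"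
  by (induction p arbitrary: a) auto

lemma walk_restrict: "walk D a p c \<Longrightarrow> set p \<subseteq> W \<Longrightarrow> walk W a p c"
  by (induction p arbitrary: a) auto

lemma walk_mono: "walk D a p c \<Longrightarrow> D \<subseteq> E \<Longrightarrow> walk E a p c"
  by (induction p arbitrary: a) auto

lemma walk_map: "walk D a p c \<Longrightarrow> walk (map_dart f ` D) (f a) (map (map_dart f) p) (f c)"
  by (induction p arbitrary: a) auto

lemma walk_rev:
  assumes "dart_graph D"
  shows "walk D a p c \<Longrightarrow> walk D c (rev (map rev_dart p)) a"
  by (induction p arbitrary: a) (auto simp: walk_append dart_graphD[OF assms])

lemma walk_reads: "walk D a p c \<Longrightarrow> reads D a (map lab p) c"
proof (induction p arbitrary: a)
  case (Cons d p)
  then have "(a, lab d, tgt d) \<in> D" "reads D (tgt d) (map lab p) c" by auto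
  then show ?case by (simp only: list.map reads.simps) blast
qed simp

lemma reads_walkE:
  assumes "reads D a w c"
  obtains p where "walk D a p c" "map lab p = w"
proof -
  have "reads D a w c \<Longrightarrow> \<exists>p. walk D a p c \<and> map lab p = w"
  proof (induction w arbitrary: a)
    case (Cons l w)
    then obtain b p where b: "(a, l, b) \<in> D" "walk D b p c \<and> map lab p = w" by fastforce
    then have "walk D a ((a, l, b) # p) c \<and> map lab ((a, l, b) # p) = l # w" by simp
    then show ?case by (rule exI)
  qed simp
  then show ?thesis using assms that by metis
qed

lemma reads_append: "reads D a (u @ w) c \<longleftrightarrow> (\<exists>b. reads D a u b \<and> reads D b w c)"
  by (induction u arbitrary: a) auto

lemma reads_mono: "reads D a w c \<Longrightarrow> D \<subseteq> E \<Longrightarrow> reads E a w c"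
  by (induction w arbitrary: a) auto

lemma reads_map: "reads D a w c \<Longrightarrow> reads (map_dart f ` D) (f a) w (f c)"
proof (induction w arbitrary: a)
  case (Cons l w)
  then obtain b where b: "(a, l, b) \<in> D" "reads (map_dart f ` D) (f b) w (f c)" by auto
  then have "(f a, l, f b) \<in> map_dart f ` D" by (force simp: map_dart_def)
  then show ?case using b(2) by auto
qed simp

lemma reads_inv:
  assumes "dart_graph D"
  shows "reads D a w c \<Longrightarrow> reads D c (rev (map inv_letter w)) a"
proof (induction w arbitrary: a)
  case (Cons l w)
  then obtain b where b: "(a, l, b) \<in> D" "reads D c (rev (map inv_letter w)) b" by auto
  then have "(b, inv_letter l, a) \<in> D"
    using dart_graphD(2)[OF assms b(1)] by (simp add: rev_dart_def)
  then show ?case using b(2) by (auto simp: reads_append)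
qed simp

text \<open>In a folded graph a walk that reads \<open>l\<close> and then
  \<open>inv_letter l\<close> is back where it was, so cancellation does not change the end
  point.\<close>

lemma reads_reduce:
  assumes "dart_graph D" "deterministic D"
  shows "reads D a w c \<Longrightarrow> reads D a (foldr push w []) c"
proof (induction w arbitrary: a)
  case (Cons l w)
  then obtain b where b: "(a, l, b) \<in> D" "reads D b (foldr push w []) c"
    by auto
  show ?case
  proof (cases "foldr push w []")
    case Nil
    then show ?thesis using b by auto
  next
    case (Cons l' v)
    show ?thesis
    proof (cases "l' = inv_letter l")
      case True
      then obtain b' where b': "(b, inv_letter l, b') \<in> D" "reads D b' v c"
        using b Cons by auto
      have "(b, inv_letter l, a) \<in> D" using dart_graphD(2)[OF assms(1) b(1)]
        by (simp add: rev_dart_def)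
      then have "b' = a" using assms(2) b'(1) unfolding deterministic_def by fastforce
      then show ?thesis using Cons True b' by simp
    next
      case False
      then show ?thesis using Cons b by auto
    qed
  qed
qed simp

section \<open>Counting edges and vertices\<close>

lemma card_verts_image_fold:
  assumes "finite V" "x \<in> V" "y \<in> V" "x \<noteq> y"
  shows "card (id(x := y) ` V) + 1 = card V"
proof -
  have "id(x := y) ` V = V - {x}" using assms by auto
  then show ?thesis using card_Suc_Diff1[OF assms(1,2)] by (simp del: fun_upd_image)
qed

lemma sum_deg: "dart_graph D \<Longrightarrow> card D = (\<Sum>v\<in>verts D. card (out_darts D v))"
proof -
  assume D: "dart_graph D"
  have "(\<Union>v\<in>verts D. out_darts D v) = D" by (auto simp: out_darts_def verts_def)
  then have "card D = card (\<Union>v\<in>verts D. out_darts D v)" by simp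
  also have "\<dots> = (\<Sum>v\<in>verts D. card (out_darts D v))"
    by (rule card_UN_disjoint) (auto simp: finite_verts[OF D] out_darts_def dart_graphD[OF D])
  finally show ?thesis .
qed

text \<open>Of two opposite darts exactly one carries a positive letter, so the labels orient the
  graph. Besides making \<open>card D\<close> even, this lets sets of edges be represented by sets
  of positive darts.\<close>

lemma card_positive_darts:
  assumes "dart_graph D"
  shows "card D = 2 * card {d \<in> D. snd (lab d)}"
proof -
  let ?P = "{d \<in> D. snd (lab d)}"
  have "D = ?P \<union> rev_dart ` ?P"
  proof
    show "D \<subseteq> ?P \<union> rev_dart ` ?P"
    proof
      fix d assume "d \<in> D"
      then have "snd (lab d) \<or> (rev_dart d \<in> ?P \<and> d = rev_dart (rev_dart d))"
        using dart_graphD(2)[OF assms] by simp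
      then show "d \<in> ?P \<union> rev_dart ` ?P" using \<open>d \<in> D\<close> by blast
    qed
  qed (use dart_graphD(2)[OF assms] in auto)
  moreover have "?P \<inter> rev_dart ` ?P = {}" by auto
  moreover have "finite ?P" using dart_graphD(1)[OF assms] by simp
  ultimately have "card D = card ?P + card (rev_dart ` ?P)"
    using card_Un_disjoint[of ?P "rev_dart ` ?P"] by simp
  then show ?thesis by (simp add: card_image inj_rev_dart)
qed

text \<open>The number of edges minus the number of vertices does not decrease when a connected subgraph
  is enlarged, because each new vertex can be reached by a new edge.\<close>

lemma euler_char_subgraph:
  assumes D: "dart_graph D" "conn D" and W: "dart_graph W" "W \<subseteq> D" "W \<noteq> {}"
  shows "card W + 2 * card (verts D) \<le> card D + 2 * card (verts W)"
  using W
proof (induction "card (verts D - verts W)" arbitrary: W)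
  case 0
  then have "verts D \<subseteq> verts W" using finite_verts[OF D(1)] by auto
  then have "verts D = verts W" using verts_mono[OF 0(3)] by blast
  moreover have "card W \<le> card D" using 0 D by (simp add: card_mono dart_graphD)
  ultimately show ?case by simp
next
  case (Suc n)
  have "verts W \<noteq> verts D" "verts W \<subseteq> verts D" "verts W \<noteq> {}"
    using Suc verts_mono[of W D] by (auto simp: verts_def)
  then have "\<not> (\<forall>d\<in>D. fst d \<in> verts W \<longrightarrow> tgt d \<in> verts W)"
    using D(2)[unfolded conn_def, rule_format, of "verts W"] by blast
  then obtain d where d: "d \<in> D" "fst d \<in> verts W" "tgt d \<notin> verts W"
    by blast
  let ?W = "W \<union> {d, rev_dart d}"
  have n: "d \<notin> W" "rev_dart d \<notin> W"
    using d(3) tgt_in_verts[OF Suc(3), of d] rev_dart_mem_iff[OF Suc(3), of d] by blast+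
  have v: "verts ?W = insert (tgt d) (verts W)" using d by (auto simp: verts_def)
  have g: "dart_graph ?W" using Suc(3) by (auto simp: dart_graph_def)
  have "verts D - verts W = insert (tgt d) (verts D - verts ?W)"
    using v d tgt_in_verts[OF D(1) d(1)] by auto
  moreover have "tgt d \<notin> verts D - verts ?W" using v by auto
  ultimately have "n = card (verts D - verts ?W)"
    using Suc(2) finite_verts[OF D(1)] by simp
  then have "card ?W + 2 * card (verts D) \<le> card D + 2 * card (verts ?W)"
    using g Suc(4) d(1) dart_graphD(2)[OF D(1) d(1)] by (intro Suc(1)) auto
  moreover have "card ?W = card W + 2" using n dart_graphD(1)[OF Suc(3)] by simp
  moreover have "card (verts ?W) = card (verts W) + 1"
    using v d(3) finite_verts[OF Suc(3)] by simp
  ultimately show ?case by simp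
qed

lemma conn_map:
  assumes "dart_graph D" "conn D" shows "conn (map_dart f ` D)"
  unfolding conn_def verts_map
proof (intro allI impI)
  fix S assume S: "S \<noteq> {}" "S \<subseteq> f ` verts D"
    "\<forall>d\<in>map_dart f ` D. fst d \<in> S \<longrightarrow> tgt d \<in> S"
  let ?T = "{v \<in> verts D. f v \<in> S}"
  have "?T \<noteq> {}" "?T \<subseteq> verts D" using S by auto
  moreover have "\<forall>d\<in>D. fst d \<in> ?T \<longrightarrow> tgt d \<in> ?T"
    using S(3) tgt_in_verts[OF assms(1)] by auto
  ultimately have "?T = verts D" using assms(2)[unfolded conn_def, rule_format, of ?T] by blast
  then show "S = f ` verts D" using S(2) by blast
qed

section \<open>Closed walks and folds\<close>

lemma walk_consecutive:
  assumes "walk D a (xs @ c # d # ys) b" shows "tgt c = fst d"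
  using assms by (auto simp: walk_append)

lemma reduced_consecutive:
  assumes "reduced (xs @ l # l' # ys)" shows "l' \<noteq> inv_letter l"
  using assms by (simp add: reduced_def successively_append_iff)

text \<open>Inside \<open>p @ p\<close> each dart of \<open>p\<close> has both a predecessor and a
  successor, so the two ends of \<open>p\<close> require no separate treatment.\<close>

lemma closed_walk_neighbours:
  assumes p: "walk D a p a" and red: "reduced (map lab p @ map lab p)" and d: "d \<in> set p"
  shows "\<exists>e\<in>set p. fst e = tgt d \<and> lab e \<noteq> inv_letter (lab d)"
    and "\<exists>c\<in>set p. tgt c = fst d \<and> lab d \<noteq> inv_letter (lab c)"
proof -
  obtain xs ys where ps: "p = xs @ d # ys" using d by (meson split_list)
  have w: "walk D a (p @ p) a" using p unfolding walk_append by blast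
  have r: "reduced (map lab (p @ p))" using red by simp
  obtain e zs where e: "ys @ xs @ [d] = e # zs" by (cases "ys @ xs @ [d]") auto
  have pp: "p @ p = xs @ d # e # (zs @ ys)" using ps e by (metis append.assoc append_Cons append_Nil)
  have "e \<in> set (ys @ xs @ [d])" using e by simp
  then have "e \<in> set p" using ps by auto
  moreover have "fst e = tgt d" using w walk_consecutive unfolding pp by metis
  moreover have "lab e \<noteq> inv_letter (lab d)"
    using r reduced_consecutive[of "map lab xs" "lab d" "lab e"] unfolding pp by simp
  ultimately show "\<exists>e\<in>set p. fst e = tgt d \<and> lab e \<noteq> inv_letter (lab d)" by blast
  obtain c zs where c: "d # ys @ xs = zs @ [c]" using rev_exhaust by blast
  have pp: "p @ p = (xs @ zs) @ c # d # ys" using ps c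
    by (metis append.assoc append_Cons append_Nil)
  have "c \<in> set (d # ys @ xs)" using c by simp
  then have "c \<in> set p" using ps by auto
  moreover have "tgt c = fst d" using w walk_consecutive unfolding pp by metis
  moreover have "lab d \<noteq> inv_letter (lab c)"
    using r reduced_consecutive[of "map lab (xs @ zs)" "lab c" "lab d"] unfolding pp by simp
  ultimately show "\<exists>c\<in>set p. tgt c = fst d \<and> lab d \<noteq> inv_letter (lab c)" by blast
qed

lemma two_le_card_out_darts:
  assumes "dart_graph W" "d \<in> W" "e \<in> W" "fst d = v" "fst e = v" "d \<noteq> e"
  shows "2 \<le> card (out_darts W v)"
proof -
  have "card {d, e} \<le> card (out_darts W v)"
    using assms by (intro card_mono) (auto simp: out_darts_def dart_graphD)
  then show ?thesis using assms by simp
qed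

text \<open>The reverse of an arriving dart and the next departing dart both leave \<open>v\<close>;
  they differ because the walk is cyclically reduced.\<close>

lemma deg_closed_walk:
  assumes p: "walk D a p a" and red: "reduced (map lab p @ map lab p)"
    and v: "v \<in> verts (sym_closure (set p))"
  shows "2 \<le> card (out_darts (sym_closure (set p)) v)"
proof -
  let ?W = "sym_closure (set p)"
  have g: "dart_graph ?W" by (simp add: dart_graph_sym_closure)
  have *: "x \<in> ?W \<and> rev_dart x \<in> ?W" if "x \<in> set p" for x using that by (auto simp: sym_closure_def)
  have "\<exists>d\<in>set p. v = fst d \<or> v = tgt d" using v unfolding verts_sym_closure by blast
  then obtain c d where "c \<in> set p" "d \<in> set p" "tgt c = v" "fst d = v" "lab d \<noteq> inv_letter (lab c)"
    using closed_walk_neighbours[OF p red] by metis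
  then show ?thesis
    using * by (intro two_le_card_out_darts[OF g, of "rev_dart c" d]) auto
qed

lemma closed_set_walk:
  assumes "\<forall>d\<in>D. fst d \<in> S \<longrightarrow> tgt d \<in> S"
  shows "walk D x q y \<Longrightarrow> x \<in> S \<Longrightarrow> y \<in> S \<and> fst ` set q \<subseteq> S \<and> tgt ` set q \<subseteq> S"
  using assms by (induction q arbitrary: x) auto

text \<open>From a dart that meets the closed set, the reversed initial part of the walk leads back
  to \<open>a\<close>, and from \<open>a\<close> the whole walk stays in the set.\<close>

lemma conn_walk:
  assumes p: "walk D a p c"
  shows "conn (sym_closure (set p))"
  unfolding conn_def
proof (intro allI impI)
  let ?W = "sym_closure (set p)"
  fix S assume S: "S \<noteq> {}" "S \<subseteq> verts ?W" and cl: "\<forall>d\<in>?W. fst d \<in> S \<longrightarrow> tgt d \<in> S"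
  have g: "dart_graph ?W" by (simp add: dart_graph_sym_closure)
  have w: "walk ?W a p c" using p subset_sym_closure by (rule walk_restrict)
  obtain v where v: "v \<in> S" using S(1) by blast
  then obtain d where d: "d \<in> set p" "v = fst d \<or> v = tgt d"
    using S(2) unfolding verts_sym_closure by blast
  have "rev_dart d \<in> ?W" using d(1) by (auto simp: sym_closure_def)
  then have "tgt d \<in> S \<longrightarrow> fst d \<in> S" using cl by (metis rev_dart_simps(1,3))
  then have fd: "fst d \<in> S" using d(2) v by blast
  obtain xs ys where ps: "p = xs @ d # ys" using d(1) by (meson split_list)
  have "walk ?W a (xs @ d # ys) c" using w ps by simp
  then have "walk ?W a xs (fst d)" unfolding walk_append by simp
  then have "walk ?W (fst d) (rev (map rev_dart xs)) a" by (rule walk_rev[OF g])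
  then have "a \<in> S" using closed_set_walk[OF cl _ fd] by blast
  then have "fst ` set p \<subseteq> S \<and> tgt ` set p \<subseteq> S" using closed_set_walk[OF cl w] by blast
  then have "verts ?W \<subseteq> S" unfolding verts_sym_closure by blast
  then show "S = verts ?W" using S(2) by blast
qed

text \<open>Two darts with common source and label are merged by identifying their targets. One
  vertex disappears and at least one edge; further edges may coincide, hence the inequality. In any
  case the rank does not grow.\<close>

lemma fold_step:
  assumes D: "dart_graph D" "\<not> deterministic D"
  shows "\<exists>f :: 'v \<Rightarrow> 'v. card (map_dart f ` (D :: ('v, 'a) dart set)) + 2 \<le> card D
    \<and> card (verts (map_dart f ` D)) + 1 = card (verts D)"
proof -
  obtain d d' where d: "d \<in> D" "d' \<in> D" "fst d = fst d'" "lab d = lab d'" "tgt d \<noteq> tgt d'"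
    using D(2) by (auto simp: deterministic_def)
  define f where "f = id(tgt d := tgt d')"
  have f: "f (tgt d) = f (tgt d')" using d by (simp add: f_def)
  have eq: "map_dart f d = map_dart f d'" "map_dart f (rev_dart d) = map_dart f (rev_dart d')"
    using d f by (simp_all add: map_dart_def)
  \<comment> \<open>Equal labels exclude \<open>d' = rev_dart d\<close>. So after removing the edge
    of \<open>d\<close> the edge of \<open>d'\<close> is still there, and it has the same
    image.\<close>
  have ne: "d' \<notin> {d, rev_dart d}" "rev_dart d' \<notin> {d, rev_dart d}"
    using d by (metis inv_letter_neq(1) insertE rev_dart_simps(2) singletonD,
        metis d(4,5) insertE inv_letter_neq(1) rev_dart_simps singletonD)
  have "map_dart f ` D = map_dart f ` (D - {d, rev_dart d})"
  proof
    show "map_dart f ` D \<subseteq> map_dart f ` (D - {d, rev_dart d})"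
    proof
      fix x assume "x \<in> map_dart f ` D"
      then obtain y where y: "y \<in> D" "x = map_dart f y" by blast
      have "d' \<in> D - {d, rev_dart d}" "rev_dart d' \<in> D - {d, rev_dart d}"
        using ne d(2) dart_graphD(2)[OF D(1) d(2)] by auto
      then show "x \<in> map_dart f ` (D - {d, rev_dart d})"
        using y eq by (cases "y = d \<or> y = rev_dart d") auto
    qed
  qed auto
  then have "card (map_dart f ` D) \<le> card (D - {d, rev_dart d})"
    using dart_graphD(1)[OF D(1)] by (simp add: card_image_le)
  moreover have "card (D - {d, rev_dart d}) + 2 = card D"
  proof -
    have s: "{d, rev_dart d} \<subseteq> D" using d(1) dart_graphD(2)[OF D(1) d(1)] by simp
    have "card {d, rev_dart d} = 2" by simp
    then show ?thesis
      using card_Diff_subset[OF _ s] card_mono[OF dart_graphD(1)[OF D(1)] s] by simp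
  qed
  moreover have "card (verts (map_dart f ` D)) + 1 = card (verts D)"
    unfolding verts_map f_def
    using d tgt_in_verts[OF D(1)] finite_verts[OF D(1)] by (intro card_verts_image_fold) auto
  ultimately show ?thesis by (intro exI[of _ f]) simp
qed

text \<open>Reading a word with value \<open>x\<close> at \<open>b\<close> forces, after reduction,
  a loop at \<open>b\<close> labelled \<open>x\<close>. By determinism every dart at
  \<open>b\<close> is such a loop, and connectedness leaves no other vertex.\<close>

lemma deterministic_rose:
  assumes D: "dart_graph D" "conn D" "deterministic D" "b \<in> verts D"
    and lab: "\<forall>d\<in>D. lab d \<in> X \<times> UNIV"
    and gen: "\<forall>x\<in>X. \<exists>u. reads D b u b \<and> foldr push u [] = [(x, True)]"
    and fin: "finite X"
  shows "card D \<le> 2 * card X"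
proof -
  have loop: "(b, l, b) \<in> D" if l: "fst l \<in> X" for l
  proof -
    obtain u where "reads D b u b" "foldr push u [] = [(fst l, True)]"
      using gen[rule_format, OF l] by blast
    then have "reads D b [(fst l, True)] b" using reads_reduce[OF D(1,3), of b u b] by simp
    then have *: "(b, (fst l, True), b) \<in> D" by simp
    then have "(b, (fst l, False), b) \<in> D"
      using dart_graphD(2)[OF D(1)] by (fastforce simp: rev_dart_def)
    with * show ?thesis by (cases l; cases "snd l") auto
  qed
  have at_b: "tgt d = b" if "d \<in> D" "fst d = b" for d
  proof -
    have "(b, lab d, b) \<in> D" using lab that by (intro loop) (auto simp: mem_Times_iff)
    then show ?thesis using D(3) that unfolding deterministic_def by fastforce
  qed
  then have "{b} = verts D"
    using D(2)[unfolded conn_def, rule_format, of "{b}"] D(4) by blast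
  then have "D \<subseteq> {b} \<times> (X \<times> UNIV) \<times> {b}"
    using lab tgt_in_verts[OF D(1)] fst_in_verts by (fastforce simp: mem_Times_iff)
  then have "card D \<le> card ({b} \<times> (X \<times> (UNIV :: bool set)) \<times> {b})"
    using fin by (intro card_mono) auto
  then show ?thesis by (simp add: card_cartesian_product)
qed

text \<open>A connected graph has at least as many edges as a tree on its vertices; this is the
  comparison with the subgraph of a single edge.\<close>

lemma euler_char_ge:
  assumes "dart_graph D" "conn D" "D \<noteq> {}"
  shows "2 * card (verts D) \<le> card D + 2"
proof -
  obtain d where d: "d \<in> D" using assms(3) by blast
  have "dart_graph {d, rev_dart d}" "{d, rev_dart d} \<subseteq> D"
    using dart_graphD[OF assms(1)] d by (auto simp: dart_graph_def)
  then have "card {d, rev_dart d} + 2 * card (verts D) \<le> card D + 2 * card (verts {d, rev_dart d})"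
    by (intro euler_char_subgraph[OF assms(1,2)]) auto
  moreover have "card (verts {d, rev_dart d}) \<le> card {d, rev_dart d}"
    unfolding verts_def by (rule card_image_le) simp
  ultimately show ?thesis by simp
qed

text \<open>A subset loses under \<open>g\<close> at most what the whole set loses. So the covered
  part of a graph shrinks in a fold by no more than the graph does.\<close>

lemma card_image_drop:
  assumes "finite D" "W \<subseteq> D"
  shows "card W + card (g ` D) \<le> card D + card (g ` W)"
proof -
  have "card (g ` D) \<le> card (g ` W) + card (g ` (D - W))"
    by (metis assms(2) card_Un_le image_Un Un_Diff_cancel sup.absorb_iff2)
  moreover have "card (g ` (D - W)) \<le> card (D - W)"
    using assms by (simp add: card_image_le)
  moreover have "card D = card W + card (D - W)"
    using assms card_mono[OF assms] by (simp add: card_Diff_subset finite_subset)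
  ultimately show ?thesis by simp
qed

text \<open>Along a sequence of folds from \<open>D\<close> to a rose, the part covered by a closed walk shrinks to
  at most \<open>k\<close> edges, and it loses at most \<open>k + 1\<close> edges in each fold.\<close>

lemma fold_interpolation:
  fixes D :: "('v, 'a) dart set"
  assumes "dart_graph D" "conn D" "b \<in> verts D"
    and "card D + 2 \<le> 2 * card (verts D) + 2 * k"
    and "\<forall>d\<in>D. lab d \<in> X \<times> UNIV" "\<forall>x\<in>X. \<exists>u. reads D b u b \<and> foldr push u [] = [(x, True)]"
    and "walk D a p a" "map lab p = w" "2 * m \<le> card (sym_closure (set p))"
    and X: "finite X" "card X \<le> k" and m: "k < m"
  shows "\<exists>(q :: ('v, 'a) dart list) c. walk (sym_closure (set q)) c q c \<and> map lab q = w \<and>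
    2 * m \<le> card (sym_closure (set q)) \<and> card (sym_closure (set q)) \<le> 2 * m + 2 * k + 2 \<and>
    card (sym_closure (set q)) + 2 \<le> 2 * card (verts (sym_closure (set q))) + 2 * k"
  using assms(1-9)
proof (induction "card (verts D)" arbitrary: D b a p rule: less_induct)
  case less
  note g = less.prems(1) and c = less.prems(2)
  let ?W = "sym_closure (set p)"
  have sub: "?W \<subseteq> D"
    using sym_closure_subset[OF g walk_set[OF less.prems(7)]] .
  show ?case
  proof (cases "deterministic D")
    case True
    \<comment> \<open>A completely folded graph has at most \<open>2 * k\<close> darts, fewer than
      the \<open>2 * m\<close> that are covered, so this case cannot occur.\<close>
    then have "card D \<le> 2 * card X"
      using less.prems X by (intro deterministic_rose[of D b X]) auto
    moreover have "card ?W \<le> card D" using sub dart_graphD(1)[OF g] by (rule card_mono[rotated])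
    ultimately show ?thesis using less.prems(9) X m by simp
  next
    case False
    then obtain f :: "'v \<Rightarrow> 'v" where f: "card (map_dart f ` D) + 2 \<le> card D"
      "card (verts (map_dart f ` D)) + 1 = card (verts D)"
      using fold_step[OF g] by blast
    let ?D = "map_dart f ` D" and ?p = "map (map_dart f) p"
    have g': "dart_graph ?D" and c': "conn ?D"
      using g c by (simp_all add: dart_graph_map conn_map)
    have W': "sym_closure (set ?p) = map_dart f ` ?W" by (simp add: sym_closure_map)
    show ?thesis
    proof (cases "2 * m \<le> card (sym_closure (set ?p))")
      case True
      show ?thesis
      proof (rule less.hyps[of ?D "f b" "f a" ?p])
        show "card (verts ?D) < card (verts D)" using f by simp
        show "f b \<in> verts ?D" using less.prems(3) by (simp add: verts_map)
        show "card ?D + 2 \<le> 2 * card (verts ?D) + 2 * k" using f less.prems(4) by simp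
        show "\<forall>x\<in>X. \<exists>u. reads ?D (f b) u (f b) \<and> foldr push u [] = [(x, True)]"
          using less.prems(6) reads_map by metis
        show "walk ?D (f a) ?p (f a)" using less.prems(7) by (rule walk_map)
        show "map lab ?p = w" using less.prems(8) by auto
      qed (use g' c' less.prems(5) True in auto)
    next
      \<comment> \<open>The current graph is the last one whose covered part has
        \<open>2 * m\<close> darts. It has at most \<open>2 * card (verts D) + 2 * k - 2\<close>
        darts, and the folded one, with one vertex less, at least
        \<open>2 * card (verts D) - 4\<close>. The fold therefore costs at most
        \<open>2 * k + 2\<close> darts, which bounds the covered part from above.\<close>
      case False
      have ne: "?D \<noteq> {}" using less.prems(3) by (auto simp: verts_def)
      have "card ?W + card ?D \<le> card D + card (map_dart f ` ?W)"
        using card_image_drop[OF dart_graphD(1)[OF g] sub] .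
      then have "card ?W \<le> 2 * m + 2 * k + 2"
        using euler_char_ge[OF g' c' ne] False f less.prems(4) W' by simp
      moreover have "card ?W + 2 * card (verts D) \<le> card D + 2 * card (verts ?W)"
      proof (rule euler_char_subgraph[OF g c _ sub])
        show "?W \<noteq> {}" using less.prems(9) m by auto
      qed (simp add: dart_graph_sym_closure)
      moreover have "walk ?W a p a"
        using less.prems(7) subset_sym_closure by (rule walk_restrict)
      ultimately show ?thesis using less.prems(4,8,9) by (intro exI[of _ p] exI[of _ a]) simp
    qed
  qed
qed

section \<open>Counting reduced walks\<close>

definition succ_darts :: "('v, 'a) dart set \<Rightarrow> ('v, 'a) dart \<Rightarrow> ('v, 'a) dart set" where
  "succ_darts D e = {f \<in> D. fst f = tgt e \<and> lab f \<noteq> inv_letter (lab e)}"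

text \<open>Splitting reduced continuations by their first dart gives this recursion. The degree
  arguments are inductions on it, and \<open>card_conts_le\<close> transfers the bounds to actual
  walks.\<close>

fun num_conts :: "('v, 'a) dart set \<Rightarrow> ('v, 'a) dart \<Rightarrow> nat \<Rightarrow> nat" where
  "num_conts D e 0 = 1"
| "num_conts D e (Suc n) = (\<Sum>f\<in>succ_darts D e. num_conts D f n)"

definition conts :: "('v, 'a) dart set \<Rightarrow> ('v, 'a) dart \<Rightarrow> nat \<Rightarrow> ('v, 'a) dart list set" where
  "conts D e n = {q. length q = n \<and> (\<exists>c. walk D (tgt e) q c) \<and> reduced (map lab (e # q))}"

lemma reduced_Cons_Cons: "reduced (a # b # w) \<longleftrightarrow> b \<noteq> inv_letter a \<and> reduced (b # w)"
  by (simp add: reduced_def)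

lemma reduced_simps [simp]: "reduced []" "reduced [a]"
  by (simp_all add: reduced_def)

lemma reduced_tl: "reduced (a # w) \<Longrightarrow> reduced w"
  by (cases w) (auto simp: reduced_Cons_Cons)

lemma conts_0: "conts D e 0 = {[]}"
  by (auto simp: conts_def)

lemma conts_Suc: "conts D e (Suc n) = (\<Union>f\<in>succ_darts D e. (#) f ` conts D f n)"
proof
  show "conts D e (Suc n) \<subseteq> (\<Union>f\<in>succ_darts D e. (#) f ` conts D f n)"
  proof
    fix q assume q: "q \<in> conts D e (Suc n)"
    then obtain f r where r: "q = f # r" by (cases q) (auto simp: conts_def)
    have "f \<in> succ_darts D e" "r \<in> conts D f n"
      using q unfolding r conts_def succ_darts_def by (auto simp: reduced_Cons_Cons)
    then show "q \<in> (\<Union>f\<in>succ_darts D e. (#) f ` conts D f n)" using r by blast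
  qed
qed (auto simp: conts_def succ_darts_def reduced_Cons_Cons)

lemma finite_succ_darts: "finite D \<Longrightarrow> finite (succ_darts D e)"
  by (simp add: succ_darts_def)

lemma succ_darts_subset: "succ_darts D e \<subseteq> D"
  by (auto simp: succ_darts_def)

lemma finite_conts: "finite D \<Longrightarrow> finite (conts D e n)"
  by (induction n arbitrary: e) (auto simp: conts_0 conts_Suc finite_succ_darts)

lemma card_conts_le: "finite D \<Longrightarrow> card (conts D e n) \<le> num_conts D e n"
proof (induction n arbitrary: e)
  case (Suc n)
  have "card (conts D e (Suc n)) \<le> (\<Sum>f\<in>succ_darts D e. card ((#) f ` conts D f n))"
    unfolding conts_Suc using Suc.prems by (intro card_UN_le finite_succ_darts)
  also have "\<dots> \<le> (\<Sum>f\<in>succ_darts D e. num_conts D f n)"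
    using Suc by (intro sum_mono) (simp add: card_image)
  finally show ?case by simp
qed (simp add: conts_0)

text \<open>A continuation of length \<open>a + b\<close> is one of length \<open>a\<close> followed
  by one of length \<open>b\<close> after its last dart.\<close>

lemma num_conts_add:
  assumes "\<And>f. f \<in> D \<Longrightarrow> num_conts D f b \<le> B"
  shows "e \<in> D \<Longrightarrow> num_conts D e (a + b) \<le> num_conts D e a * B"
proof (induction a arbitrary: e)
  case (Suc a)
  have "num_conts D e (Suc a + b) \<le> (\<Sum>f\<in>succ_darts D e. num_conts D f a * B)"
    using Suc succ_darts_subset[of D e] by (auto intro!: sum_mono)
  then show ?case by (simp add: sum_distrib_right)
qed (use assms in simp)

lemma num_conts_mult:
  assumes "\<And>f. f \<in> D \<Longrightarrow> num_conts D f L \<le> M"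
  shows "e \<in> D \<Longrightarrow> num_conts D e (q * L) \<le> M ^ q"
proof (induction q)
  case (Suc q)
  have "num_conts D e (q * L + L) \<le> num_conts D e (q * L) * M"
    using assms Suc.prems by (rule num_conts_add)
  also have "\<dots> \<le> M ^ q * M" using Suc by simp
  finally show ?case by (simp add: ac_simps)
qed simp

lemma num_conts_power:
  assumes "\<And>f. f \<in> D \<Longrightarrow> card (succ_darts D f) \<le> s"
  shows "e \<in> D \<Longrightarrow> num_conts D e n \<le> s ^ n"
proof (induction n arbitrary: e)
  case (Suc n)
  have "num_conts D e (Suc n) \<le> (\<Sum>f\<in>succ_darts D e. s ^ n)"
    unfolding num_conts.simps using succ_darts_subset[of D e] by (intro sum_mono Suc.IH) blast
  also have "\<dots> \<le> s * s ^ n" using assms[OF Suc.prems] by simp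
  finally show ?case by simp
qed simp

text \<open>A walk of length \<open>Suc n\<close> consists of its first dart and a continuation of
  length \<open>n\<close>, which together determine the label.\<close>

lemma card_closed_walk_labels_le:
  assumes fin: "finite D" and B: "\<And>e. e \<in> D \<Longrightarrow> num_conts D e n \<le> B"
  shows "finite {w. length w = Suc n \<and> reduced w \<and> (\<exists>q c. walk D c q c \<and> map lab q = w)}"
    and "card {w. length w = Suc n \<and> reduced w \<and> (\<exists>q c. walk D c q c \<and> map lab q = w)} \<le> card D * B"
proof -
  let ?S = "{w. length w = Suc n \<and> reduced w \<and> (\<exists>q c. walk D c q c \<and> map lab q = w)}"
  let ?T = "\<Union>e\<in>D. (\<lambda>q. map lab (e # q)) ` conts D e n"
  have sub: "?S \<subseteq> ?T"
  proof
    fix w assume "w \<in> ?S"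
    then obtain q c where q: "length w = Suc n" "reduced w" "walk D c q c" "map lab q = w" by auto
    then obtain e r where r: "q = e # r" by (cases q) auto
    have "e \<in> D" "r \<in> conts D e n" using q unfolding r conts_def by auto
    then show "w \<in> ?T" using q(4) r by blast
  qed
  have fT: "finite ?T" using fin by (auto simp: finite_conts)
  show "finite ?S" using sub fT by (rule finite_subset)
  have "card ?S \<le> card ?T" using fT sub by (rule card_mono)
  also have "\<dots> \<le> (\<Sum>e\<in>D. card ((\<lambda>q. map lab (e # q)) ` conts D e n))"
    by (rule card_UN_le[OF fin])
  also have "\<dots> \<le> (\<Sum>e\<in>D. B)"
  proof (rule sum_mono)
    fix e assume "e \<in> D"
    have "card ((\<lambda>q. map lab (e # q)) ` conts D e n) \<le> card (conts D e n)"
      by (rule card_image_le) (simp add: fin finite_conts)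
    also have "\<dots> \<le> B" using card_conts_le[OF fin, of e n] B[OF \<open>e \<in> D\<close>] by simp
    finally show "card ((\<lambda>q. map lab (e # q)) ` conts D e n) \<le> B" .
  qed
  finally show "card ?S \<le> card D * B" by simp
qed

section \<open>Degrees and Euler characteristic\<close>

lemma finite_out_darts: "finite D \<Longrightarrow> finite (out_darts D v)"
  by (simp add: out_darts_def)

lemma out_darts_not_vert: "v \<notin> verts D \<Longrightarrow> out_darts D v = {}"
  unfolding out_darts_def verts_def by blast

text \<open>The reverse of \<open>e\<close> leaves \<open>tgt e\<close> but is forbidden as a
  continuation. This is the step from degree \<open>2 * k - 2\<close> to the growth rate
  \<open>2 * k - 3\<close>.\<close>

lemma card_succ_darts_less:
  assumes "dart_graph D" "e \<in> D"
  shows "card (succ_darts D e) < card (out_darts D (tgt e))"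
proof (rule psubset_card_mono)
  have "rev_dart e \<in> out_darts D (tgt e)" "rev_dart e \<notin> succ_darts D e"
    using dart_graphD(2)[OF assms] by (auto simp: out_darts_def succ_darts_def)
  moreover have "succ_darts D e \<subseteq> out_darts D (tgt e)"
    by (auto simp: out_darts_def succ_darts_def)
  ultimately show "succ_darts D e \<subset> out_darts D (tgt e)" by blast
qed (simp add: finite_out_darts dart_graphD[OF assms(1)])

text \<open>The excesses \<open>deg - 2\<close> of all vertices add up to
  \<open>card D - 2 * card (verts D)\<close>, and those outside \<open>A\<close> are not
  negative.\<close>

lemma sum_deg_le:
  assumes D: "dart_graph D" and A: "A \<subseteq> verts D"
    and deg: "\<And>v. v \<in> verts D - A \<Longrightarrow> 2 \<le> card (out_darts D v)"
  shows "(\<Sum>v\<in>A. card (out_darts D v)) + 2 * card (verts D) \<le> card D + 2 * card A"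
proof -
  have fin: "finite (verts D)" by (rule finite_verts[OF D])
  have "card D = (\<Sum>v\<in>A. card (out_darts D v)) + (\<Sum>v\<in>verts D - A. card (out_darts D v))"
    unfolding sum_deg[OF D] by (metis A fin add.commute sum.subset_diff)
  moreover have "(\<Sum>v\<in>verts D - A. 2) \<le> (\<Sum>v\<in>verts D - A. card (out_darts D v))"
    by (intro sum_mono deg)
  moreover have "card (verts D - A) + card A = card (verts D)"
    using A fin by (metis card_Diff_subset card_mono finite_subset le_add_diff_inverse2)
  ultimately show ?thesis by simp
qed

text \<open>Without leaves in \<open>D\<close>, the new edges outnumber the new vertices, so passing
  to a proper subgraph lowers the rank by at least one.\<close>

lemma euler_char_proper_subgraph:
  assumes D: "dart_graph D" "conn D" and deg: "\<And>v. v \<in> verts D \<Longrightarrow> 2 \<le> card (out_darts D v)"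
    and Y: "dart_graph Y" "Y \<subset> D" "Y \<noteq> {}"
  shows "card Y + 2 * card (verts D) + 2 \<le> card D + 2 * card (verts Y)"
proof -
  have fin: "finite D" "finite (verts D)" using D by (simp_all add: dart_graphD finite_verts)
  have vY: "verts Y \<subseteq> verts D" using Y verts_mono by blast
  have "card Y + 2 * card (verts D) < card D + 2 * card (verts Y)"
  proof (cases "verts Y = verts D")
    case True
    then show ?thesis using psubset_card_mono[OF fin(1) Y(2)] by simp
  next
    case False
    have "verts Y \<noteq> {}" using Y(3) by (auto simp: verts_def)
    then have "\<not> (\<forall>d\<in>D. fst d \<in> verts Y \<longrightarrow> tgt d \<in> verts Y)"
      using D(2)[unfolded conn_def, rule_format, of "verts Y"] vY False by blast
    then obtain d where d: "d \<in> D" "fst d \<in> verts Y" "tgt d \<notin> verts Y" by blast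
    let ?O = "\<Union>v\<in>verts D - verts Y. out_darts D v"
    \<comment> \<open>At least two darts leave each vertex outside \<open>Y\<close>, and none of
      them is in \<open>Y\<close>. The dart \<open>d\<close> starts at a vertex of \<open>Y\<close>
      and comes in addition, which makes the inequality strict.\<close>
    have "insert d ?O \<subseteq> D - Y"
      using d tgt_in_verts[OF Y(1), of d] fst_in_verts[of _ Y] by (auto simp: out_darts_def)
    then have "card (insert d ?O) \<le> card (D - Y)" using fin by (intro card_mono) auto
    moreover have "card (insert d ?O) = Suc (card ?O)"
      using d fin by (intro card_insert_disjoint) (auto simp: out_darts_def)
    moreover have "card ?O = (\<Sum>v\<in>verts D - verts Y. card (out_darts D v))"
      using fin by (intro card_UN_disjoint) (auto simp: out_darts_def)
    moreover have "(\<Sum>v\<in>verts D - verts Y. 2) \<le> (\<Sum>v\<in>verts D - verts Y. card (out_darts D v))"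
      using deg by (intro sum_mono) auto
    moreover have "card (verts D - verts Y) + card (verts Y) = card (verts D)"
      using vY fin by (metis card_Diff_subset card_mono finite_subset le_add_diff_inverse2)
    moreover have "card (D - Y) + card Y = card D"
      using Y fin
      by (metis card_Diff_subset card_mono finite_subset le_add_diff_inverse2 psubset_imp_subset)
    ultimately show ?thesis by simp
  qed
  \<comment> \<open>All terms are even, so the gap of 1 is a gap of 2, that is, of one edge.\<close>
  moreover have "even (card Y)" "even (card D)"
    using card_positive_darts[OF Y(1)] card_positive_darts[OF D(1)] by simp_all
  ultimately show ?thesis by presburger
qed

section \<open>Short closed walks at a vertex\<close>

fun reach :: "('v, 'a) dart set \<Rightarrow> 'v set \<Rightarrow> nat \<Rightarrow> ('v, 'a) dart set" where
  "reach D A 0 = {}"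
| "reach D A (Suc n) = (\<Union>v\<in>A. out_darts D v) \<union> reach D (tgt ` (\<Union>v\<in>A. out_darts D v)) n"

lemma walk_subset_reach:
  "walk D a q c \<Longrightarrow> a \<in> A \<Longrightarrow> length q \<le> n \<Longrightarrow> set q \<subseteq> reach D A n"
proof (induction q arbitrary: a A n)
  case (Cons d q)
  then obtain m where m: "n = Suc m" by (cases n) auto
  have d: "d \<in> (\<Union>v\<in>A. out_darts D v)" using Cons.prems by (auto simp: out_darts_def)
  have "set q \<subseteq> reach D (tgt ` (\<Union>v\<in>A. out_darts D v)) m"
    using Cons.prems d m by (intro Cons.IH[of "tgt d"]) auto
  then show ?case using d m by auto
qed simp

text \<open>The base \<open>2 * s + 1\<close> is generous so that the geometric sum is absorbed:
  \<open>s + s * (2 * s + 1) ^ n \<le> (2 * s + 1) ^ Suc n\<close>. With \<open>s = 2 * k\<close> it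
  becomes the \<open>4 * k + 1\<close> used below.\<close>

lemma card_reach:
  assumes "finite D" and "\<And>v. card (out_darts D v) \<le> s"
  shows "finite A \<Longrightarrow> finite (reach D A n) \<and> card (reach D A n) \<le> card A * (2 * s + 1) ^ n"
proof (induction n arbitrary: A)
  case (Suc n)
  let ?O = "\<Union>v\<in>A. out_darts D v"
  have fin: "finite ?O" using Suc.prems assms(1) by (simp add: finite_out_darts)
  have "card ?O \<le> (\<Sum>v\<in>A. card (out_darts D v))" by (rule card_UN_le[OF Suc.prems])
  also have "\<dots> \<le> card A * s" using sum_bounded_above[of A _ s] assms(2) by simp
  finally have O: "card ?O \<le> card A * s" .
  have IH: "finite (reach D (tgt ` ?O) n)"
    "card (reach D (tgt ` ?O) n) \<le> card (tgt ` ?O) * (2 * s + 1) ^ n"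
    using Suc.IH[of "tgt ` ?O"] fin by auto
  have "card (tgt ` ?O) * (2 * s + 1) ^ n \<le> card A * s * (2 * s + 1) ^ n"
    using card_image_le[OF fin, of tgt] O by (intro mult_right_mono) auto
  then have "card (?O \<union> reach D (tgt ` ?O) n) \<le> card A * s + card A * s * (2 * s + 1) ^ n"
    using card_Un_le[of ?O "reach D (tgt ` ?O) n"] O IH by linarith
  also have "\<dots> \<le> card A * s * (2 * s + 1) ^ n + card A * s * (2 * s + 1) ^ n" by simp
  also have "\<dots> \<le> card A * (2 * s + 1) ^ Suc n" by (simp add: algebra_simps)
  finally show ?case using fin IH by simp
qed simp

text \<open>These darts are all that a reduced walk can use between leaving \<open>p\<close> and
  returning to it within \<open>L\<close> steps. The walks are reduced but not cyclically reduced,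
  so \<open>p\<close> itself may be a leaf.\<close>

definition short_core :: "('v, 'a) dart set \<Rightarrow> 'v \<Rightarrow> nat \<Rightarrow> ('v, 'a) dart set" where
  "short_core D p L =
     sym_closure (\<Union> (set ` {q. walk D p q p \<and> reduced (map lab q) \<and> length q \<le> L}))"

lemma short_core_subset: "dart_graph D \<Longrightarrow> short_core D p L \<subseteq> D"
  unfolding short_core_def by (rule sym_closure_subset) (auto dest: walk_set)

lemma dart_graph_short_core: "dart_graph D \<Longrightarrow> dart_graph (short_core D p L)"
  unfolding short_core_def
  by (intro dart_graph_sym_closure finite_subset[OF _ dart_graphD(1)[of D]]) (auto dest: walk_set)

lemma short_coreI:
  assumes "walk D p q p" "reduced (map lab q)" "length q \<le> L" "d \<in> set q"
  shows "d \<in> short_core D p L" "rev_dart d \<in> short_core D p L"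
  using assms unfolding short_core_def sym_closure_def by blast+

text \<open>The walks begin and end at \<open>p\<close>, so a visit to \<open>v \<noteq> p\<close>
  lies in the interior of one and has an arriving and a departing dart.\<close>

lemma short_core_deg:
  fixes D :: "('v, 'a) dart set"
  assumes D: "dart_graph D" and v: "v \<in> verts (short_core D p L)" "v \<noteq> p"
  shows "2 \<le> card (out_darts (short_core D p L) v)"
proof -
  obtain q d where q: "walk D p q p" "reduced (map lab q)" "length q \<le> L"
    and d: "d \<in> set q" "v = fst d \<or> v = tgt d"
    using v(1) unfolding short_core_def verts_sym_closure by blast
  obtain xs ys where ps: "q = xs @ d # ys" using d(1) by (meson split_list)
  have "\<exists>(c :: ('v, 'a) dart) e us zs. q = us @ c # e # zs \<and> tgt c = v"
  proof (cases "v = fst d")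
    case True
    have "xs \<noteq> []" using q(1) ps True v(2) by auto
    then obtain us c where "xs = us @ [c]" by (meson rev_exhaust)
    then have *: "q = us @ c # d # ys" using ps by simp
    then have "tgt c = v" using q(1) walk_consecutive True by metis
    with * show ?thesis by blast
  next
    case False
    have "ys \<noteq> []" using q(1) ps False v(2) d(2) by (auto simp: walk_append)
    then obtain e zs where "ys = e # zs" by (cases ys) auto
    then show ?thesis using ps False d(2) by blast
  qed
  then obtain c e us zs where ce: "q = us @ c # e # zs" "tgt c = v" by blast
  have "fst e = v" using q(1) ce walk_consecutive by metis
  moreover have "lab e \<noteq> inv_letter (lab c)"
    using q(2) ce(1) reduced_consecutive[of "map lab us" "lab c" "lab e"] by simp
  then have "rev_dart c \<noteq> e" by auto
  moreover have "e \<in> short_core D p L" "rev_dart c \<in> short_core D p L"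
    using short_coreI[OF q] ce(1) by simp_all
  ultimately show ?thesis
    using ce(2) by (intro two_le_card_out_darts[OF dart_graph_short_core[OF D], where d = "rev_dart c" and e = e]) auto
qed

text \<open>The bound is independent of the size of \<open>D\<close>. A large \<open>D\<close>
  therefore contains the short core as a proper subgraph.\<close>

lemma card_short_core:
  assumes D: "dart_graph D" and s: "\<And>v. card (out_darts D v) \<le> s"
  shows "card (short_core D p L) \<le> 2 * (2 * s + 1) ^ L"
proof -
  let ?U = "\<Union> (set ` {q. walk D p q p \<and> reduced (map lab q) \<and> length q \<le> L})"
  have r: "finite (reach D {p} L)" "card (reach D {p} L) \<le> (2 * s + 1) ^ L"
    using card_reach[OF dart_graphD(1)[OF D] s, of "{p}" L] by simp_all
  have U: "?U \<subseteq> reach D {p} L" using walk_subset_reach[of D p _ p "{p}" L] by blast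
  then have "finite ?U" using r(1) by (rule finite_subset)
  then have "card (rev_dart ` ?U) \<le> card ?U" by (rule card_image_le)
  moreover have "card ?U \<le> (2 * s + 1) ^ L" using card_mono[OF r(1) U] r(2) by simp
  moreover have "card (short_core D p L) \<le> card ?U + card (rev_dart ` ?U)"
    unfolding short_core_def sym_closure_def by (rule card_Un_le)
  ultimately show ?thesis by linarith
qed

locale core_graph =
  fixes D :: "('v, 'a) dart set" and k :: nat
  assumes D: "dart_graph D" "conn D"
    and deg2: "\<And>v. v \<in> verts D \<Longrightarrow> 2 \<le> card (out_darts D v)"
    and rank: "card D + 2 \<le> 2 * card (verts D) + 2 * k"
begin

lemma sum_deg_core:
  assumes "A \<subseteq> verts D"
  shows "(\<Sum>v\<in>A. card (out_darts D v)) + 2 \<le> 2 * k + 2 * card A"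
  using sum_deg_le[OF D(1) assms] deg2 rank by fastforce

lemma deg_le: "card (out_darts D v) \<le> 2 * k"
  using sum_deg_core[of "{v}"] out_darts_not_vert[of v D] by (cases "v \<in> verts D") auto

lemma deg_pair_le:
  assumes "u \<noteq> v" "u \<in> verts D" "v \<in> verts D"
  shows "card (out_darts D u) + card (out_darts D v) \<le> 2 * k + 2"
  using sum_deg_core[of "{u, v}"] assms by simp

text \<open>As a proper subgraph the short core has rank at most \<open>k - 1\<close> in the sense
  of Euler characteristics. Its vertices other than \<open>p\<close> have degree at least 2, so the
  excess at \<open>p\<close> is at most \<open>2 * (k - 1) - 2\<close>.\<close>

lemma deg_short_core_le:
  assumes big: "2 * (4 * k + 1) ^ L < card D"
  shows "card (out_darts (short_core D p L) p) \<le> 2 * k - 2"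
proof -
  let ?Y = "short_core D p L"
  have Y: "dart_graph ?Y" "?Y \<subseteq> D"
    using dart_graph_short_core[OF D(1)] short_core_subset[OF D(1)] by auto
  have "card ?Y < card D" using card_short_core[OF D(1) deg_le, of p L] big by simp
  then have psub: "?Y \<subset> D" using Y by auto
  show ?thesis
  proof (cases "p \<in> verts ?Y")
    case True
    then have "?Y \<noteq> {}" by (auto simp: verts_def)
    then have "card ?Y + 2 * card (verts D) + 2 \<le> card D + 2 * card (verts ?Y)"
      using euler_char_proper_subgraph[OF D deg2 Y(1) psub] by blast
    moreover have "card (out_darts ?Y p) + 2 * card (verts ?Y) \<le> card ?Y + 2"
      using sum_deg_le[OF Y(1), of "{p}"] True short_core_deg[OF D(1)] by fastforce
    ultimately show ?thesis using rank by linarith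
  next
    case False
    then show ?thesis by (simp add: out_darts_not_vert)
  qed
qed

end

text \<open>If only \<open>p\<close> has large degree, a reduced walk of length at most \<open>L\<close> moves in the short core
  of \<open>p\<close> between its first and its last visit to \<open>p\<close>. Hence the number of choices is at most
  \<open>s\<close> at all steps except for those two visits.\<close>

locale one_big_vertex =
  fixes D :: "('v, 'a) dart set" and p :: 'v and s t L :: nat
  assumes D: "dart_graph D"
    and small: "\<And>v. v \<noteq> p \<Longrightarrow> card (out_darts D v) \<le> s + 1"
    and big: "card (out_darts D p) \<le> t"
    and core: "card (out_darts (short_core D p L) p) \<le> s + 1"
    and s: "s \<ge> 1"
begin

text \<open>Only visits to \<open>p\<close> at which another dart is still to be chosen cost
  anything, hence the strict bound: the walk may be at \<open>p\<close> after exactly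
  \<open>n\<close> steps.\<close>

definition far :: "nat \<Rightarrow> ('v, 'a) dart \<Rightarrow> bool" where
  "far n e \<longleftrightarrow> (\<forall>q c. walk D (tgt e) q c \<longrightarrow> reduced (map lab (e # q)) \<longrightarrow> length q < n \<longrightarrow> c \<noteq> p)"

text \<open>If the walk arrives at \<open>p\<close> by a core dart, the forbidden reverse is a core
  dart too, and at most \<open>s\<close> continuations remain in the core. The case
  \<open>q = []\<close> speaks of \<open>e\<close> itself.\<close>

definition returns_in_core :: "nat \<Rightarrow> ('v, 'a) dart \<Rightarrow> bool" where
  "returns_in_core n e \<longleftrightarrow> (\<forall>q. walk D (tgt e) q p \<longrightarrow> reduced (map lab (e # q)) \<longrightarrow> length q < n \<longrightarrow>
     last (e # q) \<in> short_core D p L)"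

lemma farD: "far (Suc n) e \<Longrightarrow> tgt e \<noteq> p"
  unfolding far_def by (drule spec[of _ "[]"]) auto

lemma returns_in_coreD: "returns_in_core (Suc n) e \<Longrightarrow> tgt e = p \<Longrightarrow> e \<in> short_core D p L"
  unfolding returns_in_core_def by (drule spec[of _ "[]"]) auto

lemma far_succ: "far (Suc n) e \<Longrightarrow> f \<in> succ_darts D e \<Longrightarrow> far n f"
  unfolding far_def succ_darts_def
proof (intro allI impI)
  fix q c
  assume a: "\<forall>q c. walk D (tgt e) q c \<longrightarrow> reduced (map lab (e # q)) \<longrightarrow> length q < Suc n \<longrightarrow> c \<noteq> p"
    and f: "f \<in> {f \<in> D. fst f = tgt e \<and> lab f \<noteq> inv_letter (lab e)}"
    and q: "walk D (tgt f) q c" "reduced (map lab (f # q))" "length q < n"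
  show "c \<noteq> p"
    using a[rule_format, of "f # q" c] f q by (simp add: reduced_Cons_Cons)
qed

lemma returns_in_core_succ: "returns_in_core (Suc n) e \<Longrightarrow> f \<in> succ_darts D e \<Longrightarrow> returns_in_core n f"
  unfolding returns_in_core_def succ_darts_def
proof (intro allI impI)
  fix q
  assume a: "\<forall>q. walk D (tgt e) q p \<longrightarrow> reduced (map lab (e # q)) \<longrightarrow> length q < Suc n \<longrightarrow>
      last (e # q) \<in> short_core D p L"
    and f: "f \<in> {f \<in> D. fst f = tgt e \<and> lab f \<noteq> inv_letter (lab e)}"
    and q: "walk D (tgt f) q p" "reduced (map lab (f # q))" "length q < n"
  show "last (f # q) \<in> short_core D p L"
    using a[rule_format, of "f # q"] f q by (simp add: reduced_Cons_Cons)
qed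

text \<open>If a walk that starts with \<open>f\<close> returns to \<open>p\<close> in time, then
  \<open>f # q\<close> is a closed reduced walk of length at most \<open>L\<close>, and all its
  darts, \<open>f\<close> included, belong to the core.\<close>

lemma from_p:
  assumes "f \<in> D" "fst f = p" "n \<le> L"
  shows "returns_in_core n f" "f \<notin> short_core D p L \<Longrightarrow> far n f"
proof -
  have *: "d \<in> short_core D p L"
    if "walk D (tgt f) q p" "reduced (map lab (f # q))" "length q < n" "d \<in> set (f # q)" for q d
    using that assms by (intro short_coreI[of D p "f # q" L d]) auto
  show "returns_in_core n f" unfolding returns_in_core_def
  proof (intro allI impI)
    fix q assume "walk D (tgt f) q p" "reduced (map lab (f # q))" "length q < n"
    then show "last (f # q) \<in> short_core D p L" by (rule *) (rule last_in_set, simp)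
  qed
  show "far n f" if "f \<notin> short_core D p L"
    unfolding far_def
  proof (intro allI impI notI)
    fix q c assume "walk D (tgt f) q c" "reduced (map lab (f # q))" "length q < n" "c = p"
    then show False using *[of q f] that by simp
  qed
qed

lemma card_succ_small: "e \<in> D \<Longrightarrow> tgt e \<noteq> p \<Longrightarrow> card (succ_darts D e) \<le> s"
  using card_succ_darts_less[OF D, of e] small[of "tgt e"] by simp

lemma card_succ_big: "e \<in> D \<Longrightarrow> tgt e = p \<Longrightarrow> card (succ_darts D e) \<le> t"
  using card_succ_darts_less[OF D, of e] big by simp

lemma sum_succ_le:
  assumes "\<And>f. f \<in> A \<Longrightarrow> num_conts D f n \<le> B" "card A \<le> c"
  shows "(\<Sum>f\<in>A. num_conts D f n) \<le> c * B"
proof -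
  have "(\<Sum>f\<in>A. num_conts D f n) \<le> card A * B"
    using sum_bounded_above[of A "\<lambda>f. num_conts D f n" B] assms(1) by simp
  also have "\<dots> \<le> c * B" using assms(2) by simp
  finally show ?thesis .
qed

lemma num_conts_far: "e \<in> D \<Longrightarrow> far n e \<Longrightarrow> num_conts D e n \<le> s ^ n"
proof (induction n arbitrary: e)
  case (Suc n)
  have "num_conts D e (Suc n) \<le> s * s ^ n" unfolding num_conts.simps
    using Suc.IH far_succ[OF Suc.prems(2)] succ_darts_subset[of D e]
      card_succ_small[OF Suc.prems(1) farD[OF Suc.prems(2)]]
    by (intro sum_succ_le) auto
  then show ?case by simp
qed simp

text \<open>At \<open>p\<close> the walk either stays in the core, with at most \<open>s\<close>
  choices, or leaves it by one of at most \<open>t\<close> darts and never returns in time, with at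
  most \<open>s ^ n\<close> continuations. The recurrence \<open>s * a + t * s ^ n\<close> has the
  stated solution.\<close>

lemma num_conts_returns:
  "e \<in> D \<Longrightarrow> returns_in_core n e \<Longrightarrow> n \<le> L \<Longrightarrow> num_conts D e n \<le> (1 + t * n) * s ^ n"
proof (induction n arbitrary: e)
  case (Suc n)
  let ?S = "succ_darts D e" and ?Y = "short_core D p L"
  have fin: "finite ?S" by (rule finite_succ_darts) (rule dart_graphD(1)[OF D])
  have IH: "num_conts D f n \<le> (1 + t * n) * s ^ n" if "f \<in> ?S" for f
    using Suc.IH[of f] returns_in_core_succ[OF Suc.prems(2) that] subsetD[OF succ_darts_subset that]
      Suc.prems(3) by simp
  have "num_conts D e (Suc n) \<le> s * ((1 + t * n) * s ^ n) + t * s ^ n"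
  proof (cases "tgt e = p")
    case False
    have "num_conts D e (Suc n) \<le> s * ((1 + t * n) * s ^ n)" unfolding num_conts.simps
      using IH card_succ_small[OF Suc.prems(1) False] by (intro sum_succ_le) auto
    then show ?thesis by simp
  next
    case True
    have e: "rev_dart e \<in> out_darts ?Y p"
      using returns_in_coreD[OF Suc.prems(2) True] dart_graphD(2)[OF dart_graph_short_core[OF D]] True
      by (simp add: out_darts_def)
    have fY: "finite (out_darts ?Y p)"
      by (intro finite_out_darts dart_graphD(1) dart_graph_short_core D)
    have "?S \<inter> ?Y \<subseteq> out_darts ?Y p - {rev_dart e}"
      using True by (auto simp: succ_darts_def out_darts_def)
    then have "card (?S \<inter> ?Y) \<le> card (out_darts ?Y p - {rev_dart e})"
      using fY by (intro card_mono) auto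
    also have "\<dots> \<le> s" using core e fY by simp
    finally have 1: "(\<Sum>f\<in>?S \<inter> ?Y. num_conts D f n) \<le> s * ((1 + t * n) * s ^ n)"
      using IH by (intro sum_succ_le) auto
    have "card (?S - ?Y) \<le> card ?S" using fin by (intro card_mono) auto
    then have "card (?S - ?Y) \<le> t" using card_succ_big[OF Suc.prems(1) True] by simp
    moreover have "num_conts D f n \<le> s ^ n" if "f \<in> ?S - ?Y" for f
    proof (rule num_conts_far)
      show "f \<in> D" using that by (simp add: succ_darts_def)
      show "far n f" using that True Suc.prems(3) by (intro from_p(2)) (auto simp: succ_darts_def)
    qed
    ultimately have 2: "(\<Sum>f\<in>?S - ?Y. num_conts D f n) \<le> t * s ^ n"
      by (intro sum_succ_le) auto
    have "num_conts D e (Suc n) = (\<Sum>f\<in>?S \<inter> ?Y. num_conts D f n) + (\<Sum>f\<in>?S - ?Y. num_conts D f n)"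
      unfolding num_conts.simps using fin by (rule sum.Int_Diff)
    then show ?thesis using 1 2 by simp
  qed
  also have "\<dots> \<le> s * ((1 + t * n) * s ^ n) + t * (s * s ^ n)"
    using s by simp
  also have "\<dots> = (1 + t * Suc n) * s ^ Suc n" by (simp add: algebra_simps)
  finally show ?case .
qed simp

text \<open>Until the first visit to \<open>p\<close> there are at most \<open>s\<close> choices per
  step. At that visit the arriving dart need not lie in the core, which costs the factor
  \<open>t\<close> once; afterwards \<open>num_conts_returns\<close> applies.\<close>

lemma num_conts_window:
  assumes "t \<ge> 1"
  shows "e \<in> D \<Longrightarrow> n \<le> L \<Longrightarrow> num_conts D e n \<le> t * ((1 + t * n) * s ^ n)"
proof (induction n arbitrary: e)
  case (Suc n)
  let ?S = "succ_darts D e"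
  have m: "(1 + t * n) * s ^ n \<le> (1 + t * Suc n) * s ^ Suc n"
    using s by (intro mult_le_mono) auto
  show ?case
  proof (cases "tgt e = p")
    case False
    have "num_conts D f n \<le> t * ((1 + t * n) * s ^ n)" if "f \<in> ?S" for f
      using Suc.IH[of f] subsetD[OF succ_darts_subset that] Suc.prems(2) by simp
    then have "num_conts D e (Suc n) \<le> s * (t * ((1 + t * n) * s ^ n))"
      unfolding num_conts.simps
      using card_succ_small[OF Suc.prems(1) False] by (intro sum_succ_le) auto
    also have "\<dots> \<le> t * ((1 + t * Suc n) * s ^ Suc n)" by (simp add: algebra_simps)
    finally show ?thesis .
  next
    case True
    have "num_conts D f n \<le> (1 + t * n) * s ^ n" if "f \<in> ?S" for f
    proof (rule num_conts_returns)
      show "f \<in> D" using that by (simp add: succ_darts_def)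
      show "returns_in_core n f"
        using that True Suc.prems(2) by (intro from_p(1)) (auto simp: succ_darts_def)
    qed (use Suc.prems in simp)
    then have "num_conts D e (Suc n) \<le> t * ((1 + t * n) * s ^ n)"
      unfolding num_conts.simps
      using card_succ_big[OF Suc.prems(1) True] by (intro sum_succ_le) auto
    also have "\<dots> \<le> t * ((1 + t * Suc n) * s ^ Suc n)" using m by simp
    finally show ?thesis .
  qed
qed (use assms in simp)

end

context core_graph
begin

lemma num_conts_core:
  assumes k3: "k \<ge> 3" and L: "2 * (4 * k + 1) ^ L < card D" and e: "e \<in> D"
  shows "num_conts D e L \<le> 2 * k * ((1 + 2 * k * L) * (2 * k - 3) ^ L)"
proof (cases "\<exists>p\<in>verts D. card (out_darts D p) \<ge> 2 * k - 1")
  case True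
  then obtain p where p: "p \<in> verts D" "card (out_darts D p) \<ge> 2 * k - 1" by blast
  \<comment> \<open>The two degrees add up to at most \<open>2 * k + 2\<close>, so \<open>v\<close>
    has degree at most 3, and \<open>3 \<le> 2 * k - 2\<close>.\<close>
  have "card (out_darts D v) \<le> 2 * k - 3 + 1" if "v \<noteq> p" for v
  proof (cases "v \<in> verts D")
    case True
    then show ?thesis using deg_pair_le[OF that _ p(1)] p(2) k3 by simp
  qed (simp add: out_darts_not_vert)
  then interpret one_big_vertex D p "2 * k - 3" "2 * k" L
    using deg_le deg_short_core_le[OF L, of p] k3 D by unfold_locales auto
  show ?thesis using num_conts_window[of e L] e k3 by simp
next
  case False
  have "card (succ_darts D f) \<le> 2 * k - 3" if "f \<in> D" for f
    using card_succ_darts_less[OF D(1) that] False tgt_in_verts[OF D(1) that] by force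
  then have "num_conts D e L \<le> (2 * k - 3) ^ L" using num_conts_power[of D] e by blast
  also have "\<dots> \<le> (2 * k * (1 + 2 * k * L)) * (2 * k - 3) ^ L" using k3 by simp
  also have "\<dots> = 2 * k * ((1 + 2 * k * L) * (2 * k - 3) ^ L)" by (simp only: mult.assoc)
  finally show ?thesis .
qed

end

section \<open>Counting the labels of closed walks\<close>

definition loop_words :: "('v, 'a) dart set \<Rightarrow> nat \<Rightarrow> 'a word set" where
  "loop_words D n = {w. length w = n \<and> reduced w \<and> (\<exists>q c. walk D c q c \<and> map lab q = w)}"

lemma card_loop_words:
  assumes "finite D" "\<And>e. e \<in> D \<Longrightarrow> num_conts D e n \<le> B"
  shows "finite (loop_words D (Suc n))" "card (loop_words D (Suc n)) \<le> card D * B"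
  unfolding loop_words_def using card_closed_walk_labels_le[OF assms] by simp_all

context core_graph
begin

text \<open>This is meant for graphs of rank at most \<open>k - 1\<close>, where
  \<open>2 * (k - 1) - 1 = 2 * k - 3\<close>.\<close>

lemma card_loop_words_thin:
  shows "finite (loop_words D (Suc n)) \<and> card (loop_words D (Suc n)) \<le> card D * (2 * k - 1) ^ n"
proof -
  have "card (succ_darts D f) \<le> 2 * k - 1" if "f \<in> D" for f
    using card_succ_darts_less[OF D(1) that] deg_le[of "tgt f"] by simp
  then have "num_conts D e n \<le> (2 * k - 1) ^ n" if "e \<in> D" for e
    using num_conts_power[of D] that by blast
  then show ?thesis using card_loop_words dart_graphD(1)[OF D(1)] by blast
qed

text \<open>The walk is cut into blocks of length \<open>L\<close>, each with at most
  \<open>\<mu> ^ L\<close> choices. The remainder of \<open>n mod L\<close> steps is bounded crudely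
  and affects only the constant.\<close>

lemma card_loop_words_core:
  fixes \<mu> :: real
  assumes k3: "k \<ge> 3" and L: "2 * (4 * k + 1) ^ L < card D" "L \<ge> 1"
    and \<mu>: "\<mu> \<ge> 1" "real (2 * k * ((1 + 2 * k * L) * (2 * k - 3) ^ L)) \<le> \<mu> ^ L"
  shows "finite (loop_words D (Suc n)) \<and>
    real (card (loop_words D (Suc n))) \<le> real (card D) * (2 * real k) ^ L * \<mu> ^ n"
proof -
  let ?M = "2 * k * ((1 + 2 * k * L) * (2 * k - 3) ^ L)"
  let ?B = "(2 * k) ^ (n mod L) * ?M ^ (n div L)"
  have s: "card (succ_darts D f) \<le> 2 * k" if "f \<in> D" for f
    using card_succ_darts_less[OF D(1) that] deg_le[of "tgt f"] by simp
  have q: "num_conts D e (n div L * L) \<le> ?M ^ (n div L)" if "e \<in> D" for e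
    using num_conts_mult[of D L ?M e] num_conts_core[OF k3 L(1)] that by blast
  have "num_conts D e n \<le> ?B" if "e \<in> D" for e
  proof -
    have "num_conts D e (n mod L + n div L * L) \<le> num_conts D e (n mod L) * ?M ^ (n div L)"
      using q that by (rule num_conts_add)
    also have "\<dots> \<le> ?B"
      using num_conts_power[of D "2 * k" e "n mod L", OF s that] by (intro mult_right_mono) auto
    finally show ?thesis by simp
  qed
  then have fin: "finite (loop_words D (Suc n))" and c: "card (loop_words D (Suc n)) \<le> card D * ?B"
    using card_loop_words[of D n ?B] dart_graphD(1)[OF D(1)] by blast+
  have "real ?M ^ (n div L) \<le> (\<mu> ^ L) ^ (n div L)"
    using \<mu>(2) by (intro power_mono) simp_all
  also have "\<dots> = \<mu> ^ (L * (n div L))" by (simp add: power_mult)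
  also have "\<dots> \<le> \<mu> ^ n" using \<mu>(1) by (intro power_increasing) simp_all
  finally have 1: "real ?M ^ (n div L) \<le> \<mu> ^ n" .
  have "(2 * real k) ^ (n mod L) \<le> (2 * real k) ^ L"
    using L(2) k3 by (intro power_increasing) (simp_all add: less_imp_le)
  then have "(2 * real k) ^ (n mod L) * real ?M ^ (n div L) \<le> (2 * real k) ^ L * \<mu> ^ n"
    using 1 by (intro mult_mono) simp_all
  then have "real ?B \<le> (2 * real k) ^ L * \<mu> ^ n"
    by simp
  then have "real (card D) * real ?B \<le> real (card D) * ((2 * real k) ^ L * \<mu> ^ n)"
    by (rule mult_left_mono) simp
  moreover have "real (card (loop_words D (Suc n))) \<le> real (card D) * real ?B"
    using c by (metis of_nat_le_iff of_nat_mult)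
  ultimately show ?thesis using fin by (simp add: mult.assoc)
qed

end

text \<open>A closed walk labelled \<open>w\<close> covers a graph of rank at most \<open>k - 1\<close> with less than \<open>m\<close>
  edges, or a graph of rank at most \<open>k\<close> with at least \<open>m\<close> and at most \<open>m + k + 1\<close> edges.\<close>

definition covers_small_graph :: "'v itself \<Rightarrow> nat \<Rightarrow> nat \<Rightarrow> 'a word \<Rightarrow> bool" where
  "covers_small_graph T k m w \<longleftrightarrow> (\<exists>(q :: ('v, 'a) dart list) c. let W = sym_closure (set q) in
     walk W c q c \<and> map lab q = w \<and>
     (card W < 2 * m \<and> card W + 2 \<le> 2 * card (verts W) + 2 * (k - 1) \<or>
      2 * m \<le> card W \<and> card W \<le> 2 * m + 2 * k + 2 \<and> card W + 2 \<le> 2 * card (verts W) + 2 * k))"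

text \<open>Vertices are no more numerous than darts, so they can be renamed to numbers below a
  fixed bound. All graphs in question then lie in one finite set.\<close>

lemma covers_small_graph_nat:
  assumes "covers_small_graph TYPE('v) k m w" "w \<noteq> []" "set w \<subseteq> X \<times> UNIV"
  shows "\<exists>(q :: (nat, 'a) dart list) c. let W = sym_closure (set q) in
     W \<subseteq> {..<2 * m + 2 * k + 2} \<times> (X \<times> UNIV) \<times> {..<2 * m + 2 * k + 2} \<and>
     walk W c q c \<and> map lab q = w \<and>
     (card W < 2 * m \<and> card W + 2 \<le> 2 * card (verts W) + 2 * (k - 1) \<or>
      2 * m \<le> card W \<and> card W \<le> 2 * m + 2 * k + 2 \<and> card W + 2 \<le> 2 * card (verts W) + 2 * k)"
proof -
  let ?B = "2 * m + 2 * k + 2"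
  obtain q :: "('v, 'a) dart list" and c where q: "walk (sym_closure (set q)) c q c" "map lab q = w"
    and W: "card (sym_closure (set q)) < 2 * m \<and>
        card (sym_closure (set q)) + 2 \<le> 2 * card (verts (sym_closure (set q))) + 2 * (k - 1) \<or>
      2 * m \<le> card (sym_closure (set q)) \<and> card (sym_closure (set q)) \<le> ?B \<and>
        card (sym_closure (set q)) + 2 \<le> 2 * card (verts (sym_closure (set q))) + 2 * k"
    using assms(1) unfolding covers_small_graph_def Let_def by blast
  let ?W = "sym_closure (set q)"
  have g: "dart_graph ?W" by (simp add: dart_graph_sym_closure)
  have "card (verts ?W) \<le> card ?W"
    unfolding verts_def by (rule card_image_le) (rule dart_graphD(1)[OF g])
  then have "card (verts ?W) \<le> card {..<?B}" using W by auto
  then obtain f where f: "f ` verts ?W \<subseteq> {..<?B}" "inj_on f (verts ?W)"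
    using card_le_inj[OF finite_verts[OF g], of "{..<?B}"] by auto
  let ?q = "map (map_dart f) q"
  have W': "sym_closure (set ?q) = map_dart f ` ?W" by (simp add: sym_closure_map)
  have c1: "card (map_dart f ` ?W) = card ?W"
    by (rule card_image[OF inj_on_map_dart[OF g f(2)]])
  have c2: "card (verts (map_dart f ` ?W)) = card (verts ?W)"
    unfolding verts_map using f(2) by (rule card_image)
  have l: "fst (lab d) \<in> X" if dW: "d \<in> ?W" for d
  proof -
    obtain e where e: "e \<in> set q" "d = e \<or> d = rev_dart e"
      using dW unfolding sym_closure_def by blast
    then have "fst (lab d) = fst (lab e)" by (elim disjE) simp_all
    then have "fst (lab d) \<in> fst ` set w"
      using e(1) unfolding q(2)[symmetric] by auto
    then show ?thesis using assms(3) by auto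
  qed
  have "map_dart f ` ?W \<subseteq> {..<?B} \<times> (X \<times> UNIV) \<times> {..<?B}"
  proof
    fix x assume "x \<in> map_dart f ` ?W"
    then obtain d where d: "d \<in> ?W" "x = map_dart f d" by blast
    have "f (fst d) \<in> {..<?B}" "f (tgt d) \<in> {..<?B}"
      using f(1) fst_in_verts[OF d(1)] tgt_in_verts[OF g d(1)] by blast+
    then show "x \<in> {..<?B} \<times> (X \<times> UNIV) \<times> {..<?B}"
      using l[OF d(1)] unfolding d(2) map_dart_def by (simp add: mem_Times_iff)
  qed
  moreover have "walk (map_dart f ` ?W) (f c) ?q (f c)" using q(1) by (rule walk_map)
  moreover have "map lab ?q = w" using q(2) by auto
  ultimately show ?thesis using W unfolding Let_def W'[symmetric] c1[symmetric] c2[symmetric]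
    by blast
qed

lemma core_graph_closed_walk:
  assumes "walk (sym_closure (set q)) c q c" "reduced (map lab q @ map lab q)"
    "card (sym_closure (set q)) + 2 \<le> 2 * card (verts (sym_closure (set q))) + 2 * k"
  shows "core_graph (sym_closure (set q)) k"
  using assms deg_closed_walk[OF assms(1,2)] conn_walk[OF assms(1)]
  by unfold_locales (auto simp: dart_graph_sym_closure)

lemma reduced_append1: "reduced (u @ v) \<Longrightarrow> reduced u"
  and reduced_append2: "reduced (u @ v) \<Longrightarrow> reduced v"
  by (auto simp: reduced_def successively_append_iff)

text \<open>After division by \<open>\<mu> ^ L\<close>, the left side is a linear function of
  \<open>L\<close> times a power of \<open>s / \<mu> < 1\<close>, which tends to 0.\<close>

lemma window_exists:
  fixes \<mu> :: real and s t :: nat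
  assumes "real s < \<mu>"
  shows "\<exists>L\<ge>1. real (t * ((1 + t * L) * s ^ L)) \<le> \<mu> ^ L"
proof -
  have \<mu>: "\<mu> > 0" using assms by simp
  define r where "r = real s / \<mu>"
  have r: "0 \<le> r" "r < 1" using assms \<mu> by (simp_all add: r_def)
  have "(\<lambda>L. real t * r ^ L + real t * real t * (real L * r ^ L)) \<longlonglongrightarrow> real t * 0 + real t * real t * 0"
    using r by (intro tendsto_intros LIMSEQ_realpow_zero powser_times_n_limit_0) auto
  then have "eventually (\<lambda>L. real t * r ^ L + real t * real t * (real L * r ^ L) < 1) sequentially"
    by (rule order_tendstoD(2)) simp
  then obtain N where N: "\<And>L. L \<ge> N \<Longrightarrow> real t * r ^ L + real t * real t * (real L * r ^ L) < 1"
    by (auto simp: eventually_sequentially)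
  let ?L = "Suc N"
  have "real (t * ((1 + t * ?L) * s ^ ?L))
      = (real t * r ^ ?L + real t * real t * (real ?L * r ^ ?L)) * \<mu> ^ ?L"
    using \<mu> unfolding r_def power_divide by (simp add: field_simps del: power_Suc)
  also have "\<dots> \<le> 1 * \<mu> ^ ?L"
    using N[of ?L] \<mu> by (intro mult_right_mono) simp_all
  finally show ?thesis by (intro exI[of _ ?L]) simp
qed

text \<open>The order of choices matters: \<open>\<mu>\<close> determines \<open>L\<close>, then
  \<open>L\<close> determines \<open>m\<close>, and \<open>m\<close> the finite family of graphs.
  Nothing depends on \<open>n\<close>, so the constants of the family can be added.\<close>

lemma card_covers_small_graph:
  fixes \<mu> :: real and X :: "'a set"
  assumes X: "finite X" and k3: "k \<ge> 3" and \<mu>: "2 * real k - 3 < \<mu>"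
  shows "\<exists>m>k. \<exists>C\<ge>0. \<forall>n. real (card {w. set w \<subseteq> X \<times> UNIV \<and> length w = Suc n \<and>
    reduced (w @ w) \<and> covers_small_graph TYPE('v) k m w}) \<le> C * \<mu> ^ n"
proof -
  have \<mu>1: "\<mu> \<ge> 1" and s: "real (2 * k - 3) < \<mu>" using k3 \<mu> by (simp_all add: of_nat_diff)
  obtain L where L: "L \<ge> 1" "real (2 * k * ((1 + 2 * k * L) * (2 * k - 3) ^ L)) \<le> \<mu> ^ L"
    using window_exists[OF s, of "2 * k"] by blast
  \<comment> \<open>With at least \<open>2 * m\<close> darts a graph exceeds the bound
    \<open>2 * (4 * k + 1) ^ L\<close> for its short cores; the summand \<open>k + 1\<close> ensures
    \<open>m > k\<close>.\<close>
  define m where "m = (4 * k + 1) ^ L + k + 1"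
  let ?B = "2 * m + 2 * k + 2"
  define C0 where "C0 = real ?B * (2 * real k) ^ L"
  define Fam :: "(nat, 'a) dart set set" where
    "Fam = {W. W \<subseteq> {..<?B} \<times> (X \<times> UNIV) \<times> {..<?B} \<and>
      (\<forall>n. finite (loop_words W (Suc n)) \<and> real (card (loop_words W (Suc n))) \<le> C0 * \<mu> ^ n)}"
  have FamD: "real (card (loop_words W (Suc n))) \<le> C0 * \<mu> ^ n" if "W \<in> Fam" for W n
    using that unfolding Fam_def by blast
  have finFam: "finite Fam"
  proof (rule finite_subset)
    show "Fam \<subseteq> Pow ({..<?B} \<times> (X \<times> UNIV) \<times> {..<?B})" by (auto simp: Fam_def)
  qed (use X in auto)
  have one: "1 \<le> (2 * real k) ^ L" using k3 by (intro one_le_power) simp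
  have inFam: "\<exists>W\<in>Fam. w \<in> loop_words W (Suc n)"
    if w: "set w \<subseteq> X \<times> UNIV" "length w = Suc n" "reduced (w @ w)"
      "covers_small_graph TYPE('v) k m w" for w n
  proof -
    have "w \<noteq> []" using w(2) by auto
    then obtain q :: "(nat, 'a) dart list" and c where
      sub: "sym_closure (set q) \<subseteq> {..<?B} \<times> (X \<times> UNIV) \<times> {..<?B}" and
      q: "walk (sym_closure (set q)) c q c" "map lab q = w" and
      W: "card (sym_closure (set q)) < 2 * m \<and>
        card (sym_closure (set q)) + 2 \<le> 2 * card (verts (sym_closure (set q))) + 2 * (k - 1) \<or>
      2 * m \<le> card (sym_closure (set q)) \<and> card (sym_closure (set q)) \<le> ?B \<and>
        card (sym_closure (set q)) + 2 \<le> 2 * card (verts (sym_closure (set q))) + 2 * k"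
      using covers_small_graph_nat[OF w(4) _ w(1)] unfolding Let_def by blast
    let ?W = "sym_closure (set q)"
    have red: "reduced (map lab q @ map lab q)" using q(2) w(3) by simp
    have "finite (loop_words ?W (Suc i)) \<and> real (card (loop_words ?W (Suc i))) \<le> C0 * \<mu> ^ i" for i
      using W
    proof (elim disjE conjE)
      assume a: "card ?W < 2 * m" "card ?W + 2 \<le> 2 * card (verts ?W) + 2 * (k - 1)"
      interpret core_graph ?W "k - 1"
        using core_graph_closed_walk[OF q(1) red a(2)] .
      have e: "2 * (k - 1) - 1 = 2 * k - 3" by simp
      have c: "finite (loop_words ?W (Suc i))" "card (loop_words ?W (Suc i)) \<le> card ?W * (2 * k - 3) ^ i"
        using card_loop_words_thin[of i] unfolding e by simp_all
      have "real (card (loop_words ?W (Suc i))) \<le> real (card ?W) * real (2 * k - 3) ^ i"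
        using c(2) by (metis of_nat_le_iff of_nat_mult of_nat_power)
      also have "\<dots> \<le> C0 * \<mu> ^ i"
      proof (rule mult_mono)
        have "real (card ?W) * 1 \<le> real ?B * (2 * real k) ^ L"
          using a(1) one by (intro mult_mono) simp_all
        then show "real (card ?W) \<le> C0" by (simp add: C0_def)
        show "real (2 * k - 3) ^ i \<le> \<mu> ^ i" using s by (intro power_mono) simp_all
      qed (simp_all add: C0_def)
      finally show ?thesis using c(1) by blast
    next
      assume a: "2 * m \<le> card ?W" "card ?W \<le> ?B" "card ?W + 2 \<le> 2 * card (verts ?W) + 2 * k"
      interpret core_graph ?W k
        using core_graph_closed_walk[OF q(1) red a(3)] .
      have b: "2 * (4 * k + 1) ^ L < card ?W" using a(1) by (simp add: m_def)
      have c: "finite (loop_words ?W (Suc i))" "real (card (loop_words ?W (Suc i))) \<le>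
          real (card ?W) * (2 * real k) ^ L * \<mu> ^ i"
        using card_loop_words_core[OF k3 b L(1) \<mu>1 L(2), of i] by simp_all
      have "real (card ?W) * (2 * real k) ^ L * \<mu> ^ i \<le> C0 * \<mu> ^ i"
        unfolding C0_def using a(2) \<mu>1 by (intro mult_right_mono) simp_all
      then show ?thesis using c by linarith
    qed
    then have "?W \<in> Fam" using sub unfolding Fam_def by blast
    moreover have "w \<in> loop_words ?W (Suc n)"
      unfolding loop_words_def using w(2) reduced_append1[OF w(3)] q by blast
    ultimately show ?thesis by blast
  qed
  have "real (card {w. set w \<subseteq> X \<times> UNIV \<and> length w = Suc n \<and>
    reduced (w @ w) \<and> covers_small_graph TYPE('v) k m w}) \<le> real (card Fam) * C0 * \<mu> ^ n" for n
  proof -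
    let ?S = "{w. set w \<subseteq> X \<times> UNIV \<and> length w = Suc n \<and>
      reduced (w @ w) \<and> covers_small_graph TYPE('v) k m w}"
    have "?S \<subseteq> (\<Union>W\<in>Fam. loop_words W (Suc n))" using inFam by blast
    moreover have "finite (\<Union>W\<in>Fam. loop_words W (Suc n))"
      using finFam by (auto simp: Fam_def)
    ultimately have 1: "card ?S \<le> card (\<Union>W\<in>Fam. loop_words W (Suc n))" by (rule card_mono[rotated])
    have 2: "card (\<Union>W\<in>Fam. loop_words W (Suc n)) \<le> (\<Sum>W\<in>Fam. card (loop_words W (Suc n)))"
      by (rule card_UN_le[OF finFam])
    have "real (card ?S) \<le> real (\<Sum>W\<in>Fam. card (loop_words W (Suc n)))"
      using order_trans[OF 1 2] by (rule of_nat_mono)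
    moreover have "real (\<Sum>W\<in>Fam. card (loop_words W (Suc n))) \<le> (\<Sum>W\<in>Fam. C0 * \<mu> ^ n)"
      unfolding of_nat_sum by (intro sum_mono FamD)
    moreover have "(\<Sum>W\<in>Fam. C0 * \<mu> ^ n) = real (card Fam) * C0 * \<mu> ^ n"
      unfolding sum_constant by (simp only: mult.assoc)
    ultimately show ?thesis by linarith
  qed
  moreover have "m > k" by (simp add: m_def)
  moreover have "real (card Fam) * C0 \<ge> 0" by (simp add: C0_def)
  ultimately show ?thesis by blast
qed

section \<open>Homomorphisms from free products\<close>

lemma internal_free_product_sym:
  "internal_free_product G H K \<Longrightarrow> internal_free_product G K H"
proof -
  have "alternating_lists G H K = alternating_lists G K H"
    unfolding alternating_lists_def by (auto elim!: successively_mono)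
  then show "internal_free_product G H K \<Longrightarrow> internal_free_product G K H"
    by (auto simp: internal_free_product_def)
qed

lemma (in monoid) list_prod_closed:
  "set gs \<subseteq> carrier G \<Longrightarrow> list_prod G gs \<in> carrier G"
  by (induction gs) (auto simp: list_prod_def)

lemma list_prod_Cons: "list_prod G (g # gs) = g \<otimes>\<^bsub>G\<^esub> list_prod G gs"
  by (simp add: list_prod_def)

lemma alternating_lists_Cons:
  "g # gs \<in> alternating_lists G H K \<longleftrightarrow> g \<in> (H \<union> K) - {\<one>\<^bsub>G\<^esub>} \<and> gs \<in> alternating_lists G H K \<and>
     (gs \<noteq> [] \<longrightarrow> (g \<in> H \<and> hd gs \<in> K) \<or> (g \<in> K \<and> hd gs \<in> H))"
  by (cases gs) (auto simp: alternating_lists_def)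

text \<open>The universal property of the free product: evaluate the normal form in
  \<open>M\<close>. Multiplicativity reduces to left multiplication by an element of one factor,
  which changes the normal form only at its head.\<close>

lemma free_product_hom:
  assumes G: "group G" and M: "group M" and fp: "internal_free_product G H K"
    and \<alpha>: "\<alpha> \<in> H \<rightarrow> carrier M" "\<And>x y. x \<in> H \<Longrightarrow> y \<in> H \<Longrightarrow> \<alpha> (x \<otimes>\<^bsub>G\<^esub> y) = \<alpha> x \<otimes>\<^bsub>M\<^esub> \<alpha> y"
    and \<beta>: "\<beta> \<in> K \<rightarrow> carrier M" "\<And>x y. x \<in> K \<Longrightarrow> y \<in> K \<Longrightarrow> \<beta> (x \<otimes>\<^bsub>G\<^esub> y) = \<beta> x \<otimes>\<^bsub>M\<^esub> \<beta> y"
  shows "\<exists>\<phi>\<in>hom G M. (\<forall>x\<in>H. \<phi> x = \<alpha> x) \<and> (\<forall>x\<in>K. \<phi> x = \<beta> x)"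
proof -
  interpret G: group G by fact
  interpret M: group M by fact
  have H: "subgroup H G" and K: "subgroup K G" and HK: "H \<inter> K = {\<one>\<^bsub>G\<^esub>}"
    and bij: "bij_betw (list_prod G) (alternating_lists G H K) (carrier G)"
    using fp by (auto simp: internal_free_product_def)
  have one: "\<one>\<^bsub>G\<^esub> \<in> H" "\<one>\<^bsub>G\<^esub> \<in> K"
    using subgroup.one_closed[OF H] subgroup.one_closed[OF K] by auto
  have idem: "x = \<one>\<^bsub>M\<^esub>" if "x \<in> carrier M" "x \<otimes>\<^bsub>M\<^esub> x = x" for x
    using that M.l_cancel_one' by metis
  have \<alpha>1: "\<alpha> \<one>\<^bsub>G\<^esub> = \<one>\<^bsub>M\<^esub>" using \<alpha>(1) \<alpha>(2)[OF one(1) one(1)] one(1) by (intro idem) auto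
  have \<beta>1: "\<beta> \<one>\<^bsub>G\<^esub> = \<one>\<^bsub>M\<^esub>" using \<beta>(1) \<beta>(2)[OF one(2) one(2)] one(2) by (intro idem) auto
  \<comment> \<open>The two maps agree on the intersection, since both send the identity to the
    identity.\<close>
  define \<gamma> where "\<gamma> x = (if x \<in> H then \<alpha> x else \<beta> x)" for x
  have \<gamma>K: "\<gamma> x = \<beta> x" if "x \<in> K" for x
  proof (cases "x \<in> H")
    case True
    then have "x = \<one>\<^bsub>G\<^esub>" using that HK by blast
    then show ?thesis using True \<alpha>1 \<beta>1 by (simp add: \<gamma>_def)
  qed (simp add: \<gamma>_def)
  have \<gamma>H: "\<gamma> x = \<alpha> x" if "x \<in> H" for x using that by (simp add: \<gamma>_def)
  have \<gamma>_closed: "\<gamma> x \<in> carrier M" if "x \<in> H \<union> K" for x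
    using that \<alpha>(1) \<beta>(1) by (auto simp: \<gamma>_def)
  have HKG: "H \<union> K \<subseteq> carrier G" using subgroup.subset[OF H] subgroup.subset[OF K] by blast
  define ev where "ev gs = list_prod M (map \<gamma> gs)" for gs
  have ev_Cons: "ev (g # gs) = \<gamma> g \<otimes>\<^bsub>M\<^esub> ev gs" for g gs by (simp add: ev_def list_prod_Cons)
  have ev_closed: "ev gs \<in> carrier M" if "set gs \<subseteq> H \<union> K" for gs
    unfolding ev_def using that \<gamma>_closed by (intro M.list_prod_closed) auto
  have alt: "set gs \<subseteq> H \<union> K" if "gs \<in> alternating_lists G H K" for gs
    using that by (auto simp: alternating_lists_def)
  define nf where "nf = inv_into (alternating_lists G H K) (list_prod G)"
  have nf: "nf x \<in> alternating_lists G H K" "list_prod G (nf x) = x" if "x \<in> carrier G" for x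
    using that bij unfolding nf_def bij_betw_def by (metis inv_into_into, metis f_inv_into_f)
  have nf_eq: "nf (list_prod G gs) = gs" if "gs \<in> alternating_lists G H K" for gs
    using that bij unfolding nf_def bij_betw_def by (metis inv_into_f_f)
  have same: "\<gamma> (a \<otimes>\<^bsub>G\<^esub> g) = \<gamma> a \<otimes>\<^bsub>M\<^esub> \<gamma> g \<and> a \<otimes>\<^bsub>G\<^esub> g \<in> H \<union> K"
    if "(a \<in> H \<and> g \<in> H) \<or> (a \<in> K \<and> g \<in> K)" for a g
    using that \<alpha>(2) \<beta>(2) \<gamma>H \<gamma>K subgroup.m_closed[OF H] subgroup.m_closed[OF K] by auto
  \<comment> \<open>The element \<open>a\<close> is trivial, is put in front of the list, or merges
    with the first entry. In the last case the product may be trivial, and then the entry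
    disappears.\<close>
  have step: "\<exists>gs'\<in>alternating_lists G H K. list_prod G gs' = a \<otimes>\<^bsub>G\<^esub> list_prod G gs \<and>
      ev gs' = \<gamma> a \<otimes>\<^bsub>M\<^esub> ev gs"
    if a: "a \<in> H \<union> K" and gs: "gs \<in> alternating_lists G H K" for a gs
  proof -
    have c: "list_prod G gs \<in> carrier G" "ev gs \<in> carrier M"
      using alt[OF gs] HKG by (auto intro: G.list_prod_closed ev_closed)
    consider "a = \<one>\<^bsub>G\<^esub>" | "a \<noteq> \<one>\<^bsub>G\<^esub>" "gs = []"
      | g t where "a \<noteq> \<one>\<^bsub>G\<^esub>" "gs = g # t" "(a \<in> H \<and> g \<in> K) \<or> (a \<in> K \<and> g \<in> H)"
      | g t where "a \<noteq> \<one>\<^bsub>G\<^esub>" "gs = g # t" "(a \<in> H \<and> g \<in> H) \<or> (a \<in> K \<and> g \<in> K)"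
      using a alt[OF gs] by (cases gs) auto
    then show ?thesis
    proof cases
      case 1
      then show ?thesis using c gs one(1) \<gamma>H \<alpha>1 by (intro bexI[of _ gs]) auto
    next
      case 2
      then show ?thesis using a gs
        by (intro bexI[of _ "[a]"]) (auto simp: alternating_lists_Cons list_prod_Cons ev_Cons)
    next
      case 3
      then show ?thesis using a gs
        by (intro bexI[of _ "a # gs"]) (auto simp: alternating_lists_Cons list_prod_Cons ev_Cons)
    next
      case 4
      have t: "t \<in> alternating_lists G H K" and g: "g \<in> H \<union> K"
        using gs 4 by (simp_all add: alternating_lists_Cons)
      have ct: "list_prod G t \<in> carrier G" "ev t \<in> carrier M"
        using alt[OF t] HKG by (auto intro: G.list_prod_closed ev_closed)
      have ag: "a \<in> carrier G" "g \<in> carrier G" using a g HKG by auto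
      have p: "a \<otimes>\<^bsub>G\<^esub> list_prod G gs = (a \<otimes>\<^bsub>G\<^esub> g) \<otimes>\<^bsub>G\<^esub> list_prod G t"
        using ag ct 4(2) by (simp add: list_prod_Cons G.m_assoc)
      have q: "\<gamma> a \<otimes>\<^bsub>M\<^esub> ev gs = \<gamma> (a \<otimes>\<^bsub>G\<^esub> g) \<otimes>\<^bsub>M\<^esub> ev t"
        using same[OF 4(3)] ct 4(2) \<gamma>_closed a g by (simp add: ev_Cons M.m_assoc)
      show ?thesis
      proof (cases "a \<otimes>\<^bsub>G\<^esub> g = \<one>\<^bsub>G\<^esub>")
        case True
        then show ?thesis using p q t ct one(1) \<gamma>H \<alpha>1 by (intro bexI[of _ t]) auto
      next
        case False
        have "(a \<otimes>\<^bsub>G\<^esub> g) # t \<in> alternating_lists G H K"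
          using False same[OF 4(3)] t gs 4 HK subgroup.m_closed[OF H] subgroup.m_closed[OF K]
          by (auto simp: alternating_lists_Cons)
        then show ?thesis using p q
          by (intro bexI[of _ "(a \<otimes>\<^bsub>G\<^esub> g) # t"]) (auto simp: list_prod_Cons ev_Cons)
      qed
    qed
  qed
  define \<phi> where "\<phi> x = ev (nf x)" for x
  have \<phi>_closed: "\<phi> x \<in> carrier M" if "x \<in> carrier G" for x
    unfolding \<phi>_def using nf(1)[OF that] alt by (intro ev_closed) blast
  have \<phi>_step: "\<phi> (a \<otimes>\<^bsub>G\<^esub> x) = \<gamma> a \<otimes>\<^bsub>M\<^esub> \<phi> x" if aHK: "a \<in> H \<union> K" and xG: "x \<in> carrier G" for a x
  proof -
    obtain gs' where "gs' \<in> alternating_lists G H K" "list_prod G gs' = a \<otimes>\<^bsub>G\<^esub> x"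
      "ev gs' = \<gamma> a \<otimes>\<^bsub>M\<^esub> \<phi> x"
      using step[OF aHK nf(1)[OF xG]] nf(2)[OF xG] unfolding \<phi>_def by auto
    then show ?thesis using nf_eq unfolding \<phi>_def by metis
  qed
  have \<phi>_list: "\<phi> (list_prod G gs \<otimes>\<^bsub>G\<^esub> y) = ev gs \<otimes>\<^bsub>M\<^esub> \<phi> y"
    if "set gs \<subseteq> H \<union> K" "y \<in> carrier G" for gs y
    using that(1)
  proof (induction gs)
    case Nil
    then show ?case using that(2) \<phi>_closed by (simp add: ev_def list_prod_def)
  next
    case (Cons g gs)
    have c: "list_prod G gs \<in> carrier G" "ev gs \<in> carrier M" "g \<in> carrier G" "\<gamma> g \<in> carrier M"
      using Cons.prems HKG \<gamma>_closed by (auto intro!: G.list_prod_closed ev_closed)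
    have "\<phi> (list_prod G (g # gs) \<otimes>\<^bsub>G\<^esub> y) = \<phi> (g \<otimes>\<^bsub>G\<^esub> (list_prod G gs \<otimes>\<^bsub>G\<^esub> y))"
      using c that(2) by (simp add: list_prod_Cons G.m_assoc)
    also have "\<dots> = \<gamma> g \<otimes>\<^bsub>M\<^esub> \<phi> (list_prod G gs \<otimes>\<^bsub>G\<^esub> y)"
      using Cons.prems c that(2) by (intro \<phi>_step) auto
    also have "\<dots> = ev (g # gs) \<otimes>\<^bsub>M\<^esub> \<phi> y"
      using Cons c \<phi>_closed[OF that(2)] by (simp add: ev_Cons M.m_assoc)
    finally show ?case .
  qed
  have \<phi>1: "\<phi> \<one>\<^bsub>G\<^esub> = \<one>\<^bsub>M\<^esub>"
  proof -
    have "[] \<in> alternating_lists G H K" by (simp add: alternating_lists_def)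
    then have "nf \<one>\<^bsub>G\<^esub> = []" using nf_eq[of "[]"] by (simp add: list_prod_def)
    then show ?thesis by (simp add: \<phi>_def ev_def list_prod_def)
  qed
  have \<phi>_HK: "\<phi> x = \<gamma> x" if "x \<in> H \<union> K" for x
    using \<phi>_step[OF that G.one_closed] \<phi>1 \<gamma>_closed[OF that] that HKG by auto
  have "\<phi> \<in> hom G M"
  proof (rule homI)
    fix x y assume xy: "x \<in> carrier G" "y \<in> carrier G"
    show "\<phi> (x \<otimes>\<^bsub>G\<^esub> y) = \<phi> x \<otimes>\<^bsub>M\<^esub> \<phi> y"
      using \<phi>_list[OF alt[OF nf(1)[OF xy(1)]] xy(2)] nf(2)[OF xy(1)] unfolding \<phi>_def by simp
  qed (rule \<phi>_closed)
  then show ?thesis using \<phi>_HK \<gamma>H \<gamma>K by (intro bexI[of _ \<phi>]) auto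
qed

text \<open>Extend the identity on \<open>H\<close> and the trivial map on \<open>K\<close>. The
  retraction will show that a free factor is finitely generated.\<close>

lemma free_product_retraction:
  assumes G: "group G" and fp: "internal_free_product G H K"
  shows "\<exists>\<rho>\<in>hom G (G\<lparr>carrier := H\<rparr>). \<forall>x\<in>H. \<rho> x = x"
proof -
  interpret G: group G by fact
  have H: "subgroup H G" using fp by (simp add: internal_free_product_def)
  have "group (G\<lparr>carrier := H\<rparr>)" using G.subgroup_imp_group[OF H] .
  then have "\<exists>\<phi>\<in>hom G (G\<lparr>carrier := H\<rparr>). (\<forall>x\<in>H. \<phi> x = id x) \<and> (\<forall>x\<in>K. \<phi> x = \<one>\<^bsub>G\<^esub>)"
    using subgroup.one_closed[OF H] by (intro free_product_hom[OF G _ fp]) auto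
  then show ?thesis by auto
qed

lemma internal_free_product_trivial:
  assumes G: "group G" and fp: "internal_free_product G H {\<one>\<^bsub>G\<^esub>}"
  shows "H = carrier G"
proof
  interpret G: group G by fact
  have H: "subgroup H G" using fp by (simp add: internal_free_product_def)
  show "H \<subseteq> carrier G" by (rule subgroup.subset[OF H])
  have prod: "list_prod G gs \<in> H" if "set gs \<subseteq> H" for gs
    using that by (induction gs) (auto simp: list_prod_def subgroup.one_closed[OF H] subgroup.m_closed[OF H])
  show "carrier G \<subseteq> H"
  proof
    fix x assume "x \<in> carrier G"
    then obtain gs where gs: "gs \<in> alternating_lists G H {\<one>\<^bsub>G\<^esub>}" "x = list_prod G gs"
      using fp unfolding internal_free_product_def bij_betw_def by blast
    then have "set gs \<subseteq> H" by (auto simp: alternating_lists_def)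
    then show "x \<in> H" using prod gs(2) by simp
  qed
qed

section \<open>Coset graphs of subgroups of a free group\<close>

fun coset_path :: "'a set \<Rightarrow> 'a word set \<Rightarrow> 'a word \<Rightarrow> ('a word set, 'a) dart list" where
  "coset_path X S [] = []"
| "coset_path X S (l # w) =
     (S, l, S #>\<^bsub>free_group X\<^esub> [l]) # coset_path X (S #>\<^bsub>free_group X\<^esub> [l]) w"

text \<open>A finite part of the Schreier graph of the right cosets of \<open>L\<close>.\<close>

definition coset_graph :: "'a set \<Rightarrow> 'a word set \<Rightarrow> 'a word \<Rightarrow> ('a word set, 'a) dart set" where
  "coset_graph X L U = sym_closure (set (coset_path X L U))"

text \<open>This is the number, modulo 2, of crossings of marked darts by the path of the word; on
  truth values \<open>\<noteq>\<close> is addition modulo 2. For a symmetric \<open>f\<close> it is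
  a cocycle of the coset graph.\<close>

fun parity_along :: "'a set \<Rightarrow> ('a word set, 'a) dart set \<Rightarrow> 'a word set \<Rightarrow> 'a word \<Rightarrow> bool" where
  "parity_along X f S [] = False"
| "parity_along X f S (l # w) = (((S, l, S #>\<^bsub>free_group X\<^esub> [l]) \<in> f) \<noteq>
     parity_along X f (S #>\<^bsub>free_group X\<^esub> [l]) w)"

section \<open>Words, cosets and crossing parities in a free group\<close>

locale free_group_on =
  fixes X :: "'a set" and F :: "'a word monoid" (structure)
  assumes F_eq: "F = free_group X"
begin

sublocale group F unfolding F_eq by (rule group_free_group)

abbreviation val :: "'a word \<Rightarrow> 'a word" where "val w \<equiv> foldr push w []"

abbreviation words :: "'a word set" where "words \<equiv> {w. set w \<subseteq> X \<times> UNIV}"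

lemma carrier_eq: "carrier F = {w. set w \<subseteq> X \<times> UNIV \<and> reduced w}"
  by (simp add: F_eq free_group_def reduced_words_def)

lemma mult_eq: "u \<otimes> v = foldr push u v"
  by (simp add: F_eq free_group_def)

lemma one_eq: "\<one> = []"
  by (simp add: F_eq free_group_def)

lemma val_closed: "w \<in> words \<Longrightarrow> val w \<in> carrier F"
  using set_foldr_push[of w "[]"] by (auto simp: carrier_eq reduced_foldr_push)

lemma val_id: "w \<in> carrier F \<Longrightarrow> val w = w"
  by (simp add: carrier_eq foldr_push_Nil)

lemma letter_closed: "l \<in> X \<times> UNIV \<Longrightarrow> [l] \<in> carrier F"
  by (auto simp: carrier_eq)

lemma val_Cons: "val (l # w) = [l] \<otimes> val w"
  by (simp add: mult_eq)

lemma val_append: "u \<in> words \<Longrightarrow> v \<in> words \<Longrightarrow> val (u @ v) = val u \<otimes> val v"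
proof (induction u)
  case Nil
  then show ?case using val_closed[of v] l_one one_eq by simp
next
  case (Cons l u)
  have "val ((l # u) @ v) = [l] \<otimes> (val u \<otimes> val v)"
    using Cons by (simp add: mult_eq)
  also have "\<dots> = ([l] \<otimes> val u) \<otimes> val v"
    using Cons.prems by (intro m_assoc[symmetric] letter_closed val_closed) auto
  finally show ?case by (simp add: mult_eq)
qed

lemma inv_words: "w \<in> words \<Longrightarrow> rev (map inv_letter w) \<in> words"
proof -
  assume w: "w \<in> words"
  have "inv_letter l \<in> X \<times> UNIV" if "l \<in> X \<times> UNIV" for l
    using that by (cases l) auto
  then show ?thesis using w by auto
qed

lemma inv_eq: "w \<in> carrier F \<Longrightarrow> inv w = rev (map inv_letter w)"
proof (rule inv_equality)
  assume w: "w \<in> carrier F"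
  have "foldr push (rev (map inv_letter w)) (foldr push w []) = []"
    by (rule foldr_push_inv) (simp add: reduced_def)
  then show "rev (map inv_letter w) \<otimes> w = \<one>"
    using val_id[OF w] by (simp add: mult_eq one_eq)
  show "rev (map inv_letter w) \<in> carrier F"
    using inv_words w reduced_inv by (auto simp: carrier_eq)
qed

lemma val_inv: "w \<in> words \<Longrightarrow> val (w @ rev (map inv_letter w)) = \<one>"
proof -
  assume w: "w \<in> words"
  have "foldr push (rev (map inv_letter (rev (map inv_letter w))))
      (foldr push (rev (map inv_letter w)) []) = []"
    by (rule foldr_push_inv) (simp add: reduced_def)
  moreover have "rev (map inv_letter (rev (map inv_letter w))) = w"
    by (simp add: rev_map o_def)
  ultimately show ?thesis by (simp add: one_eq)
qed

lemma coset_letter_inv: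
  assumes "S \<subseteq> carrier F" "l \<in> X \<times> UNIV"
  shows "(S #> [l]) #> [inv_letter l] = S"
proof -
  have i: "inv_letter l \<in> X \<times> UNIV" using assms(2) by (cases l) auto
  have "[l] \<otimes> [inv_letter l] = \<one>" by (simp add: mult_eq one_eq)
  then show ?thesis
    using coset_mult_assoc[OF assms(1) letter_closed[OF assms(2)] letter_closed[OF i]] assms(1)
    by simp
qed

lemma coset_Cons:
  assumes "S \<subseteq> carrier F" "l \<in> X \<times> UNIV" "w \<in> words"
  shows "(S #> [l]) #> val w = S #> val (l # w)"
  using coset_mult_assoc[OF assms(1) letter_closed[OF assms(2)] val_closed[OF assms(3)]]
  by (simp add: mult_eq)

lemma coset_append:
  assumes "S \<subseteq> carrier F" "u \<in> words" "w \<in> words"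
  shows "S #> val (u @ w) = (S #> val u) #> val w"
  unfolding val_append[OF assms(2,3)]
  using coset_mult_assoc[OF assms(1) val_closed[OF assms(2)] val_closed[OF assms(3)]] by simp

lemma coset_subset: "S \<subseteq> carrier F \<Longrightarrow> l \<in> X \<times> UNIV \<Longrightarrow> S #> [l] \<subseteq> carrier F"
  by (intro r_coset_subset_G letter_closed)

lemma coset_path_append:
  assumes "w \<in> words"
  shows "S \<subseteq> carrier F \<Longrightarrow> u \<in> words \<Longrightarrow>
    coset_path X S (u @ w) = coset_path X S u @ coset_path X (S #> val u) w"
proof (induction u arbitrary: S)
  case Nil
  then show ?case using coset_mult_one[of S] by (simp add: one_eq)
next
  case (Cons l u)
  have "S #> [l] \<subseteq> carrier F" using Cons.prems by (intro coset_subset) auto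
  then show ?case using Cons coset_Cons[of S l u] by (simp add: F_eq[symmetric])
qed

lemma walk_coset_path:
  "S \<subseteq> carrier F \<Longrightarrow> w \<in> words \<Longrightarrow> set (coset_path X S w) \<subseteq> D \<Longrightarrow>
    walk D S (coset_path X S w) (S #> val w)"
proof (induction w arbitrary: S)
  case Nil
  then show ?case using coset_mult_one[of S] by (simp add: one_eq)
next
  case (Cons l w)
  have s: "S #> [l] \<subseteq> carrier F" using Cons.prems by (intro coset_subset) auto
  have "walk D (S #> [l]) (coset_path X (S #> [l]) w) ((S #> [l]) #> val w)"
    using Cons.prems s by (intro Cons.IH) (auto simp: F_eq[symmetric])
  moreover have "(S #> [l]) #> val w = S #> val (l # w)" using Cons.prems by (intro coset_Cons) auto
  ultimately show ?case using Cons.prems(3) by (simp add: F_eq[symmetric])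
qed

lemma map_lab_coset_path: "map lab (coset_path X S w) = w"
  by (induction w arbitrary: S) auto

lemma coset_path_dart:
  "S \<subseteq> carrier F \<Longrightarrow> w \<in> words \<Longrightarrow> d \<in> set (coset_path X S w) \<Longrightarrow>
    tgt d = fst d #> [lab d] \<and> lab d \<in> X \<times> UNIV \<and> (\<exists>u\<in>words. fst d = S #> val u)"
proof (induction w arbitrary: S)
  case (Cons l w)
  have s: "S #> [l] \<subseteq> carrier F" using Cons.prems by (intro coset_subset) auto
  show ?case
  proof (cases "d = (S, l, S #> [l])")
    case True
    have "S = S #> val []" using coset_mult_one[of S] Cons.prems(1) by (simp add: one_eq)
    then have "\<exists>u\<in>words. S = S #> val u" by (rule bexI) simp
    then show ?thesis using True Cons.prems(2) by (simp add: F_eq[symmetric])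
  next
    case False
    then have "d \<in> set (coset_path X (S #> [l]) w)"
      using Cons.prems(3) by (simp add: F_eq[symmetric])
    then obtain u where u: "tgt d = fst d #> [lab d]" "lab d \<in> X \<times> UNIV" "u \<in> words"
      "fst d = (S #> [l]) #> val u"
      using Cons.IH[OF s] Cons.prems(2) by auto
    have "fst d = S #> val (l # u)" using u Cons.prems coset_Cons[of S l u] by simp
    moreover have "l # u \<in> words" using u(3) Cons.prems(2) by simp
    ultimately show ?thesis using u(1,2) by blast
  qed
qed simp

lemma parity_append:
  assumes "w \<in> words"
  shows "S \<subseteq> carrier F \<Longrightarrow> u \<in> words \<Longrightarrow>
    parity_along X f S (u @ w) = (parity_along X f S u \<noteq> parity_along X f (S #> val u) w)"
proof (induction u arbitrary: S)
  case Nil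
  then show ?case using coset_mult_one[of S] by (simp add: one_eq)
next
  case (Cons l u)
  have "S #> [l] \<subseteq> carrier F" using Cons.prems by (intro coset_subset) auto
  then show ?case using Cons coset_Cons[of S l u] by (auto simp: F_eq[symmetric])
qed

text \<open>A cancelling pair of letters crosses the same edge twice, in opposite
  directions.\<close>

lemma parity_push:
  assumes f: "rev_dart ` f \<subseteq> f" and S: "S \<subseteq> carrier F" and l: "l \<in> X \<times> UNIV"
  shows "parity_along X f S (push l v) = parity_along X f S (l # v)"
proof (cases v)
  case (Cons l' v')
  show ?thesis
  proof (cases "l' = inv_letter l")
    case True
    have c: "(S #> [l]) #> [inv_letter l] = S" by (rule coset_letter_inv[OF S l])
    have "(S, l, S #> [l]) \<in> f \<longleftrightarrow> (S #> [l], inv_letter l, S) \<in> f"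
      using f imageI[of "(S, l, S #> [l])" f rev_dart] imageI[of "(S #> [l], inv_letter l, S)" f rev_dart]
      unfolding rev_dart_def by auto
    then show ?thesis using Cons True c by (simp add: F_eq[symmetric]) argo
  qed (use Cons in simp)
qed simp

lemma parity_foldr_push:
  assumes f: "rev_dart ` f \<subseteq> f"
  shows "S \<subseteq> carrier F \<Longrightarrow> u \<in> words \<Longrightarrow>
    parity_along X f S (foldr push u v) = parity_along X f S (u @ v)"
proof (induction u arbitrary: S)
  case (Cons l u)
  have "S #> [l] \<subseteq> carrier F" using Cons.prems by (intro coset_subset) auto
  then have "parity_along X f (S #> [l]) (foldr push u v) = parity_along X f (S #> [l]) (u @ v)"
    using Cons by auto
  then show ?case using Cons.prems parity_push[OF f, of S l "foldr push u v"] by (simp add: F_eq[symmetric])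
qed simp

end

locale covered_subgroup = free_group_on +
  fixes L :: "'a word set" and ts :: "'a word list"
  assumes L: "subgroup L F"
    and ts: "set ts \<subseteq> L"
    and gen: "\<And>u. u \<in> L \<Longrightarrow> \<exists>vs. set vs \<subseteq> set ts \<union> (\<lambda>t. inv t) ` set ts \<and> u = list_prod F vs"
begin

text \<open>Since each generator leads from the coset \<open>L\<close> back to it, this single word
  traces all their loops. The graph is thus the support of one walk, and its connectedness follows
  from \<open>conn_walk\<close>.\<close>

abbreviation U :: "'a word" where "U \<equiv> concat ts"
abbreviation D :: "('a word set, 'a) dart set" where "D \<equiv> coset_graph X L U"

lemma L_sub: "L \<subseteq> carrier F" by (rule subgroup.subset[OF L])

lemma ts_words: "t \<in> set ts \<Longrightarrow> t \<in> words"
  using ts L_sub by (auto simp: carrier_eq)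

lemma U_words: "U \<in> words"
  using ts_words by auto

lemma coset_L: "u \<in> L \<Longrightarrow> L #> u = L"
  using coset_join2[OF _ L] L_sub by blast

lemma coset_one: "L #> \<one> = L"
  using coset_mult_one[OF L_sub] .

lemma dart_graph_D: "dart_graph D"
  unfolding coset_graph_def by (rule dart_graph_sym_closure) simp

lemma D_dart:
  assumes "d \<in> D"
  shows "tgt d = fst d #> [lab d] \<and> lab d \<in> X \<times> UNIV \<and> (\<exists>u\<in>words. fst d = L #> val u)"
proof -
  obtain e where e: "e \<in> set (coset_path X L U)" "d = e \<or> d = rev_dart e"
    using assms unfolding coset_graph_def sym_closure_def by blast
  note E = coset_path_dart[OF L_sub U_words e(1)]
  then obtain u where u: "u \<in> words" "fst e = L #> val u" by blast
  show ?thesis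
  proof (cases "d = e")
    case False
    then have d: "d = rev_dart e" using e(2) by blast
    have sub: "fst e \<subseteq> carrier F" unfolding u(2) using L_sub val_closed[OF u(1)] by (rule r_coset_subset_G)
    have w: "u @ [lab e] \<in> words" using u(1) E by simp
    have "tgt e = L #> val (u @ [lab e])"
      using E coset_append[OF L_sub u(1), of "[lab e]"] u(2) by simp
    moreover have "fst e = tgt e #> [inv_letter (lab e)]"
      using coset_letter_inv[OF sub, of "lab e"] E by simp
    moreover have "inv_letter (lab e) \<in> X \<times> UNIV" using E by (cases "lab e") auto
    ultimately show ?thesis using w unfolding d rev_dart_simps by blast
  qed (use E in simp)
qed

lemma D_verts: "v \<in> verts D \<Longrightarrow> \<exists>u\<in>words. v = L #> val u"
  using D_dart unfolding verts_def by blast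

lemma deterministic_D: "deterministic D"
  unfolding deterministic_def using D_dart by metis

lemma walk_U: "walk D L (coset_path X L U) (L #> val U)"
  by (intro walk_coset_path L_sub U_words) (simp add: coset_graph_def subset_sym_closure)

lemma conn_D: "conn D"
  using conn_walk[OF walk_U] unfolding coset_graph_def .

lemma coset_path_concat:
  assumes "set ts' \<subseteq> set ts" "t \<in> set ts'"
  shows "set (coset_path X L t) \<subseteq> set (coset_path X L (concat ts'))"
  using assms
proof (induction ts')
  case (Cons a ts')
  have w: "a \<in> words" "concat ts' \<in> words" using Cons.prems(1) ts_words by auto
  have "val a = a" using ts Cons.prems(1) L_sub val_id by (metis list.set_intros(1) subsetD)
  then have "L #> val a = L" using coset_L ts Cons.prems(1) by auto
  then have "coset_path X L (concat (a # ts')) = coset_path X L a @ coset_path X L (concat ts')"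
    using coset_path_append[OF w(2) L_sub w(1)] by simp
  then show ?case using Cons by auto
qed simp

lemma reads_ts: "t \<in> set ts \<Longrightarrow> reads D L t L"
proof -
  assume t: "t \<in> set ts"
  have "set (coset_path X L t) \<subseteq> D"
    using coset_path_concat[OF order_refl t] unfolding coset_graph_def sym_closure_def by blast
  then have "walk D L (coset_path X L t) (L #> val t)"
    by (intro walk_coset_path L_sub ts_words t)
  moreover have "val t = t" using t ts L_sub val_id by blast
  moreover have "L #> t = L" using t ts coset_L by blast
  ultimately show "reads D L t L" using walk_reads map_lab_coset_path by metis
qed

text \<open>A product of generators and inverses is first read as an unreduced concatenation;
  determinism of the coset graph allows it to be reduced.\<close>

lemma reads_L:
  assumes "u \<in> L"
  shows "reads D L u L"
proof -
  have *: "\<exists>w. reads D L w L \<and> w \<in> words \<and> val w = list_prod F vs"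
    if "set vs \<subseteq> set ts \<union> (\<lambda>t. inv t) ` set ts" for vs
    using that
  proof (induction vs)
    case Nil
    then show ?case by (intro exI[of _ "[]"]) (simp add: list_prod_def one_eq)
  next
    case (Cons a vs)
    then obtain w where w: "reads D L w L" "w \<in> words" "val w = list_prod F vs" by auto
    have a: "reads D L a L \<and> a \<in> carrier F"
    proof (cases "a \<in> set ts")
      case True
      then show ?thesis using reads_ts ts L_sub by blast
    next
      case False
      then obtain t where t: "t \<in> set ts" "a = inv t" using Cons.prems by auto
      then have c: "t \<in> carrier F" using ts L_sub by blast
      have "reads D L (rev (map inv_letter t)) L"
        using reads_inv[OF dart_graph_D reads_ts[OF t(1)]] .
      then show ?thesis using inv_eq[OF c] t(2) inv_closed[OF c] by simp
    qed
    then have aw: "a \<in> words" by (simp add: carrier_eq)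
    have "val (a @ w) = a \<otimes> list_prod F vs"
      using val_append[OF aw w(2)] w(3) val_id a by simp
    then show ?case using a aw w
      by (intro exI[of _ "a @ w"]) (auto simp: reads_append list_prod_Cons)
  qed
  obtain w where w: "reads D L w L" "val w = u"
    using gen[OF assms] * by metis
  show ?thesis using reads_reduce[OF dart_graph_D deterministic_D w(1)] w(2) by simp
qed

lemma L_in_verts: "L \<noteq> {\<one>} \<Longrightarrow> L \<in> verts D"
proof -
  assume "L \<noteq> {\<one>}"
  then obtain u where u: "u \<in> L" "u \<noteq> []" using subgroup.one_closed[OF L] one_eq by auto
  then obtain l w where "u = l # w" by (cases u) auto
  then obtain b where "(L, l, b) \<in> D" using reads_L[OF u(1)] by auto
  then show "L \<in> verts D" using fst_in_verts by (metis fst_conv)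
qed

lemma parity_hom:
  assumes f: "rev_dart ` f \<subseteq> f" and uv: "u \<in> L" "v \<in> L"
  shows "parity_along X f L (u \<otimes> v) = (parity_along X f L u \<noteq> parity_along X f L v)"
proof -
  have w: "u \<in> words" "v \<in> words" using uv L_sub by (auto simp: carrier_eq)
  have "val u = u" using uv L_sub val_id by blast
  then show ?thesis
    using parity_foldr_push[OF f L_sub w(1), of v] parity_append[OF w(2) L_sub w(1), of f]
      coset_L[OF uv(1)] by (simp add: mult_eq)
qed

text \<open>For a dart \<open>d\<close>, the representative of its source, its label and the inverse
  representative of its target form a closed path at \<open>L\<close>, hence an element of
  \<open>L\<close>. Its parity tells whether \<open>d\<close> is marked once the parities of the two
  representatives are known.\<close>

lemma parity_determines:
  assumes rep: "\<And>v. v \<in> verts D \<Longrightarrow> r v \<in> words \<and> L #> val (r v) = v"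
    and ff: "f \<subseteq> D" "f' \<subseteq> D" and pos: "\<And>d. d \<in> f \<union> f' \<Longrightarrow> snd (lab d)"
    and eqL: "\<And>u. u \<in> L \<Longrightarrow>
      parity_along X (sym_closure f) L u = parity_along X (sym_closure f') L u"
    and eqr: "\<And>v. v \<in> verts D \<Longrightarrow>
      parity_along X (sym_closure f) L (r v) = parity_along X (sym_closure f') L (r v)"
  shows "f = f'"
proof -
  have sym: "rev_dart ` sym_closure g \<subseteq> sym_closure g" for g :: "('a word set, 'a) dart set"
    by (auto simp: sym_closure_def image_image)
  have mem: "d \<in> g \<longleftrightarrow> d \<in> sym_closure g"
    if pg: "\<And>d. d \<in> g \<Longrightarrow> snd (lab d)" and pd: "snd (lab d)" for d g
  proof -
    have "d \<notin> rev_dart ` g"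
    proof
      assume "d \<in> rev_dart ` g"
      then obtain e where "e \<in> g" "d = rev_dart e" by blast
      then show False using pg[of e] pd by simp
    qed
    then show ?thesis by (simp add: sym_closure_def)
  qed
  have main: "d \<in> sym_closure f \<longleftrightarrow> d \<in> sym_closure f'" if d: "d \<in> D" for d
  proof -
    let ?u = "r (fst d)" and ?v = "r (tgt d)"
    let ?i = "rev (map inv_letter ?v)"
    have u: "?u \<in> words" "L #> val ?u = fst d" using rep fst_in_verts[OF d] by blast+
    have v: "?v \<in> words" "L #> val ?v = tgt d" using rep tgt_in_verts[OF dart_graph_D d] by blast+
    have i: "?i \<in> words" by (rule inv_words[OF v(1)])
    have dd: "tgt d = fst d #> [lab d]" "lab d \<in> X \<times> UNIV" using D_dart[OF d] by blast+
    have l: "[lab d] \<in> words" using dd(2) by simp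
    have ul: "?u @ [lab d] \<in> words" using u(1) l by simp
    have w: "(?u @ [lab d]) @ ?i \<in> words" using ul i by simp
    have tv: "L #> val (?u @ [lab d]) = tgt d"
      using coset_append[OF L_sub u(1) l] u(2) dd(1) by simp
    have ret: "tgt d #> val ?i = L"
      using coset_append[OF L_sub v(1) i] v(2) val_inv[OF v(1)] coset_one by simp
    have "L #> val ((?u @ [lab d]) @ ?i) = L"
      using coset_append[OF L_sub ul i] tv ret by simp
    then have inL: "val ((?u @ [lab d]) @ ?i) \<in> L"
      using coset_join1[OF _ val_closed[OF w] L] by blast
    have par: "parity_along X (sym_closure g) L (val ((?u @ [lab d]) @ ?i)) =
        (parity_along X (sym_closure g) L ?u \<noteq> ((d \<in> sym_closure g) \<noteq> parity_along X (sym_closure g) L ?v))"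
      for g :: "('a word set, 'a) dart set"
    proof -
      \<comment> \<open>This word has value 1, so its parity vanishes; hence the way back along
        \<open>?i\<close> has the same parity as \<open>?v\<close>.\<close>
      have "parity_along X (sym_closure g) L (?v @ ?i) = False"
        using parity_foldr_push[OF sym[of g] L_sub, of "?v @ ?i" "[]"] v(1) i val_inv[OF v(1)]
        by (simp add: one_eq)
      then have pi: "parity_along X (sym_closure g) (tgt d) ?i = parity_along X (sym_closure g) L ?v"
        using parity_append[OF i L_sub v(1), of "sym_closure g"] v(2) by simp
      have "parity_along X (sym_closure g) L (val ((?u @ [lab d]) @ ?i)) =
          parity_along X (sym_closure g) L ((?u @ [lab d]) @ ?i)"
        using parity_foldr_push[OF sym[of g] L_sub w, of "[]"] by simp
      also have "\<dots> = (parity_along X (sym_closure g) L (?u @ [lab d]) \<noteq>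
          parity_along X (sym_closure g) (tgt d) ?i)"
        using parity_append[OF i L_sub ul, of "sym_closure g"] tv by simp
      also have "parity_along X (sym_closure g) L (?u @ [lab d]) =
          (parity_along X (sym_closure g) L ?u \<noteq> ((fst d, lab d, tgt d) \<in> sym_closure g))"
        using parity_append[OF l L_sub u(1), of "sym_closure g"] u(2) dd(1) by (simp add: F_eq[symmetric])
      finally show ?thesis unfolding pi prod.collapse by argo
    qed
    show ?thesis
      using par[of f] par[of f'] eqL[OF inL] eqr[OF fst_in_verts[OF d]]
        eqr[OF tgt_in_verts[OF dart_graph_D d]] by argo
  qed
  have "g \<subseteq> g'"
    if "g \<subseteq> D" "\<And>d. d \<in> g \<union> g' \<Longrightarrow> snd (lab d)"
      "\<And>d. d \<in> D \<Longrightarrow> d \<in> sym_closure g \<Longrightarrow> d \<in> sym_closure g'" for g g'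
  proof
    fix d assume d: "d \<in> g"
    then have "d \<in> sym_closure g'"
      using that(3)[of d] that(1) subset_sym_closure by blast
    then show "d \<in> g'" using mem[of g' d] that(2) d by blast
  qed
  then show ?thesis using main ff pos by (intro equalityI) blast+
qed

end

section \<open>The rank of a free factor\<close>

lemma not_reduced_cons_inv: "\<not> reduced [l, inv_letter l]"
  by (simp add: reduced_def)

lemma cyclic_reduction:
  "reduced w \<Longrightarrow> w \<noteq> [] \<Longrightarrow>
    \<exists>u v. w = u @ v @ rev (map inv_letter u) \<and> v \<noteq> [] \<and> reduced (v @ v)"
proof (induction "length w" arbitrary: w rule: less_induct)
  case less
  show ?case
  proof (cases "reduced (w @ w)")
    case True
    then show ?thesis using less.prems by (intro exI[of _ "[]"] exI[of _ w]) simp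
  next
    case False
    then have h: "hd w = inv_letter (last w)"
      using less.prems by (auto simp: reduced_def successively_append_iff)
    obtain l v' where w1: "w = l # v'" using less.prems(2) by (cases w) auto
    have "v' \<noteq> []" using h w1 by auto
    then obtain v x where v': "v' = v @ [x]" by (meson rev_exhaust)
    have x: "x = inv_letter l" using h w1 v' by simp
    have wv: "w = [l] @ v @ [inv_letter l]" using w1 v' x by simp
    have "v \<noteq> []" using less.prems(1) wv not_reduced_cons_inv[of l] by auto
    moreover have "reduced v"
      using less.prems(1) reduced_append1[OF reduced_append2, of "[l]" v "[inv_letter l]"]
      unfolding wv by blast
    moreover have "length v < length w" using wv by simp
    ultimately obtain u y where y: "v = u @ y @ rev (map inv_letter u)" "y \<noteq> []" "reduced (y @ y)"
      using less.hyps[of v] by blast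
    have "w = (l # u) @ y @ rev (map inv_letter (l # u))" unfolding wv y(1) by simp
    then show ?thesis using y(2,3) by blast
  qed
qed

lemma reads_deterministic:
  assumes "deterministic D"
  shows "reads D a w b \<Longrightarrow> reads D a w c \<Longrightarrow> b = c"
proof (induction w arbitrary: a)
  case (Cons l w)
  then obtain x y where x: "(a, l, x) \<in> D" "reads D x w b" and y: "(a, l, y) \<in> D" "reads D y w c"
    by auto
  have "x = y" using assms x(1) y(1) unfolding deterministic_def by fastforce
  then show ?case using Cons.IH x y by blast
qed simp

lemma card_verts_closed_walk:
  assumes "walk D a p a" "reduced (map lab p @ map lab p)"
  shows "2 * card (verts (sym_closure (set p))) \<le> card (sym_closure (set p))"
proof -
  have "(\<Sum>v\<in>verts (sym_closure (set p)). 2)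
      \<le> (\<Sum>v\<in>verts (sym_closure (set p)). card (out_darts (sym_closure (set p)) v))"
    by (intro sum_mono deg_closed_walk[OF assms])
  then show ?thesis using sum_deg[OF dart_graph_sym_closure[OF finite_set[of p]]] by simp
qed

lemma conn_Un:
  assumes g: "dart_graph A" "dart_graph B" and c: "conn A" "conn B"
    and b: "b \<in> verts A" "b \<in> verts B"
  shows "conn (A \<union> B)"
  unfolding conn_def verts_Un
proof (intro allI impI)
  fix S assume S: "S \<noteq> {}" "S \<subseteq> verts A \<union> verts B"
    and cl: "\<forall>d\<in>A \<union> B. fst d \<in> S \<longrightarrow> tgt d \<in> S"
  have A: "verts A \<subseteq> S" if "S \<inter> verts A \<noteq> {}"
  proof -
    have "\<forall>d\<in>A. fst d \<in> S \<inter> verts A \<longrightarrow> tgt d \<in> S \<inter> verts A"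
      using cl tgt_in_verts[OF g(1)] by blast
    then have "S \<inter> verts A = verts A"
      using c(1)[unfolded conn_def, rule_format, of "S \<inter> verts A"] that by blast
    then show ?thesis by blast
  qed
  have B: "verts B \<subseteq> S" if "S \<inter> verts B \<noteq> {}"
  proof -
    have "\<forall>d\<in>B. fst d \<in> S \<inter> verts B \<longrightarrow> tgt d \<in> S \<inter> verts B"
      using cl tgt_in_verts[OF g(2)] by blast
    then have "S \<inter> verts B = verts B"
      using c(2)[unfolded conn_def, rule_format, of "S \<inter> verts B"] that by blast
    then show ?thesis by blast
  qed
  have "verts A \<subseteq> S \<and> verts B \<subseteq> S"
  proof (cases "S \<inter> verts A = {}")
    case True
    then have "verts B \<subseteq> S" using S B by blast
    then show ?thesis using True b by blast
  next
    case False
    then have "verts A \<subseteq> S" by (rule A)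
    then show ?thesis using b B by blast
  qed
  then show "S = verts A \<union> verts B" using S(2) by blast
qed

context covered_subgroup
begin

text \<open>The final part, read backwards from \<open>L\<close>, is \<open>u\<close> again. By
  determinism it ends where the initial \<open>u\<close> does, so \<open>v\<close> is read along a
  closed walk.\<close>

lemma reads_cyclic_part:
  assumes "u @ v @ rev (map inv_letter u) \<in> L"
  shows "\<exists>a. reads D a v a"
proof -
  obtain a b where ab: "reads D L u a" "reads D a v b" "reads D b (rev (map inv_letter u)) L"
    using reads_L[OF assms] by (auto simp: reads_append)
  have "reads D L (rev (map inv_letter (rev (map inv_letter u)))) b"
    by (rule reads_inv[OF dart_graph_D ab(3)])
  then have "reads D L u b" by (simp add: rev_map o_def)
  then have "a = b" using reads_deterministic[OF deterministic_D] ab(1) by blast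
  then show ?thesis using ab(2) by blast
qed

text \<open>A nontrivial element has a nonempty cyclically reduced part. Its closed walk covers a
  leafless subgraph, which has rank at least one, and so has the larger connected graph.\<close>

lemma card_verts_D:
  assumes "L \<noteq> {\<one>}"
  shows "2 * card (verts D) \<le> card D"
proof -
  obtain w where w: "w \<in> L" "w \<noteq> []" using assms subgroup.one_closed[OF L] one_eq by auto
  then have "reduced w" using L_sub by (auto simp: carrier_eq)
  then obtain u v where v: "w = u @ v @ rev (map inv_letter u)" "v \<noteq> []" "reduced (v @ v)"
    using cyclic_reduction w(2) by blast
  obtain a where r: "reads D a v a" using reads_cyclic_part[of u v] w(1) unfolding v(1) by blast
  obtain p where p: "walk D a p a" "map lab p = v" by (rule reads_walkE[OF r])
  have red: "reduced (map lab p @ map lab p)" using p(2) v(3) by simp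
  have "set p \<noteq> {}" using p(2) v(2) by auto
  then have "sym_closure (set p) \<noteq> {}" unfolding sym_closure_def by blast
  moreover have "sym_closure (set p) \<subseteq> D"
    by (rule sym_closure_subset[OF dart_graph_D walk_set[OF p(1)]])
  moreover have "dart_graph (sym_closure (set p))" by (simp add: dart_graph_sym_closure)
  ultimately have "card (sym_closure (set p)) + 2 * card (verts D) \<le>
      card D + 2 * card (verts (sym_closure (set p)))"
    by (intro euler_char_subgraph[OF dart_graph_D conn_D]) auto
  then show ?thesis using card_verts_closed_walk[OF p(1) red] by linarith
qed

text \<open>The base vertex gets the empty word, whose parity is always 0. It thus contributes no
  information, which saves one bit per graph in the rank count.\<close>

definition rep :: "'a word set \<Rightarrow> 'a word" where
  "rep v = (if v = L then [] else SOME u. u \<in> words \<and> v = L #> val u)"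

lemma rep: "v \<in> verts D \<Longrightarrow> rep v \<in> words \<and> L #> val (rep v) = v"
proof (cases "v = L")
  case True
  then show ?thesis using coset_one one_eq by (simp add: rep_def)
next
  case False
  assume "v \<in> verts D"
  then have "\<exists>u. u \<in> words \<and> v = L #> val u" using D_verts by blast
  then have "rep v \<in> words \<and> v = L #> val (rep v)"
    using someI_ex[of "\<lambda>u. u \<in> words \<and> v = L #> val u"] False unfolding rep_def by presburger
  then show ?thesis by simp
qed

lemma rep_L: "rep L = []"
  by (simp add: rep_def)

end

context free_group_on
begin

lemma words_induct_hom:
  assumes M: "group M" and h: "\<phi> \<in> hom F M" "\<psi> \<in> hom F M"
    and eq: "\<And>x. x \<in> X \<Longrightarrow> \<phi> [(x, True)] = \<psi> [(x, True)]"
  shows "u \<in> carrier F \<Longrightarrow> \<phi> u = \<psi> u"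
proof -
  interpret M: group M by fact
  interpret \<phi>: group_hom F M \<phi> using h(1) by unfold_locales
  interpret \<psi>: group_hom F M \<psi> using h(2) by unfold_locales
  have l: "\<phi> [l] = \<psi> [l]" if lX: "l \<in> X \<times> UNIV" for l
  proof (cases "snd l")
    case True
    then show ?thesis using lX eq by (cases l) auto
  next
    case False
    then obtain x where x: "l = (x, False)" "x \<in> X" using lX by (cases l) auto
    have c: "[(x, True)] \<in> carrier F" using x(2) by (simp add: carrier_eq)
    have "inv [(x, True)] = [l]" using inv_eq[OF c] x(1) by simp
    then show ?thesis using \<phi>.hom_inv[OF c] \<psi>.hom_inv[OF c] eq[OF x(2)] by simp
  qed
  have *: "\<phi> (val w) = \<psi> (val w)" if "w \<in> words" for w
    using that
  proof (induction w)
    case Nil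
    then show ?case using \<phi>.hom_one \<psi>.hom_one by (simp add: one_eq)
  next
    case (Cons a w)
    then have "[a] \<in> carrier F" "val w \<in> carrier F" by (auto intro: letter_closed val_closed)
    then show ?case
      unfolding val_Cons using Cons l[of a] by simp
  qed
  assume "u \<in> carrier F"
  then show ?thesis using *[of u] val_id by (simp add: carrier_eq)
qed

text \<open>The images of the free generators under the retraction onto \<open>H\<close> generate
  \<open>H\<close>.\<close>

lemma free_factor_covered:
  assumes fin: "finite X" and fp: "internal_free_product F H K"
  shows "\<exists>ts. covered_subgroup X F H ts"
proof -
  have H: "subgroup H F" using fp by (simp add: internal_free_product_def)
  have gH: "group (F\<lparr>carrier := H\<rparr>)" by (rule subgroup_imp_group[OF H])
  obtain \<rho> where \<rho>: "\<rho> \<in> hom F (F\<lparr>carrier := H\<rparr>)" "\<forall>x\<in>H. \<rho> x = x"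
    using free_product_retraction[OF group_axioms fp] by blast
  have \<rho>H: "\<rho> u \<in> H" if "u \<in> carrier F" for u
    using that \<rho>(1) by (auto simp: hom_def)
  have \<rho>_mult: "\<rho> (u \<otimes> v) = \<rho> u \<otimes> \<rho> v" if "u \<in> carrier F" "v \<in> carrier F" for u v
    using that \<rho>(1) by (auto simp: hom_def)
  have \<rho>1: "\<rho> \<one> = \<one>" using \<rho>(2) subgroup.one_closed[OF H] by blast
  obtain xs where xs: "set xs = X" using finite_list[OF fin] by blast
  define ts where "ts = map (\<lambda>x. \<rho> [(x, True)]) xs"
  have let_in: "\<rho> [l] \<in> set ts \<union> (\<lambda>t. inv t) ` set ts" if lX: "l \<in> X \<times> UNIV" for l
  proof (cases "snd l")
    case True
    then show ?thesis using lX xs by (cases l) (auto simp: ts_def)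
  next
    case False
    then obtain x where x: "l = (x, False)" "x \<in> X" using lX by (cases l) auto
    have c: "[(x, True)] \<in> carrier F" "[l] \<in> carrier F" using x by (auto simp: carrier_eq)
    have "[l] \<otimes> [(x, True)] = \<one>" using x(1) by (simp add: mult_eq one_eq)
    then have "\<rho> [l] \<otimes> \<rho> [(x, True)] = \<one>" using \<rho>_mult[OF c(2,1)] \<rho>1 by simp
    then have "inv \<rho> [(x, True)] = \<rho> [l]"
      using \<rho>H[OF c(1)] \<rho>H[OF c(2)] subgroup.subset[OF H] by (intro inv_equality) auto
    moreover have "\<rho> [(x, True)] \<in> set ts" using x(2) xs by (simp add: ts_def)
    ultimately show ?thesis by (metis UnI2 imageI)
  qed
  have gen: "\<exists>vs. set vs \<subseteq> set ts \<union> (\<lambda>t. inv t) ` set ts \<and> \<rho> (val w) = list_prod F vs"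
    if "w \<in> words" for w
    using that
  proof (induction w)
    case Nil
    then show ?case using \<rho>1 by (intro exI[of _ "[]"]) (simp add: list_prod_def one_eq)
  next
    case (Cons l w)
    then obtain vs where vs: "set vs \<subseteq> set ts \<union> (\<lambda>t. inv t) ` set ts" "\<rho> (val w) = list_prod F vs"
      by auto
    have c: "[l] \<in> carrier F" "val w \<in> carrier F"
      using Cons.prems by (auto intro: letter_closed val_closed)
    have "\<rho> (val (l # w)) = list_prod F (\<rho> [l] # vs)"
      unfolding val_Cons list_prod_Cons using \<rho>_mult[OF c] vs(2) by simp
    moreover have "set (\<rho> [l] # vs) \<subseteq> set ts \<union> (\<lambda>t. inv t) ` set ts"
      using let_in[of l] Cons.prems vs(1) by auto
    ultimately show ?case by blast
  qed
  have "covered_subgroup X F H ts"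
  proof (intro covered_subgroup.intro covered_subgroup_axioms.intro free_group_on_axioms)
    show "subgroup H F" by (rule H)
    show "set ts \<subseteq> H" using xs \<rho>H by (auto simp: ts_def carrier_eq)
    fix u assume u: "u \<in> H"
    then have c: "u \<in> carrier F" using subgroup.subset[OF H] by blast
    then have "u \<in> words" by (simp add: carrier_eq)
    then show "\<exists>vs. set vs \<subseteq> set ts \<union> (\<lambda>t. inv t) ` set ts \<and> u = list_prod F vs"
      using gen[of u] \<rho>(2) u val_id[OF c] by metis
  qed
  then show ?thesis by blast
qed

text \<open>A choice of a set of edges in each of the two coset graphs defines a homomorphism from \<open>F\<close>
  to the group of order two, and there are only \<open>2 ^ card X\<close> such homomorphisms.\<close>

lemma free_product_rank:
  assumes fin: "finite X" and fp: "internal_free_product F H K"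
    and H: "covered_subgroup X F H ts" "H \<noteq> {\<one>}" and K: "covered_subgroup X F K us" "K \<noteq> {\<one>}"
  shows "card (coset_graph X H (concat ts)) + card (coset_graph X K (concat us)) + 4 \<le>
    2 * card X + 2 * card (verts (coset_graph X H (concat ts))) +
    2 * card (verts (coset_graph X K (concat us)))"
proof -
  interpret H: covered_subgroup X F H ts by (rule H)
  interpret K: covered_subgroup X F K us by (rule K)
  let ?M = "\<lparr>carrier = UNIV :: bool set, monoid.mult = (\<noteq>), one = False\<rparr>"
  have M: "group ?M" by (rule groupI) auto
  define PH where "PH = {d \<in> H.D. snd (lab d)}"
  define PK where "PK = {d \<in> K.D. snd (lab d)}"
  have sym: "rev_dart ` sym_closure g \<subseteq> sym_closure g" for g :: "('a word set, 'a) dart set"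
    by (auto simp: sym_closure_def image_image)
  have "\<exists>\<phi>\<in>hom F ?M. (\<forall>x\<in>H. \<phi> x = parity_along X (sym_closure f) H x) \<and>
      (\<forall>x\<in>K. \<phi> x = parity_along X (sym_closure g) K x)" for f g
    using H.parity_hom[OF sym[of f]] K.parity_hom[OF sym[of g]]
    by (intro free_product_hom[OF group_axioms M fp]) auto
  then have "\<forall>p. \<exists>\<phi>. \<phi> \<in> hom F ?M \<and> (\<forall>x\<in>H. \<phi> x = parity_along X (sym_closure (fst p)) H x) \<and>
      (\<forall>x\<in>K. \<phi> x = parity_along X (sym_closure (snd p)) K x)" by blast
  then obtain \<phi> where \<phi>: "\<And>p. \<phi> p \<in> hom F ?M"
    "\<And>p x. x \<in> H \<Longrightarrow> \<phi> p x = parity_along X (sym_closure (fst p)) H x"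
    "\<And>p x. x \<in> K \<Longrightarrow> \<phi> p x = parity_along X (sym_closure (snd p)) K x"
    unfolding choice_iff by blast
  \<comment> \<open>The data that recover the marked edges: the homomorphism, given by its values on
    \<open>X\<close>, and one bit for each vertex other than the base points.\<close>
  define \<Psi> where "\<Psi> p = ({x \<in> X. \<phi> p [(x, True)]},
    {v \<in> verts H.D - {H}. parity_along X (sym_closure (fst p)) H (H.rep v)},
    {v \<in> verts K.D - {K}. parity_along X (sym_closure (snd p)) K (K.rep v)})" for p
  have "inj_on \<Psi> (Pow PH \<times> Pow PK)"
  proof (rule inj_onI)
    fix p q assume p: "p \<in> Pow PH \<times> Pow PK" and q: "q \<in> Pow PH \<times> Pow PK" and eq: "\<Psi> p = \<Psi> q"
    note e = eq[unfolded \<Psi>_def prod.inject]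
    note eqs = conjunct1[OF e] conjunct1[OF conjunct2[OF e]] conjunct2[OF conjunct2[OF e]]
    have sub: "fst p \<subseteq> PH" "fst q \<subseteq> PH" "snd p \<subseteq> PK" "snd q \<subseteq> PK"
      using p q by (simp_all add: mem_Times_iff)
    have "\<phi> p [(x, True)] = \<phi> q [(x, True)]" if "x \<in> X" for x
      using eqs(1) that by blast
    then have hom_eq: "\<phi> p u = \<phi> q u" if "u \<in> carrier F" for u
      using words_induct_hom[OF M \<phi>(1) \<phi>(1)] that by blast
    have "fst p = fst q"
    proof (rule H.parity_determines[OF H.rep])
      show "fst p \<subseteq> H.D" "fst q \<subseteq> H.D" using sub(1,2) unfolding PH_def by blast+
      show "snd (lab d)" if "d \<in> fst p \<union> fst q" for d
        using that sub(1,2) unfolding PH_def by blast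
      show "parity_along X (sym_closure (fst p)) H u = parity_along X (sym_closure (fst q)) H u"
        if "u \<in> H" for u
        using hom_eq[of u] that H.L_sub \<phi>(2) by auto
      show "parity_along X (sym_closure (fst p)) H (H.rep v) =
          parity_along X (sym_closure (fst q)) H (H.rep v)" if "v \<in> verts H.D" for v
      proof (cases "v = H")
        case True
        then show ?thesis by (simp add: H.rep_L)
      next
        case False
        then show ?thesis using eqs(2) that by blast
      qed
    qed
    moreover have "snd p = snd q"
    proof (rule K.parity_determines[OF K.rep])
      show "snd p \<subseteq> K.D" "snd q \<subseteq> K.D" using sub(3,4) unfolding PK_def by blast+
      show "snd (lab d)" if "d \<in> snd p \<union> snd q" for d
        using that sub(3,4) unfolding PK_def by blast
      show "parity_along X (sym_closure (snd p)) K u = parity_along X (sym_closure (snd q)) K u"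
        if "u \<in> K" for u
        using hom_eq[of u] that K.L_sub \<phi>(3) by auto
      show "parity_along X (sym_closure (snd p)) K (K.rep v) =
          parity_along X (sym_closure (snd q)) K (K.rep v)" if "v \<in> verts K.D" for v
      proof (cases "v = K")
        case True
        then show ?thesis by (simp add: K.rep_L)
      next
        case False
        then show ?thesis using eqs(3) that by blast
      qed
    qed
    ultimately show "p = q" by (simp add: prod_eq_iff)
  qed
  moreover have "\<Psi> ` (Pow PH \<times> Pow PK) \<subseteq> Pow X \<times> Pow (verts H.D - {H}) \<times> Pow (verts K.D - {K})"
    unfolding \<Psi>_def by blast
  moreover have finV: "finite (verts H.D)" "finite (verts K.D)"
    by (intro finite_verts H.dart_graph_D K.dart_graph_D)+
  ultimately have "card (Pow PH \<times> Pow PK) \<le>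
      card (Pow X \<times> Pow (verts H.D - {H}) \<times> Pow (verts K.D - {K}))"
    using fin by (intro card_inj_on_le[of \<Psi>]) auto
  moreover have "finite PH" "finite PK"
    using dart_graphD(1)[OF H.dart_graph_D] dart_graphD(1)[OF K.dart_graph_D]
    by (simp_all add: PH_def PK_def)
  \<comment> \<open>Comparing exponents, the edges of both graphs number at most
    \<open>card X\<close> plus all vertices other than the base points. So the two ranks add up to
    at most \<open>card X\<close>.\<close>
  ultimately have "(2::nat) ^ (card PH + card PK) \<le>
      2 ^ (card X + (card (verts H.D) - 1) + (card (verts K.D) - 1))"
    using fin finV H.L_in_verts[OF H(2)] K.L_in_verts[OF K(2)]
    by (simp add: card_cartesian_product card_Pow power_add ac_simps)
  then have "card PH + card PK \<le> card X + (card (verts H.D) - 1) + (card (verts K.D) - 1)"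
    by (rule power_le_imp_le_exp[rotated]) simp
  moreover have "card (verts H.D) > 0" "card (verts K.D) > 0"
    using finV H.L_in_verts[OF H(2)] K.L_in_verts[OF K(2)] by (auto simp: card_gt_0_iff)
  moreover have "card H.D = 2 * card PH" "card K.D = 2 * card PK"
    unfolding PH_def PK_def
    by (intro card_positive_darts H.dart_graph_D K.dart_graph_D)+
  ultimately show ?thesis by linarith
qed

end

section \<open>The upper bound\<close>

context free_group_on
begin

text \<open>The coset graphs of the two factors are joined at their base points. The walk of an element of
  \<open>H\<close> does not enter the part that belongs to \<open>K\<close>.\<close>

lemma factor_covers_small_graph:
  assumes fin: "finite X" and fp: "internal_free_product F H K" and ne: "H \<noteq> carrier F"
    and w: "w \<in> H" "w \<noteq> []" and m: "card X < m"
  shows "\<exists>u v. w = u @ v @ rev (map inv_letter u) \<and> v \<noteq> [] \<and> reduced (v @ v) \<and>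
    covers_small_graph TYPE(bool \<times> 'a word set) (card X) m v"
proof -
  have K1: "K \<noteq> {\<one>}" using internal_free_product_trivial[OF group_axioms] fp ne by blast
  have H1: "H \<noteq> {\<one>}" using w one_eq by auto
  obtain ts where ts: "covered_subgroup X F H ts" using free_factor_covered[OF fin fp] by blast
  obtain us where us: "covered_subgroup X F K us"
    using free_factor_covered[OF fin internal_free_product_sym[OF fp]] by blast
  interpret H: covered_subgroup X F H ts by (rule ts)
  interpret K: covered_subgroup X F K us by (rule us)
  have rank: "card H.D + card K.D + 4 \<le> 2 * card X + 2 * card (verts H.D) + 2 * card (verts K.D)"
    by (rule free_product_rank[OF fin fp ts H1 us K1])
  have rankK: "2 * card (verts K.D) \<le> card K.D" by (rule K.card_verts_D[OF K1])
  \<comment> \<open>The tags keep the vertices of the two graphs apart, except that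
    \<open>f2\<close> moves the base point \<open>K\<close> onto the base point \<open>H\<close> of
    the first graph.\<close>
  define f1 :: "'a word set \<Rightarrow> bool \<times> 'a word set" where "f1 S = (True, S)" for S
  define f2 :: "'a word set \<Rightarrow> bool \<times> 'a word set"
    where "f2 S = (if S = K then (True, H) else (False, S))" for S
  let ?b = "(True, H)"
  let ?A = "map_dart f1 ` H.D" and ?B = "map_dart f2 ` K.D"
  have b1: "f1 H = ?b" and b2: "f2 K = ?b" by (simp_all add: f1_def f2_def)
  have i1: "inj_on f1 V" for V by (simp add: f1_def inj_on_def)
  have i2: "inj_on f2 V" for V by (auto simp: f2_def inj_on_def split: if_splits)
  have gA: "dart_graph ?A" "conn ?A" and gB: "dart_graph ?B" "conn ?B"
    using H.dart_graph_D K.dart_graph_D H.conn_D K.conn_D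
    by (simp_all add: dart_graph_map conn_map)
  have bA: "?b \<in> verts ?A" and bB: "?b \<in> verts ?B"
    unfolding verts_map using H.L_in_verts[OF H1] K.L_in_verts[OF K1] b1 b2 by (metis imageI)+
  have cA: "card ?A = card H.D" by (rule card_image[OF inj_on_map_dart[OF H.dart_graph_D i1]])
  have cB: "card ?B = card K.D" by (rule card_image[OF inj_on_map_dart[OF K.dart_graph_D i2]])
  have vA: "card (verts ?A) = card (verts H.D)" unfolding verts_map by (rule card_image[OF i1])
  have vB: "card (verts ?B) = card (verts K.D)" unfolding verts_map by (rule card_image[OF i2])
  have "verts ?A \<inter> verts ?B \<subseteq> {?b}"
    unfolding verts_map f1_def f2_def by auto
  then have "verts ?A \<inter> verts ?B = {?b}" using bA bB by blast
  then have vD: "card (verts (?A \<union> ?B)) + 1 = card (verts H.D) + card (verts K.D)"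
    using card_Un_Int[OF finite_verts[OF gA(1)] finite_verts[OF gB(1)]] vA vB
    unfolding verts_Un by simp
  have D: "dart_graph (?A \<union> ?B)" "conn (?A \<union> ?B)" "?b \<in> verts (?A \<union> ?B)"
    using dart_graph_Un[OF gA(1) gB(1)] conn_Un[OF gA(1) gB(1) gA(2) gB(2) bA bB] bA
    by (simp_all add: verts_Un)
  have rankD: "card (?A \<union> ?B) + 2 \<le> 2 * card (verts (?A \<union> ?B)) + 2 * card X"
    using card_Un_le[of ?A ?B] cA cB vD rank by linarith
  have lab: "\<forall>d\<in>?A \<union> ?B. lab d \<in> X \<times> UNIV"
  proof
    fix d assume "d \<in> ?A \<union> ?B"
    then obtain e where "(e \<in> H.D \<and> d = map_dart f1 e) \<or> (e \<in> K.D \<and> d = map_dart f2 e)" by blast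
    then show "lab d \<in> X \<times> UNIV"
      using H.D_dart[of e] K.D_dart[of e] by (elim disjE conjE) simp_all
  qed
  have readsHK: "reads (?A \<union> ?B) ?b g ?b" if gHK: "g \<in> H \<union> K" for g
  proof -
    consider "g \<in> H" | "g \<in> K" using gHK by blast
    then show ?thesis
    proof cases
      case 1
      then have "reads ?A (f1 H) g (f1 H)" by (intro reads_map H.reads_L)
      then show ?thesis unfolding b1 by (rule reads_mono) simp
    next
      case 2
      then have "reads ?B (f2 K) g (f2 K)" by (intro reads_map K.reads_L)
      then show ?thesis unfolding b2 by (rule reads_mono) simp
    qed
  qed
  have HKF: "H \<union> K \<subseteq> carrier F" using H.L_sub K.L_sub by blast
  have reads_list: "\<exists>u. reads (?A \<union> ?B) ?b u ?b \<and> u \<in> words \<and> val u = list_prod F gs"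
    if "set gs \<subseteq> H \<union> K" for gs
    using that
  proof (induction gs)
    case Nil
    then show ?case by (intro exI[of _ "[]"]) (simp add: list_prod_def one_eq)
  next
    case (Cons g gs)
    then obtain u where u: "reads (?A \<union> ?B) ?b u ?b" "u \<in> words" "val u = list_prod F gs" by auto
    have g: "g \<in> H \<union> K" "g \<in> carrier F" using Cons.prems HKF by auto
    then have gw: "g \<in> words" by (simp add: carrier_eq)
    have "reads (?A \<union> ?B) ?b (g @ u) ?b"
      using readsHK[OF g(1)] u(1) unfolding reads_append by blast
    moreover have "val (g @ u) = list_prod F (g # gs)"
      using val_append[OF gw u(2)] val_id[OF g(2)] u(3) by (simp add: list_prod_Cons)
    moreover have "g @ u \<in> words" using gw u(2) by simp
    ultimately show ?case by blast
  qed
  have gen: "\<forall>x\<in>X. \<exists>u. reads (?A \<union> ?B) ?b u ?b \<and> foldr push u [] = [(x, True)]"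
  proof
    fix x assume "x \<in> X"
    then have "[(x, True)] \<in> carrier F" by (simp add: carrier_eq)
    then have "[(x, True)] \<in> list_prod F ` alternating_lists F H K"
      using fp unfolding internal_free_product_def bij_betw_def by blast
    then obtain gs where gs: "gs \<in> alternating_lists F H K" "[(x, True)] = list_prod F gs" by blast
    then have "set gs \<subseteq> H \<union> K" by (auto simp: alternating_lists_def)
    then show "\<exists>u. reads (?A \<union> ?B) ?b u ?b \<and> foldr push u [] = [(x, True)]"
      using reads_list gs(2) by metis
  qed
  have "reduced w" using w(1) H.L_sub by (auto simp: carrier_eq)
  then obtain u v where v: "w = u @ v @ rev (map inv_letter u)" "v \<noteq> []" "reduced (v @ v)"
    using cyclic_reduction w(2) by blast
  obtain a where "reads H.D a v a" using H.reads_cyclic_part[of u v] w(1) unfolding v(1) by blast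
  then have rA: "reads ?A (f1 a) v (f1 a)" by (rule reads_map)
  obtain p where p: "walk ?A (f1 a) p (f1 a)" "map lab p = v" by (rule reads_walkE[OF rA])
  let ?W = "sym_closure (set p)"
  have WA: "?W \<subseteq> ?A" by (rule sym_closure_subset[OF gA(1) walk_set[OF p(1)]])
  have "covers_small_graph TYPE(bool \<times> 'a word set) (card X) m v"
  proof (cases "2 * m \<le> card ?W")
    case True
    obtain q :: "(bool \<times> 'a word set, 'a) dart list" and c where q: "walk (sym_closure (set q)) c q c" "map lab q = v"
      "2 * m \<le> card (sym_closure (set q))" "card (sym_closure (set q)) \<le> 2 * m + 2 * card X + 2"
      "card (sym_closure (set q)) + 2 \<le> 2 * card (verts (sym_closure (set q))) + 2 * card X"
      using fold_interpolation[OF D rankD lab gen walk_mono[OF p(1) Un_upper1] p(2) True fin order_refl m]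
      by blast
    then show ?thesis unfolding covers_small_graph_def Let_def by blast
  next
    case False
    have "set p \<noteq> {}" using p(2) v(2) by auto
    then have "?W \<noteq> {}" unfolding sym_closure_def by blast
    then have "card ?W + 2 * card (verts ?A) \<le> card ?A + 2 * card (verts ?W)"
      by (intro euler_char_subgraph[OF gA _ WA]) (simp_all add: dart_graph_sym_closure)
    \<comment> \<open>The graph of \<open>K\<close> has rank at least one and the ranks add up to at
      most \<open>card X\<close>, so that of \<open>H\<close>, and any nonempty subgraph with it,
      has rank at most \<open>card X - 1\<close>.\<close>
    then have "card ?W + 2 \<le> 2 * card (verts ?W) + 2 * (card X - 1)"
      using rank rankK unfolding cA vA by linarith
    moreover have "walk ?W (f1 a) p (f1 a)" by (rule walk_restrict[OF p(1) subset_sym_closure])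
    ultimately show ?thesis using False p(2) unfolding covers_small_graph_def Let_def not_le by blast
  qed
  then show ?thesis using v by blast
qed

end

text \<open>A word is split into a conjugator of length \<open>j\<close> and a cyclically reduced
  part. There are at most \<open>(2 * k) ^ j\<close> conjugators, while the other part is shorter by
  \<open>2 * j\<close>, which saves \<open>(\<mu> ^ 2) ^ j\<close>. Each of the at most
  \<open>n + 1\<close> values of \<open>j\<close> thus contributes at most
  \<open>C * \<mu> ^ n\<close>.\<close>

lemma factor_upper_bound:
  fixes \<mu> :: real and k :: nat
  assumes k: "k \<ge> 3" and \<mu>: "2 * real k - 3 < \<mu>"
  shows "\<exists>C\<ge>0. \<forall>n. real (card (factor_elements_of_length k (Suc n))) \<le> C * (real n + 1) * \<mu> ^ n"
proof -
  let ?X = "{1..k} :: nat set"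
  have cX: "card ?X = k" by simp
  interpret free_group_on ?X "free_group_rank k" by unfold_locales (simp add: free_group_rank_def)
  obtain m C where m: "m > k" and C: "C \<ge> 0"
    and bound: "\<And>n. real (card {w. set w \<subseteq> ?X \<times> UNIV \<and> length w = Suc n \<and>
      reduced (w @ w) \<and> covers_small_graph TYPE(bool \<times> nat word set) k m w}) \<le> C * \<mu> ^ n"
    using card_covers_small_graph[of ?X k \<mu>, where 'v = "bool \<times> nat word set"] k \<mu> by blast
  define Cyc where "Cyc n = {w. set w \<subseteq> ?X \<times> UNIV \<and> length w = Suc n \<and>
      reduced (w @ w) \<and> covers_small_graph TYPE(bool \<times> nat word set) k m w}" for n
  define Wd where "Wd j = {u :: nat word. set u \<subseteq> ?X \<times> UNIV \<and> length u = j}" for j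
  have finWd: "finite (Wd j)" for j
    unfolding Wd_def by (intro finite_lists_length_eq) simp
  have cardWd: "card (Wd j) = (2 * k) ^ j" for j
    unfolding Wd_def by (subst card_lists_length_eq) (simp_all add: card_cartesian_product)
  have finCyc: "finite (Cyc n)" for n
    unfolding Cyc_def by (rule finite_subset[OF _ finWd[of "Suc n"]]) (auto simp: Wd_def)
  have \<mu>1: "\<mu> \<ge> 1" using k \<mu> by simp
  have sq: "2 * real k \<le> \<mu> ^ 2"
  proof -
    have "2 * real k \<le> (2 * real k - 3) * (2 * real k - 3)"
    proof -
      \<comment> \<open>The difference \<open>(2 * k - 3) ^ 2 - 2 * k\<close> equals this product
        plus 3.\<close>
      have "0 \<le> (real k - 3) * (4 * real k - 2)" using k by simp
      then show ?thesis by (simp add: algebra_simps)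
    qed
    also have "\<dots> \<le> \<mu> * \<mu>" using k \<mu> by (intro mult_mono) auto
    finally show ?thesis by (simp add: power2_eq_square)
  qed
  have "real (card (factor_elements_of_length k (Suc n))) \<le> C * (real n + 1) * \<mu> ^ n" for n
  proof -
    let ?conj = "\<lambda>(u, v). u @ v @ rev (map inv_letter u)"
    let ?J = "{j. 2 * j \<le> n}"
    have fJ: "finite ?J" by (rule finite_subset[of _ "{..n}"]) auto
    have "factor_elements_of_length k (Suc n) \<subseteq> (\<Union>j\<in>?J. ?conj ` (Wd j \<times> Cyc (n - 2 * j)))"
    proof
      fix w assume "w \<in> factor_elements_of_length k (Suc n)"
      then obtain H K where w: "w \<in> carrier (free_group_rank k)" "length w = Suc n" "w \<in> H"
        and fp: "internal_free_product (free_group_rank k) H K" "H \<noteq> carrier (free_group_rank k)"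
        unfolding factor_elements_of_length_def proper_free_factor_def free_factor_def by blast
      have "w \<noteq> []" using w(2) by auto
      then obtain u v where v: "w = u @ v @ rev (map inv_letter u)" "v \<noteq> []" "reduced (v @ v)"
        "covers_small_graph TYPE(bool \<times> nat word set) (card ?X) m v"
        using factor_covers_small_graph[of H K w m] fp w m by auto
      have l: "length w = 2 * length u + length v" unfolding v(1) by simp
      have lv: "length v > 0" using v(2) by simp
      have j: "2 * length u \<le> n" using l lv w(2) by linarith
      have s: "set u \<subseteq> ?X \<times> UNIV" "set v \<subseteq> ?X \<times> UNIV"
        using w(1) unfolding carrier_eq v(1) by auto
      have "length v = Suc (n - 2 * length u)" using l w(2) j by linarith
      then have "v \<in> Cyc (n - 2 * length u)" unfolding Cyc_def using s v by simp
      moreover have "u \<in> Wd (length u)" unfolding Wd_def using s by simp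
      ultimately have "w \<in> ?conj ` (Wd (length u) \<times> Cyc (n - 2 * length u))"
        unfolding v(1) by (intro image_eqI[of _ _ "(u, v)"]) auto
      then show "w \<in> (\<Union>j\<in>?J. ?conj ` (Wd j \<times> Cyc (n - 2 * j)))" using j by blast
    qed
    then have "card (factor_elements_of_length k (Suc n)) \<le>
        card (\<Union>j\<in>?J. ?conj ` (Wd j \<times> Cyc (n - 2 * j)))"
      using fJ finWd finCyc by (intro card_mono) auto
    also have "\<dots> \<le> (\<Sum>j\<in>?J. card (?conj ` (Wd j \<times> Cyc (n - 2 * j))))"
      by (rule card_UN_le[OF fJ])
    also have "\<dots> \<le> (\<Sum>j\<in>?J. card (Wd j \<times> Cyc (n - 2 * j)))"
      by (intro sum_mono card_image_le finite_cartesian_product finWd finCyc)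
    finally have "real (card (factor_elements_of_length k (Suc n))) \<le>
        real (\<Sum>j\<in>?J. card (Wd j \<times> Cyc (n - 2 * j)))"
      by (rule of_nat_mono)
    also have "\<dots> = (\<Sum>j\<in>?J. (2 * real k) ^ j * real (card (Cyc (n - 2 * j))))"
      by (simp add: card_cartesian_product cardWd)
    also have "\<dots> \<le> (\<Sum>j\<in>?J. C * \<mu> ^ n)"
    proof (rule sum_mono)
      fix j assume j: "j \<in> ?J"
      have "(2 * real k) ^ j * real (card (Cyc (n - 2 * j))) \<le> (\<mu> ^ 2) ^ j * (C * \<mu> ^ (n - 2 * j))"
        using sq bound[of "n - 2 * j"] C \<mu>1 unfolding Cyc_def
        by (intro mult_mono power_mono) auto
      also have "\<dots> = C * (\<mu> ^ (2 * j) * \<mu> ^ (n - 2 * j))" by (simp add: power_mult)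
      also have "\<dots> = C * \<mu> ^ n" using j by (simp flip: power_add)
      finally show "(2 * real k) ^ j * real (card (Cyc (n - 2 * j))) \<le> C * \<mu> ^ n" .
    qed
    also have "\<dots> = real (card ?J) * (C * \<mu> ^ n)" by simp
    also have "\<dots> \<le> (real n + 1) * (C * \<mu> ^ n)"
    proof (rule mult_right_mono)
      have "card ?J \<le> card {..n}" by (rule card_mono) auto
      then show "real (card ?J) \<le> real n + 1" by simp
    qed (use C \<mu>1 in simp)
    finally show ?thesis by (simp add: mult_ac)
  qed
  then show ?thesis using C by blast
qed

section \<open>The lower bound\<close>

lemma reduced_append_iff:
  "reduced (u @ v) \<longleftrightarrow> reduced u \<and> reduced v \<and> (u \<noteq> [] \<longrightarrow> v \<noteq> [] \<longrightarrow> hd v \<noteq> inv_letter (last u))"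
  by (auto simp: reduced_def successively_append_iff)

lemma foldr_push_reduced: "reduced (u @ v) \<Longrightarrow> foldr push u v = u @ v"
proof (induction u)
  case (Cons a u)
  then have "foldr push u v = u @ v" using reduced_tl[of a "u @ v"] by simp
  then show ?case using Cons.prems by (cases "u @ v") (auto simp: reduced_Cons_Cons)
qed simp

lemma reduced_words_mono: "A \<subseteq> B \<Longrightarrow> reduced_words A \<subseteq> reduced_words B"
  unfolding reduced_words_def by blast

lemma subgroup_reduced_words:
  assumes "A \<subseteq> X" shows "subgroup (reduced_words A) (free_group X)"
proof -
  interpret free_group_on X "free_group X" by unfold_locales simp
  interpret A: free_group_on A "free_group A" by unfold_locales simp
  have cA: "reduced_words A = carrier (free_group A)" by (simp add: free_group_def)
  have sub: "reduced_words A \<subseteq> carrier (free_group X)"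
    using assms by (auto simp: carrier_eq reduced_words_def)
  show ?thesis
  proof
    show "reduced_words A \<subseteq> carrier (free_group X)" by (rule sub)
    show "x \<otimes>\<^bsub>free_group X\<^esub> y \<in> reduced_words A" if "x \<in> reduced_words A" "y \<in> reduced_words A" for x y
      using A.m_closed[of x y] that unfolding cA mult_eq A.mult_eq .
    show "\<one>\<^bsub>free_group X\<^esub> \<in> reduced_words A"
      using A.one_closed unfolding cA one_eq A.one_eq .
    show "inv\<^bsub>free_group X\<^esub> x \<in> reduced_words A" if "x \<in> reduced_words A" for x
      using A.inv_closed[of x] inv_eq[of x] A.inv_eq[of x] that sub unfolding cA by auto
  qed
qed

section \<open>Splitting the generators splits the free group\<close>

context
  fixes A B :: "'a set"
  assumes disj: "A \<inter> B = {}"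
begin

abbreviation "alt_words \<equiv> alternating_lists (free_group (A \<union> B)) (reduced_words A) (reduced_words B)"

lemma alt_words_Cons:
  "g # gs \<in> alt_words \<longleftrightarrow> g \<in> reduced_words A \<union> reduced_words B \<and> g \<noteq> [] \<and> gs \<in> alt_words \<and>
     (gs \<noteq> [] \<longrightarrow> (g \<in> reduced_words A \<and> hd gs \<in> reduced_words B) \<or>
       (g \<in> reduced_words B \<and> hd gs \<in> reduced_words A))"
  unfolding alternating_lists_Cons by (auto simp: free_group_def)

lemma hd_in_reduced_words: "g \<in> reduced_words C \<Longrightarrow> g \<noteq> [] \<Longrightarrow> fst (hd g) \<in> C"
  by (cases g) (auto simp: reduced_words_def)

lemma last_in_reduced_words: "g \<in> reduced_words C \<Longrightarrow> g \<noteq> [] \<Longrightarrow> fst (last g) \<in> C"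
proof -
  assume "g \<in> reduced_words C" "g \<noteq> []"
  then have "last g \<in> C \<times> UNIV" using last_in_set[of g] unfolding reduced_words_def by blast
  then show ?thesis by (simp add: mem_Times_iff)
qed

lemma hd_concat_alt:
  assumes "g # h # t \<in> alt_words"
  shows "h \<noteq> []" "hd (concat (h # t)) = hd h" "concat (h # t) \<noteq> []"
  using assms by (auto simp: alt_words_Cons)

text \<open>The first entry is the longest prefix over its own alphabet, so it can be recovered from
  the concatenated word. This gives uniqueness of the normal form.\<close>

lemma takeWhile_alt:
  assumes gs: "g # gs \<in> alt_words" and g: "g \<in> reduced_words C" and C: "C = A \<or> C = B"
  shows "takeWhile (\<lambda>l. fst l \<in> C) (concat (g # gs)) = g"
proof -
  have "takeWhile (\<lambda>l. fst l \<in> C) (concat gs) = []"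
  proof (cases gs)
    case (Cons h t)
    have h: "hd (concat gs) = hd h" "concat gs \<noteq> []" "h \<noteq> []"
      using hd_concat_alt[of g h t] gs Cons by auto
    have "g \<noteq> []" "(g \<in> reduced_words A \<and> h \<in> reduced_words B) \<or> (g \<in> reduced_words B \<and> h \<in> reduced_words A)"
      using gs Cons by (auto simp: alt_words_Cons)
    then have "fst (hd h) \<notin> C"
      using hd_in_reduced_words[OF _ h(3)] hd_in_reduced_words[OF g] hd_in_reduced_words[of g] disj C
      by blast
    then show ?thesis using h by (cases "concat gs") auto
  qed simp
  then show ?thesis using g by (subst concat.simps, subst takeWhile_append2) (auto simp: reduced_words_def)
qed

text \<open>Neighbouring entries use disjoint sets of generators, so nothing cancels between
  them.\<close>

lemma concat_alt: "gs \<in> alt_words \<Longrightarrow> reduced (concat gs) \<and> list_prod (free_group (A \<union> B)) gs = concat gs"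
proof (induction gs)
  case Nil
  then show ?case by (simp add: list_prod_def free_group_def)
next
  case (Cons g gs)
  then have IH: "reduced (concat gs)" "list_prod (free_group (A \<union> B)) gs = concat gs"
    by (auto simp: alt_words_Cons)
  have "g \<in> reduced_words A \<union> reduced_words B" and g1: "g \<noteq> []"
    using Cons.prems by (auto simp: alt_words_Cons)
  then have g: "g \<noteq> []" "reduced g" by (auto simp: reduced_words_def)
  have "hd (concat gs) \<noteq> inv_letter (last g)" if "concat gs \<noteq> []"
  proof (cases gs)
    case (Cons h t)
    have h: "hd (concat gs) = hd h" "h \<noteq> []"
      using hd_concat_alt[of g h t] Cons.prems Cons by auto
    have "(g \<in> reduced_words A \<and> h \<in> reduced_words B) \<or> (g \<in> reduced_words B \<and> h \<in> reduced_words A)"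
      using Cons.prems Cons by (auto simp: alt_words_Cons)
    then have "fst (hd h) \<noteq> fst (last g)"
      using hd_in_reduced_words[of h A] hd_in_reduced_words[of h B] last_in_reduced_words[of g A]
        last_in_reduced_words[of g B] h(2) g(1) disj by (metis disjoint_iff)
    then show ?thesis unfolding h(1) by (metis fst_inv_letter)
  qed (use that in simp)
  then have "reduced (g @ concat gs)" using g IH(1) by (simp add: reduced_append_iff)
  then show ?case using IH(2) foldr_push_reduced by (simp add: list_prod_Cons free_group_def)
qed

lemma concat_alt_inj: "gs \<in> alt_words \<Longrightarrow> gs' \<in> alt_words \<Longrightarrow> concat gs = concat gs' \<Longrightarrow> gs = gs'"
proof (induction gs arbitrary: gs')
  case Nil
  then show ?case by (cases gs') (auto simp: alt_words_Cons)
next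
  case (Cons g t)
  have g: "g \<noteq> []" "g \<in> reduced_words A \<union> reduced_words B" using Cons.prems by (auto simp: alt_words_Cons)
  then obtain g' t' where gs': "gs' = g' # t'" using Cons.prems(3) by (cases gs') auto
  have g': "g' \<noteq> []" "g' \<in> reduced_words A \<union> reduced_words B"
    using Cons.prems(2) gs' by (auto simp: alt_words_Cons)
  have "hd g = hd (concat (g # t))" "hd g' = hd (concat gs')" using g g' gs' by auto
  then have hd: "hd g = hd g'" using Cons.prems(3) by simp
  obtain C where C: "C = A \<or> C = B" "g \<in> reduced_words C" using g(2) by blast
  have "g' \<in> reduced_words C"
    using C g'(2) hd hd_in_reduced_words[OF C(2) g(1)] hd_in_reduced_words[OF _ g'(1)] disj by auto
  then have "g = g'"
    using takeWhile_alt[OF Cons.prems(1) C(2,1)] takeWhile_alt[of g' t' C] Cons.prems(2,3) C(1) gs'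
    by simp
  moreover have "t = t'"
    using Cons gs' \<open>g = g'\<close> by (auto simp: alt_words_Cons)
  ultimately show ?case using gs' by simp
qed

lemma concat_alt_surj:
  "reduced w \<Longrightarrow> set w \<subseteq> (A \<union> B) \<times> UNIV \<Longrightarrow> \<exists>gs\<in>alt_words. concat gs = w"
proof (induction w)
  case Nil
  then show ?case by (intro bexI[of _ "[]"]) (auto simp: alternating_lists_def)
next
  case (Cons l w)
  then obtain gs where gs: "gs \<in> alt_words" "concat gs = w"
    using reduced_tl[OF Cons.prems(1)] by auto
  have l: "[l] \<in> reduced_words A \<union> reduced_words B"
    using Cons.prems(2) by (cases l) (auto simp: reduced_words_def)
  show ?case
  proof (cases gs)
    case Nil
    then show ?thesis using l gs by (intro bexI[of _ "[[l]]"]) (auto simp: alt_words_Cons)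
  next
    case gs': (Cons h t)
    have h: "h \<noteq> []" "t \<in> alt_words" using gs gs' by (auto simp: alt_words_Cons)
    have "reduced ((l # h) @ concat t)" using Cons.prems(1) gs gs' by simp
    then have lh: "reduced (l # h)" by (rule reduced_append1)
    show ?thesis
    proof (cases "\<exists>C. (C = A \<or> C = B) \<and> [l] \<in> reduced_words C \<and> h \<in> reduced_words C")
      case True
      then obtain C where C: "C = A \<or> C = B" "[l] \<in> reduced_words C" "h \<in> reduced_words C" by blast
      then have lhC: "l # h \<in> reduced_words C" using lh by (auto simp: reduced_words_def)
      have "(l # h) # t \<in> alt_words"
      proof (cases t)
        case Nil
        then show ?thesis using lhC C(1) h(2) by (auto simp: alt_words_Cons)
      next
        case (Cons h' t')
        have h': "h' \<noteq> []" "(h \<in> reduced_words A \<and> h' \<in> reduced_words B) \<or> (h \<in> reduced_words B \<and> h' \<in> reduced_words A)"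
          using gs gs' Cons by (auto simp: alt_words_Cons)
        \<comment> \<open>A nonempty word lies over only one of the alphabets. So \<open>h'\<close>
          lies over the other one and may still follow \<open>l # h\<close>.\<close>
        have "\<not> (h \<in> reduced_words A \<and> h \<in> reduced_words B)"
          using hd_in_reduced_words[OF _ h(1)] disj by blast
        then show ?thesis using lhC C h' h(2) Cons by (auto simp: alt_words_Cons)
      qed
      then show ?thesis using gs gs' by (intro bexI[of _ "(l # h) # t"]) auto
    next
      case False
      have "h \<in> reduced_words A \<union> reduced_words B" using gs gs' by (auto simp: alt_words_Cons)
      then have "[l] # gs \<in> alt_words" using False l gs gs' by (auto simp: alt_words_Cons)
      then show ?thesis using gs by (intro bexI[of _ "[l] # gs"]) auto
    qed
  qed
qed

lemma internal_free_product_reduced_words: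
  "internal_free_product (free_group (A \<union> B)) (reduced_words A) (reduced_words B)"
  unfolding internal_free_product_def
proof (intro conjI subgroup_reduced_words)
  have "w = []" if "w \<in> reduced_words A" "w \<in> reduced_words B" for w
    using hd_in_reduced_words[OF that(1)] hd_in_reduced_words[OF that(2)] disj by blast
  then show "reduced_words A \<inter> reduced_words B = {\<one>\<^bsub>free_group (A \<union> B)\<^esub>}"
    by (auto simp: free_group_def reduced_words_def)
  show "bij_betw (list_prod (free_group (A \<union> B))) alt_words (carrier (free_group (A \<union> B)))"
  proof (rule bij_betwI')
    fix gs gs' assume "gs \<in> alt_words" "gs' \<in> alt_words"
    then show "list_prod (free_group (A \<union> B)) gs = list_prod (free_group (A \<union> B)) gs' \<longleftrightarrow> gs = gs'"
      using concat_alt concat_alt_inj by metis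
  next
    fix gs assume gs: "gs \<in> alt_words"
    then have "set (concat gs) \<subseteq> (A \<union> B) \<times> UNIV"
      by (fastforce simp: alternating_lists_def reduced_words_def)
    then show "list_prod (free_group (A \<union> B)) gs \<in> carrier (free_group (A \<union> B))"
      using concat_alt[OF gs] by (simp add: free_group_def reduced_words_def)
  next
    fix w assume "w \<in> carrier (free_group (A \<union> B))"
    then show "\<exists>gs\<in>alt_words. w = list_prod (free_group (A \<union> B)) gs"
      using concat_alt_surj[of w] concat_alt by (fastforce simp: free_group_def reduced_words_def)
  qed
qed auto

end

section \<open>Exponent sums and primitive elements\<close>

definition exponent_sum :: "'a \<Rightarrow> 'a word \<Rightarrow> int" where
  "exponent_sum x w = (\<Sum>l\<leftarrow>w. if fst l = x then (if snd l then 1 else -1) else 0)"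

lemma exponent_sum_simps [simp]:
  "exponent_sum x [] = 0"
  "exponent_sum x (l # w) = (if fst l = x then (if snd l then 1 else -1) else 0) + exponent_sum x w"
  "exponent_sum x (u @ v) = exponent_sum x u + exponent_sum x v"
  by (simp_all add: exponent_sum_def)

lemma exponent_sum_push: "exponent_sum x (push l w) = exponent_sum x (l # w)"
  by (cases w) auto

lemma exponent_sum_foldr_push: "exponent_sum x (foldr push u w) = exponent_sum x (u @ w)"
  by (induction u) (auto simp: exponent_sum_push)

lemma word_value_Cons:
  "word_value G (l # w) = (if snd l then fst l else inv\<^bsub>G\<^esub> (fst l)) \<otimes>\<^bsub>G\<^esub> word_value G w"
  by (simp add: word_value_def list_prod_def split_beta)

context group
begin

lemma word_value_closed: "fst ` set w \<subseteq> carrier G \<Longrightarrow> word_value G w \<in> carrier G"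
  by (induction w) (auto simp: word_value_Cons, auto simp: word_value_def list_prod_def)

lemma word_value_push:
  assumes "fst l \<in> carrier G" "fst ` set w \<subseteq> carrier G"
  shows "word_value G (push l w) = word_value G (l # w)"
proof (cases w)
  case (Cons l' w')
  have c: "word_value G w' \<in> carrier G" using assms Cons by (intro word_value_closed) auto
  show ?thesis
  proof (cases "l' = inv_letter l")
    case True
    then show ?thesis using Cons assms(1) c by (auto simp: word_value_Cons m_assoc[symmetric])
  qed (use Cons in simp)
qed simp

lemma word_value_foldr_push:
  assumes "fst ` set v \<subseteq> carrier G"
  shows "fst ` set u \<subseteq> carrier G \<Longrightarrow>
    word_value G (foldr push u v) = word_value G u \<otimes> word_value G v"
proof (induction u)
  case Nil
  then show ?case using word_value_closed[OF assms] by (simp add: word_value_def list_prod_def)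
next
  case (Cons l u)
  have "fst ` set (foldr push u v) \<subseteq> carrier G"
    using set_foldr_push[of u v] Cons.prems assms by force
  then have "word_value G (foldr push (l # u) v) = word_value G (l # foldr push u v)"
    using word_value_push[of l "foldr push u v"] Cons.prems by simp
  also have "\<dots> = word_value G (l # u) \<otimes> word_value G v"
    using Cons word_value_closed[OF assms] word_value_closed[of u]
    by (auto simp: word_value_Cons m_assoc)
  finally show ?case .
qed

text \<open>The homomorphism counts the occurrences of \<open>b\<close>, with sign, in the word over
  the basis; it sends \<open>b\<close> to 1 and the rest of the basis to 0.\<close>

lemma primitive_hom:
  assumes "primitive_element G b"
  shows "\<exists>\<phi> :: 'a \<Rightarrow> int. \<phi> b = 1 \<and> (\<forall>g\<in>carrier G. \<forall>h\<in>carrier G. \<phi> (g \<otimes> h) = \<phi> g + \<phi> h)"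
proof -
  obtain B where B: "B \<subseteq> carrier G" "bij_betw (word_value G) (reduced_words B) (carrier G)" "b \<in> B"
    using assms by (auto simp: primitive_element_def free_basis_def)
  define iv where "iv = inv_into (reduced_words B) (word_value G)"
  have iv: "iv g \<in> reduced_words B" "word_value G (iv g) = g" if "g \<in> carrier G" for g
    using that B(2) unfolding iv_def bij_betw_def by (metis inv_into_into, metis f_inv_into_f)
  have iv_eq: "iv (word_value G u) = u" if "u \<in> reduced_words B" for u
    using that B(2) unfolding iv_def bij_betw_def by (metis inv_into_f_f)
  have sub: "fst ` set u \<subseteq> carrier G" if "u \<in> reduced_words B" for u
    using that B(1) by (auto simp: reduced_words_def)
  have "exponent_sum b (iv (g \<otimes> h)) = exponent_sum b (iv g) + exponent_sum b (iv h)"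
    if g: "g \<in> carrier G" and h: "h \<in> carrier G" for g h
  proof -
    have r: "foldr push (iv g) (iv h) \<in> reduced_words B"
      using iv(1)[OF g] iv(1)[OF h] set_foldr_push[of "iv g" "iv h"]
      by (auto simp: reduced_words_def reduced_foldr_push)
    have "g \<otimes> h = word_value G (foldr push (iv g) (iv h))"
      using word_value_foldr_push[OF sub[OF iv(1)[OF h]] sub[OF iv(1)[OF g]]] iv(2) g h by simp
    then have "iv (g \<otimes> h) = foldr push (iv g) (iv h)" using iv_eq[OF r] by simp
    then show ?thesis by (simp add: exponent_sum_foldr_push)
  qed
  moreover have "exponent_sum b (iv b) = 1"
  proof -
    have "[(b, True)] \<in> reduced_words B" using B(3) by (simp add: reduced_words_def)
    moreover have "word_value G [(b, True)] = b"
      using B by (auto simp: word_value_def list_prod_def)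
    ultimately have "iv b = [(b, True)]" using iv_eq by metis
    then show ?thesis by simp
  qed
  ultimately show ?thesis by (intro exI[of _ "\<lambda>g. exponent_sum b (iv g)"]) simp
qed

end

text \<open>Every homomorphism to the integers is an integer combination of the exponent sums over
  \<open>X\<close>, so it cannot take the value 1 on \<open>w\<close>.\<close>

lemma not_primitive_if_exponent_sums_dvd:
  assumes fin: "finite X" and w: "w \<in> carrier (free_group X)"
    and dvd: "\<And>x. x \<in> X \<Longrightarrow> 3 dvd exponent_sum x w"
  shows "\<not> primitive_element (free_group X) w"
proof
  assume "primitive_element (free_group X) w"
  interpret free_group_on X "free_group X" by unfold_locales simp
  obtain \<phi> :: "'a word \<Rightarrow> int" where \<phi>: "\<phi> w = 1"
    "\<And>g h. g \<in> carrier (free_group X) \<Longrightarrow> h \<in> carrier (free_group X) \<Longrightarrow>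
      \<phi> (g \<otimes>\<^bsub>free_group X\<^esub> h) = \<phi> g + \<phi> h"
    using primitive_hom[OF \<open>primitive_element (free_group X) w\<close>] by blast
  have \<phi>1: "\<phi> [] = 0" using \<phi>(2)[OF one_closed one_closed] by (simp add: one_eq mult_eq)
  have l: "\<phi> [l] = (\<Sum>x\<in>X. exponent_sum x [l] * \<phi> [(x, True)])" if lX: "l \<in> X \<times> UNIV" for l
  proof -
    obtain y e where l: "l = (y, e)" "y \<in> X" using lX by (cases l) auto
    have c: "[(y, True)] \<in> carrier (free_group X)" "[(y, False)] \<in> carrier (free_group X)"
      using l(2) by (auto simp: carrier_eq)
    have "\<phi> [(y, False)] = - \<phi> [(y, True)]"
      using \<phi>(2)[OF c(2,1)] \<phi>1 by (simp add: mult_eq)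
    then have "\<phi> [l] = (if e then 1 else -1) * \<phi> [(y, True)]" using l(1) by auto
    also have "\<dots> = (\<Sum>x\<in>X. if x = y then (if e then 1 else -1) * \<phi> [(y, True)] else 0)"
      using fin l(2) by (simp add: sum.delta')
    also have "\<dots> = (\<Sum>x\<in>X. exponent_sum x [l] * \<phi> [(x, True)])"
      using l(1) by (intro sum.cong) auto
    finally show ?thesis .
  qed
  have *: "\<phi> (val v) = (\<Sum>x\<in>X. exponent_sum x v * \<phi> [(x, True)])" if "v \<in> words" for v
    using that
  proof (induction v)
    case (Cons a v)
    have c: "[a] \<in> carrier (free_group X)" "val v \<in> carrier (free_group X)"
      using Cons.prems by (auto intro: letter_closed val_closed)
    have "\<phi> (val (a # v)) = \<phi> [a] + \<phi> (val v)" unfolding val_Cons by (rule \<phi>(2)[OF c])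
    also have "\<dots> = (\<Sum>x\<in>X. exponent_sum x [a] * \<phi> [(x, True)]) + (\<Sum>x\<in>X. exponent_sum x v * \<phi> [(x, True)])"
      using Cons l[of a] by simp
    finally show ?case by (simp add: sum.distrib[symmetric] distrib_right)
  qed (simp add: \<phi>1)
  have "1 = (\<Sum>x\<in>X. exponent_sum x w * \<phi> [(x, True)])"
    using *[of w] w val_id[OF w] \<phi>(1) by (simp add: carrier_eq)
  moreover have "3 dvd (\<Sum>x\<in>X. exponent_sum x w * \<phi> [(x, True)])"
    using dvd by (intro dvd_sum) auto
  ultimately have "(3::int) dvd 1" by simp
  then show False by simp
qed

text \<open>The suffix has the same length for every residue, so that extended words of equal length
  stay of equal length. It changes the exponent sum of \<open>x\<close> only.\<close>

lemma extend_exponent_sum: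
  assumes u: "u \<in> reduced_words Y" and x: "x \<in> Y" and y: "y \<in> Y" "y \<noteq> x"
  shows "\<exists>b. length b = 4 \<and> u @ b \<in> reduced_words Y \<and> 3 dvd exponent_sum x (u @ b) \<and>
    (\<forall>z. z \<noteq> x \<longrightarrow> exponent_sum z (u @ b) = exponent_sum z u)"
proof -
  \<comment> \<open>At most one sign of \<open>y\<close> cancels with the last letter of
    \<open>u\<close>.\<close>
  obtain s where s: "u \<noteq> [] \<longrightarrow> (y, s) \<noteq> inv_letter (last u)"
    by (metis (full_types) prod.inject)
  define r where "r = exponent_sum x u mod 3"
  have r: "r = 0 \<or> r = 1 \<or> r = 2" unfolding r_def by presburger
  \<comment> \<open>The suffix adds 0, 2 or -2 to the exponent sum of \<open>x\<close>, according to
    the residue, while the two letters \<open>y\<close> cancel in the sum. For residue 0 it is a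
    commutator, which also has length 4.\<close>
  define b where "b = (if r = 0 then [(y, s), (x, True), (y, \<not> s), (x, False)]
    else if r = 1 then [(y, s), (x, True), (x, True), (y, \<not> s)]
    else [(y, s), (x, False), (x, False), (y, \<not> s)])"
  have "reduced b" "set b \<subseteq> Y \<times> UNIV" "hd b = (y, s)"
    using x y by (auto simp: b_def reduced_def)
  then have "u @ b \<in> reduced_words Y"
    using u s by (auto simp: reduced_words_def reduced_append_iff)
  moreover have "3 dvd exponent_sum x (u @ b)"
    using r y(2) unfolding b_def r_def by (elim disjE) (auto, presburger+)
  moreover have "exponent_sum z (u @ b) = exponent_sum z u" if "z \<noteq> x" for z
    using that unfolding b_def by auto
  moreover have "length b = 4" by (simp add: b_def)
  ultimately show ?thesis by blast
qed

lemma extend_exponent_sums: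
  assumes u: "u \<in> reduced_words Y" and y: "\<And>x. x \<in> Y \<Longrightarrow> \<exists>y\<in>Y. y \<noteq> x"
  shows "set xs \<subseteq> Y \<Longrightarrow> \<exists>b. length b = 4 * length xs \<and> u @ b \<in> reduced_words Y \<and>
    (\<forall>x\<in>set xs. 3 dvd exponent_sum x (u @ b))"
proof (induction xs)
  case Nil
  then show ?case using u by (intro exI[of _ "[]"]) simp
next
  case (Cons x xs)
  then obtain b where b: "length b = 4 * length xs" "u @ b \<in> reduced_words Y"
    "\<forall>x\<in>set xs. 3 dvd exponent_sum x (u @ b)" by auto
  obtain y' where y': "y' \<in> Y" "y' \<noteq> x" using y[of x] Cons.prems by auto
  obtain c where c: "length c = 4" "(u @ b) @ c \<in> reduced_words Y"
    "3 dvd exponent_sum x ((u @ b) @ c)"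
    "\<forall>z. z \<noteq> x \<longrightarrow> exponent_sum z ((u @ b) @ c) = exponent_sum z (u @ b)"
    using extend_exponent_sum[OF b(2) _ y'] Cons.prems by auto
  have "\<forall>z\<in>set (x # xs). 3 dvd exponent_sum z (u @ (b @ c))"
  proof
    fix z assume "z \<in> set (x # xs)"
    then show "3 dvd exponent_sum z (u @ (b @ c))"
      using c(3,4) b(3) by (cases "z = x") auto
  qed
  then show ?case using b(1) c(1,2) by (intro exI[of _ "b @ c"]) auto
qed

lemma card_reduced_words_ge:
  assumes fin: "finite Y"
  shows "finite {w \<in> reduced_words Y. length w = n} \<and>
    (2 * card Y - 1) ^ n \<le> card {w \<in> reduced_words Y. length w = n}"
proof (induction n)
  case 0
  have "{w \<in> reduced_words Y. length w = 0} = {[]}" by (auto simp: reduced_words_def)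
  then show ?case by simp
next
  case (Suc n)
  let ?R = "\<lambda>n. {w \<in> reduced_words Y. length w = n}"
  define E where "E w = {l \<in> Y \<times> (UNIV :: bool set). w \<noteq> [] \<longrightarrow> hd w \<noteq> inv_letter l}" for w :: "'a word"
  have finE: "finite (E w)" for w using fin by (simp add: E_def)
  have cardE: "2 * card Y - 1 \<le> card (E w)" for w
  proof -
    have "(Y \<times> UNIV) - {inv_letter (hd w)} \<subseteq> E w"
      unfolding E_def by (auto simp del: inv_letter.simps)
    then have "card ((Y \<times> (UNIV :: bool set)) - {inv_letter (hd w)}) \<le> card (E w)"
      by (intro card_mono finE)
    moreover have "card (Y \<times> (UNIV :: bool set)) - 1 \<le> card ((Y \<times> (UNIV :: bool set)) - {inv_letter (hd w)})"
      using diff_card_le_card_Diff[of "{inv_letter (hd w)}" "Y \<times> (UNIV :: bool set)"] by simp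
    ultimately show ?thesis by (simp add: card_cartesian_product)
  qed
  have eq: "?R (Suc n) = (\<lambda>(w, l). l # w) ` (SIGMA w:?R n. E w)"
  proof
    show "?R (Suc n) \<subseteq> (\<lambda>(w, l). l # w) ` (SIGMA w:?R n. E w)"
    proof
      fix v assume v: "v \<in> ?R (Suc n)"
      then obtain l w where lw: "v = l # w" by (cases v) auto
      have "w \<in> ?R n" using v reduced_tl unfolding lw reduced_words_def by auto
      moreover have "l \<in> E w"
        using v unfolding lw reduced_words_def E_def by (cases w) (auto simp: reduced_Cons_Cons)
      ultimately show "v \<in> (\<lambda>(w, l). l # w) ` (SIGMA w:?R n. E w)"
        unfolding lw by (intro image_eqI[of _ _ "(w, l)"]) auto
    qed
    show "(\<lambda>(w, l). l # w) ` (SIGMA w:?R n. E w) \<subseteq> ?R (Suc n)"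
    proof
      fix v assume "v \<in> (\<lambda>(w, l). l # w) ` (SIGMA w:?R n. E w)"
      then obtain w l where wl: "v = l # w" "w \<in> ?R n" "l \<in> E w" by auto
      then show "v \<in> ?R (Suc n)"
        unfolding reduced_words_def E_def by (cases w) (auto simp: reduced_Cons_Cons)
    qed
  qed
  have inj: "inj_on (\<lambda>(w, l). l # w) (SIGMA w:?R n. E w)" by (auto simp: inj_on_def)
  have fS: "finite (SIGMA w:?R n. E w)" using Suc finE by auto
  have "(2 * card Y - 1) ^ Suc n \<le> card (?R n) * (2 * card Y - 1)"
    using Suc by simp
  also have "\<dots> \<le> (\<Sum>w\<in>?R n. card (E w))"
    using sum_bounded_below[of "?R n" "2 * card Y - 1" "\<lambda>w. card (E w)"] cardE by simp
  also have "\<dots> = card (SIGMA w:?R n. E w)" using Suc finE by (subst card_SigmaI) auto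
  also have "\<dots> = card (?R (Suc n))" unfolding eq by (rule card_image[OF inj, symmetric])
  finally show ?case using fS unfolding eq by simp
qed

text \<open>The words over the first \<open>k - 1\<close> generators form a proper free factor. The
  suffix length depends on \<open>k\<close> only, and \<open>u\<close> is the prefix of length
  \<open>n\<close>, so the extension is injective into a single sphere.\<close>

lemma nonprimitive_lower_bound:
  assumes k: "k \<ge> 3"
  shows "(2 * k - 3) ^ n \<le>
    card (factor_elements_of_length k (n + 4 * (k - 1)) - primitives_of_length k (n + 4 * (k - 1)))"
proof -
  let ?Y = "{1..k - 1}" and ?X = "{1..k}"
  let ?R = "{w \<in> reduced_words ?Y. length w = n}"
  let ?N = "n + 4 * (k - 1)"
  have X: "?X = ?Y \<union> {k}" using k by auto
  have F: "free_group_rank k = free_group (?Y \<union> {k})" by (simp only: free_group_rank_def X)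
  have fp: "internal_free_product (free_group_rank k) (reduced_words ?Y) (reduced_words {k})"
    unfolding F using k by (intro internal_free_product_reduced_words) auto
  have carr: "carrier (free_group_rank k) = reduced_words ?X"
    by (simp add: free_group_rank_def free_group_def)
  have "[(k, True)] \<in> reduced_words ?X" "[(k, True)] \<notin> reduced_words ?Y"
    using k by (auto simp: reduced_words_def)
  then have proper: "proper_free_factor (free_group_rank k) (reduced_words ?Y)"
    using fp carr unfolding proper_free_factor_def free_factor_def by blast
  have Yne: "\<exists>y\<in>?Y. y \<noteq> x" if "x \<in> ?Y" for x
  proof (cases "x = 1")
    case True
    then show ?thesis using k by (intro bexI[of _ 2]) auto
  next
    case False
    then show ?thesis using k by (intro bexI[of _ 1]) auto
  qed
  have xs: "set [1..<k] = ?Y" using k by auto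
  have "\<forall>u\<in>reduced_words ?Y. \<exists>b. length b = 4 * (k - 1) \<and> u @ b \<in> reduced_words ?Y \<and>
      (\<forall>x\<in>?Y. 3 dvd exponent_sum x (u @ b))"
    using extend_exponent_sums[OF _ Yne, of _ "[1..<k]"] unfolding xs length_upt by blast
  from bchoice[OF this] obtain b where b:
    "\<forall>u\<in>reduced_words ?Y. length (b u) = 4 * (k - 1) \<and> u @ b u \<in> reduced_words ?Y \<and>
      (\<forall>x\<in>?Y. 3 dvd exponent_sum x (u @ b u))"
    by blast
  have "u @ b u \<in> factor_elements_of_length k ?N - primitives_of_length k ?N" if u: "u \<in> ?R" for u
  proof -
    let ?w = "u @ b u"
    have u': "u \<in> reduced_words ?Y" "length u = n" using u by blast+
    have w: "?w \<in> reduced_words ?Y" "length ?w = ?N" using b u' by simp_all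
    then have wX: "?w \<in> reduced_words ?X" using reduced_words_mono[of ?Y ?X] by auto
    have "3 dvd exponent_sum x ?w" if "x \<in> ?X" for x
    proof (cases "x = k")
      case True
      have sw: "set ?w \<subseteq> ?Y \<times> UNIV" using w(1) unfolding reduced_words_def by blast
      have "fst l \<in> ?Y" if "l \<in> set ?w" for l
        using subsetD[OF sw that] by (simp add: mem_Times_iff)
      moreover have "k \<notin> ?Y" using k by simp
      ultimately have "k \<notin> fst ` set ?w" by blast
      moreover have "exponent_sum k v = 0" if "k \<notin> fst ` set v" for v :: "nat word"
        using that by (induction v) auto
      ultimately have "exponent_sum k ?w = 0" by blast
      then show ?thesis unfolding True by (simp only: dvd_0_right)
    next
      case False
      then have "x \<in> ?Y" using that unfolding atLeastAtMost_iff by linarith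
      then show ?thesis using b u'(1) by blast
    qed
    then have "\<not> primitive_element (free_group_rank k) ?w"
      using wX carr unfolding free_group_rank_def
      by (intro not_primitive_if_exponent_sums_dvd) (auto simp: free_group_rank_def)
    then show ?thesis
      using w wX carr proper unfolding factor_elements_of_length_def primitives_of_length_def by blast
  qed
  then have "(\<lambda>u. u @ b u) ` ?R \<subseteq> factor_elements_of_length k ?N - primitives_of_length k ?N"
    by blast
  then have "card ((\<lambda>u. u @ b u) ` ?R) \<le> card (factor_elements_of_length k ?N - primitives_of_length k ?N)"
    by (intro card_mono finite_Diff finite_factor_elements_of_length)
  moreover have "inj_on (\<lambda>u. u @ b u) ?R" by (auto simp: inj_on_def)
  then have "card ((\<lambda>u. u @ b u) ` ?R) = card ?R" by (rule card_image)
  moreover have "(2 * card ?Y - 1) ^ n \<le> card ?R" using card_reduced_words_ge[of ?Y n] by blast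
  moreover have "2 * card ?Y - 1 = 2 * k - 3" by simp
  ultimately show ?thesis by simp
qed

section \<open>The growth rate\<close>

text \<open>The shift by \<open>c\<close>, the constant \<open>C\<close> and the linear factor all
  disappear under the \<open>N\<close>-th root.\<close>

lemma root_tendsto_growth_rate:
  fixes a :: "nat \<Rightarrow> real" and \<rho> :: real
  assumes \<rho>: "\<rho> \<ge> 1" and lower: "\<And>n. \<rho> ^ n \<le> a (n + c)"
    and upper: "\<And>\<mu>. \<rho> < \<mu> \<Longrightarrow> \<exists>C\<ge>0. \<forall>n. a (Suc n) \<le> C * (real n + 1) * \<mu> ^ n"
  shows "(\<lambda>N. root N (a N)) \<longlonglongrightarrow> \<rho>"
proof (rule order_tendstoI)
  fix x assume x: "x < \<rho>"
  have "(\<lambda>N. \<rho> * root N (1 / \<rho> ^ c)) \<longlonglongrightarrow> \<rho> * 1"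
    using \<rho> by (intro tendsto_intros LIMSEQ_root_const) simp
  then have "eventually (\<lambda>N. x < \<rho> * root N (1 / \<rho> ^ c)) sequentially"
    using x by (intro order_tendstoD(1)) simp_all
  moreover have "eventually (\<lambda>N. N \<ge> c + 1) sequentially" by (rule eventually_ge_at_top)
  ultimately show "eventually (\<lambda>N. x < root N (a N)) sequentially"
  proof eventually_elim
    case (elim N)
    have N: "N > 0" using elim by simp
    have "\<rho> * root N (1 / \<rho> ^ c) = root N (\<rho> ^ N * (1 / \<rho> ^ c))"
      using N \<rho> by (simp add: real_root_mult real_root_power_cancel del: mult_1_right times_divide_eq_right)
    also have "\<rho> ^ N * (1 / \<rho> ^ c) = \<rho> ^ (N - c)"
      using \<rho> elim by (simp add: power_diff)
    also have "root N (\<rho> ^ (N - c)) \<le> root N (a N)"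
      using lower[of "N - c"] elim N by simp
    finally show ?case using elim by linarith
  qed
next
  fix x assume x: "\<rho> < x"
  define \<mu> where "\<mu> = (\<rho> + x) / 2"
  have \<mu>: "\<rho> < \<mu>" "\<mu> < x" "\<mu> \<ge> 1" using x \<rho> by (simp_all add: \<mu>_def)
  obtain C where C: "C \<ge> 0" "\<And>n. a (Suc n) \<le> C * (real n + 1) * \<mu> ^ n"
    using upper[OF \<mu>(1)] by blast
  have "(\<lambda>N. root N (C + 1) * root N (real N) * \<mu>) \<longlonglongrightarrow> 1 * 1 * \<mu>"
    using C(1) by (intro tendsto_intros LIMSEQ_root_const LIMSEQ_root) simp
  then have "eventually (\<lambda>N. root N (C + 1) * root N (real N) * \<mu> < x) sequentially"
    using \<mu> by (intro order_tendstoD(2)) simp_all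
  moreover have "eventually (\<lambda>N. N \<ge> 1) sequentially" by (rule eventually_ge_at_top)
  ultimately show "eventually (\<lambda>N. root N (a N) < x) sequentially"
  proof eventually_elim
    case (elim N)
    obtain n where n: "N = Suc n" using elim by (cases N) auto
    have "a N \<le> C * real N * \<mu> ^ n" using C(2)[of n] n by (simp add: add.commute)
    \<comment> \<open>The constant \<open>C\<close> may be 0, but the \<open>N\<close>-th roots tend
      to 1 only for a positive constant.\<close>
    also have "\<dots> \<le> (C + 1) * real N * \<mu> ^ N"
      using C(1) \<mu>(3) n by (intro mult_mono power_increasing) auto
    finally have "root N (a N) \<le> root N ((C + 1) * real N * \<mu> ^ N)" using elim by simp
    also have "\<dots> = root N (C + 1) * root N (real N) * \<mu>"
      using elim \<mu>(3) by (simp add: real_root_mult real_root_power_cancel)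
    finally show ?case using elim by linarith
  qed
qed

text \<open>A lower bound for the smaller set and an upper bound for the larger one serve both
  limits.\<close>

theorem corollary1p4:
  fixes k :: nat
  assumes "k \<ge> 3"
  shows "((\<lambda>N. root N (real (card (factor_elements_of_length k N)))) \<longlonglongrightarrow> 2 * real k - 3) \<and>
    ((\<lambda>N. root N (real (card (factor_elements_of_length k N - primitives_of_length k N)))) \<longlonglongrightarrow> 2 * real k - 3)"
proof -
  let ?S = "\<lambda>N. factor_elements_of_length k N"
  let ?T = "\<lambda>N. factor_elements_of_length k N - primitives_of_length k N"
  have le: "real (card (?T N)) \<le> real (card (?S N))" for N
    using finite_factor_elements_of_length[of k N] by (simp add: card_mono)
  have upper: "\<exists>C\<ge>0. \<forall>n. real (card (?S (Suc n))) \<le> C * (real n + 1) * \<mu> ^ n"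
    if "2 * real k - 3 < \<mu>" for \<mu>
    using factor_upper_bound[OF assms that] .
  have lower: "(2 * real k - 3) ^ n \<le> real (card (?T (n + 4 * (k - 1))))" for n
  proof -
    have "real ((2 * k - 3) ^ n) \<le> real (card (?T (n + 4 * (k - 1))))"
      using nonprimitive_lower_bound[OF assms, of n] by (rule of_nat_mono)
    then show ?thesis using assms by (simp add: of_nat_diff)
  qed
  have one: "2 * real k - 3 \<ge> 1" using assms by simp
  have "(\<lambda>N. root N (real (card (?S N)))) \<longlonglongrightarrow> 2 * real k - 3"
    using one upper by (rule root_tendsto_growth_rate[OF _ order_trans[OF lower le]])
  moreover have "(\<lambda>N. root N (real (card (?T N)))) \<longlonglongrightarrow> 2 * real k - 3"
  proof (rule root_tendsto_growth_rate[OF one lower])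
    fix \<mu> assume "2 * real k - 3 < \<mu>"
    then obtain C where "C \<ge> 0" "\<And>n. real (card (?S (Suc n))) \<le> C * (real n + 1) * \<mu> ^ n"
      using upper by blast
    then show "\<exists>C\<ge>0. \<forall>n. real (card (?T (Suc n))) \<le> C * (real n + 1) * \<mu> ^ n"
      using order_trans[OF le] by blast
  qed
  ultimately show ?thesis by blast
qed

end
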